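(* Let $d\ge 1$ and let $\phi:\mathbb{R}^d\to\mathbb{R}\cup\{+\infty\}$ be a repulsive pair potential (i.e. $\phi$ is measurable, $\phi(x)=\phi(-x)$ and $\phi(x)\ge 0$ for all $x$) satisfying the Regularity Assumption below. Let $\lambda\ge 0$ and suppose $\phi$ satisfies the Zero-freeness Assumption below at $\lambda_0=\lambda$. Let $\varepsilon\in(0,1)$ and $n\in\mathbb{N}$. Then there is a deterministic algorithm that computes an $\varepsilon$-approximation to $Z_{\Lambda_n}(\lambda)$ with running time at most $\exp(O(\log^3(|\Lambda_n|/\varepsilon)))$, where the implicit constant does not depend on $n$ or $\varepsilon$.
   Context: For a measurable set $S\subset\mathbb{R}^d$ of finite Lebesgue measure $|S|$, the energy of points $x_1,\dots,x_k$ is $H(x_1,\dots,x_k)=\sum_{1\le i<j\le k}\phi(x_i-x_j)$ and the partition function is $Z_S(\lambda)=\sum_{k\ge0}\frac{\lambda^k}{k!}\int_{S^k}e^{-H(x_1,\dots,x_k)}\,dx_1\cdots dx_k$. $\Lambda_n=[-n,n]^d$. An $\varepsilon$-approximation to a number $Z$ is a value $\hat Z$ with $e^{-\varepsilon}\hat Z\le Z\le e^{\varepsilon}\hat Z$. Regularity Assumption: there are an integer $\ell\ge1$, constants $L,R>0$ and compact convex sets $\emptyset=K_0\subset K_1\subset\cdots\subset K_\ell\subset\mathbb{R}^d$ such that, with $\Delta_j=K_j\setminus K_{j-1}$ ($1\le j\le\ell$), the function $x\mapsto e^{-\phi(x)}$ is $L$-Lipschitz on each $\Delta_j$, $\mathrm{supp}(\phi)\subset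 K_\ell\subset[-R,R]^d$, and $[-1/R,1/R]^d\subset K_1$. Computation is in a real-valued model with unit cost for elementary operations, for evaluating $\phi$, and for testing membership of a point in a given $K_j$. Zero-freeness Assumption at $\lambda_0>0$: there exist constants $\delta,C>0$ such that for every bounded measurable $S\subset\mathbb{R}^d$, $Z_S(z)\ne0$ and $\frac{1}{|S|}|\log Z_S(z)|\le C$ for all $z\in\mathcal{N}_\delta([0,\lambda_0])=\{z\in\mathbb{C}: d(z,[0,\lambda_0])<\delta\}$. *)

theory Defs
  imports "HOL-Analysis.Analysis"
begin

section \<open>Repulsive pair potentials and partition functions\<close>

definition repulsive_pair_potential :: "(real ^ 'd \<Rightarrow> ereal) \<Rightarrow> bool" where
  "repulsive_pair_potential \<phi> \<longleftrightarrow>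
     \<phi> \<in> borel_measurable lebesgue \<and> (\<forall>x. \<phi> x = \<phi> (- x)) \<and> (\<forall>x. 0 \<le> \<phi> x)"

text \<open>The map \<open>h \<mapsto> exp (- h)\<close> with \<open>exp (- \<infinity>) = 0\<close>; it is only applied to values \<open>h \<ge> 0\<close>.\<close>

definition exp_neg :: "ereal \<Rightarrow> real" where
  "exp_neg h = (if h = \<infinity> then 0 else exp (- real_of_ereal h))"

definition energy :: "(real ^ 'd \<Rightarrow> ereal) \<Rightarrow> nat \<Rightarrow> (nat \<Rightarrow> real ^ 'd) \<Rightarrow> ereal" where
  "energy \<phi> k x = (\<Sum>j<k. \<Sum>i<j. \<phi> (x i - x j))"

text \<open>
  The completion of the product measure is Lebesgue measure on the \<open>k\<close>-th power of \<open>S\<close>; for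
  \<open>k = 0\<close> it is the point mass, so the zeroth term of the series is \<open>1\<close>. The activity \<open>z\<close> may be
  real or complex.
\<close>

definition partition_function ::
  "(real ^ 'd \<Rightarrow> ereal) \<Rightarrow> (real ^ 'd) set \<Rightarrow> 'a \<Rightarrow> 'a::{real_normed_field, banach}" where
  "partition_function \<phi> S z =
     (\<Sum>k. z ^ k / fact k *
        of_real (LINT x | completion (Pi\<^sub>M {..<k} (\<lambda>_. lebesgue_on S)). exp_neg (energy \<phi> k x)))"

definition centered_cube :: "real \<Rightarrow> (real ^ 'd) set" where
  "centered_cube r = {x. \<forall>i. \<bar>x $ i\<bar> \<le> r}"

definition is_approximation :: "real \<Rightarrow> real \<Rightarrow> real \<Rightarrow> bool" where
  "is_approximation \<epsilon> Zhat Z \<longleftrightarrow> exp (- \<epsilon>) * Zhat \<le> Z \<and> Z \<le> exp \<epsilon> * Zhat"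

definition regularity_assumption ::
  "(real ^ 'd \<Rightarrow> ereal) \<Rightarrow> nat \<Rightarrow> real \<Rightarrow> real \<Rightarrow> (nat \<Rightarrow> (real ^ 'd) set) \<Rightarrow> bool" where
  "regularity_assumption \<phi> l L R K \<longleftrightarrow>
     1 \<le> l \<and> 0 < L \<and> 0 < R \<and>
     K 0 = {} \<and>
     (\<forall>j\<in>{1..l}. compact (K j) \<and> convex (K j) \<and> K (j - 1) \<subseteq> K j \<and>
        L-lipschitz_on (K j - K (j - 1)) (\<lambda>x. exp_neg (\<phi> x))) \<and>
     closure {x. \<phi> x \<noteq> 0} \<subseteq> K l \<and> K l \<subseteq> centered_cube R \<and>
     centered_cube (1 / R) \<subseteq> K 1"

definition segment_nbhd :: "real \<Rightarrow> real \<Rightarrow> complex set" where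
  "segment_nbhd \<delta> a = {z. infdist z (complex_of_real ` {0..a}) < \<delta>}"

text \<open>
  The logarithm of the partition function is the holomorphic branch on the neighbourhood that
  vanishes at \<open>0\<close>, where the partition function equals \<open>1\<close>. For a null set \<open>S\<close> the partition
  function is constantly \<open>1\<close>, and the bound holds trivially since division by zero gives \<open>0\<close>.
\<close>

definition zero_freeness_assumption :: "(real ^ 'd \<Rightarrow> ereal) \<Rightarrow> real \<Rightarrow> bool" where
  "zero_freeness_assumption \<phi> a \<longleftrightarrow>
     (\<exists>\<delta>>0. \<exists>C>0. \<forall>S. bounded S \<and> S \<in> sets lebesgue \<longrightarrow>
        (\<forall>z\<in>segment_nbhd \<delta> a. partition_function \<phi> S z \<noteq> 0) \<and>
        (\<exists>logZ. logZ holomorphic_on segment_nbhd \<delta> a \<and> logZ 0 = 0 \<and>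
           (\<forall>z\<in>segment_nbhd \<delta> a.
              exp (logZ z) = partition_function \<phi> S z \<and>
              1 / measure lebesgue S * cmod (logZ z) \<le> C)))"

section \<open>Deterministic real-valued random access programs\<close>

text \<open>
  A memory assigns a real number to every address. Points of \<open>\<real>\<^sup>d\<close> are handed to the oracles by
  naming, for each coordinate, the cell that holds it; an address map has type \<open>'d \<Rightarrow> nat\<close>, which
  avoids choosing an enumeration of the index type.

  The constants occurring in a program are rational. With arbitrary real constants the answers for
  all inputs could be encoded in the digits of a single constant.
\<close>

datatype 'd test =
    Less nat nat
  | PhiInfinite "'d \<Rightarrow> nat"
  | InK nat "'d \<Rightarrow> nat"

datatype 'd com =
    SKIP
  | Cst nat rat
  | Add nat nat nat
  | Sub nat nat nat
  | Mul nat nat nat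
  | Div nat nat nat
  | Load nat nat
  | Store nat nat
  | Phi nat "'d \<Rightarrow> nat"
  | Seq "'d com" "'d com"
  | Cond "'d test" "'d com" "'d com"
  | While "'d test" "'d com"

type_synonym memory = "nat \<Rightarrow> real"

definition point_at :: "memory \<Rightarrow> ('d::finite \<Rightarrow> nat) \<Rightarrow> real ^ 'd" where
  "point_at s a = (\<chi> i. s (a i))"

fun holds ::
  "(real ^ 'd \<Rightarrow> ereal) \<Rightarrow> nat \<Rightarrow> (nat \<Rightarrow> (real ^ 'd) set) \<Rightarrow> 'd::finite test \<Rightarrow> memory \<Rightarrow> bool"
where
  "holds \<phi> l K (Less x y) s \<longleftrightarrow> s x < s y"
| "holds \<phi> l K (PhiInfinite a) s \<longleftrightarrow> \<phi> (point_at s a) = \<infinity>"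
| "holds \<phi> l K (InK j a) s \<longleftrightarrow> j \<le> l \<and> point_at s a \<in> K j"

text \<open>
  \<open>exec \<phi> l K c s t s'\<close>: started in memory \<open>s\<close>, the program \<open>c\<close> halts after exactly \<open>t\<close> steps in
  memory \<open>s'\<close>. Every instruction and every test costs one step. Indirect addressing gets stuck
  unless the address is a natural number, so that it provides no rounding operation. The
  instruction \<open>Phi\<close> stores \<open>0\<close> where the potential is infinite; \<open>PhiInfinite\<close> detects this case.
\<close>

inductive exec ::
  "(real ^ 'd \<Rightarrow> ereal) \<Rightarrow> nat \<Rightarrow> (nat \<Rightarrow> (real ^ 'd) set) \<Rightarrow>
   'd::finite com \<Rightarrow> memory \<Rightarrow> nat \<Rightarrow> memory \<Rightarrow> bool"
  for \<phi> l K
where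
  Skip: "exec \<phi> l K SKIP s 1 s"
| Cst: "exec \<phi> l K (Cst x q) s 1 (s(x := of_rat q))"
| Add: "exec \<phi> l K (Add x y z) s 1 (s(x := s y + s z))"
| Sub: "exec \<phi> l K (Sub x y z) s 1 (s(x := s y - s z))"
| Mul: "exec \<phi> l K (Mul x y z) s 1 (s(x := s y * s z))"
| Div: "exec \<phi> l K (Div x y z) s 1 (s(x := s y / s z))"
| Load: "s y = real m \<Longrightarrow> exec \<phi> l K (Load x y) s 1 (s(x := s m))"
| Store: "s x = real m \<Longrightarrow> exec \<phi> l K (Store x y) s 1 (s(m := s y))"
| Phi: "exec \<phi> l K (Phi x a) s 1 (s(x := real_of_ereal (\<phi> (point_at s a))))"
| Seq: "exec \<phi> l K c1 s t1 s1 \<Longrightarrow> exec \<phi> l K c2 s1 t2 s2 \<Longrightarrow>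
    exec \<phi> l K (Seq c1 c2) s (t1 + t2) s2"
| CondTrue: "holds \<phi> l K b s \<Longrightarrow> exec \<phi> l K c1 s t s' \<Longrightarrow>
    exec \<phi> l K (Cond b c1 c2) s (1 + t) s'"
| CondFalse: "\<not> holds \<phi> l K b s \<Longrightarrow> exec \<phi> l K c2 s t s' \<Longrightarrow>
    exec \<phi> l K (Cond b c1 c2) s (1 + t) s'"
| WhileFalse: "\<not> holds \<phi> l K b s \<Longrightarrow> exec \<phi> l K (While b c) s 1 s"
| WhileTrue: "holds \<phi> l K b s \<Longrightarrow> exec \<phi> l K c s t1 s1 \<Longrightarrow>
    exec \<phi> l K (While b c) s1 t2 s2 \<Longrightarrow> exec \<phi> l K (While b c) s (1 + t1 + t2) s2"

inductive_cases exec_elims: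
  "exec \<phi> l K SKIP s t s'"
  "exec \<phi> l K (Cst x q) s t s'"
  "exec \<phi> l K (Add x y z) s t s'"
  "exec \<phi> l K (Sub x y z) s t s'"
  "exec \<phi> l K (Mul x y z) s t s'"
  "exec \<phi> l K (Div x y z) s t s'"
  "exec \<phi> l K (Load x y) s t s'"
  "exec \<phi> l K (Store x y) s t s'"
  "exec \<phi> l K (Phi x a) s t s'"
  "exec \<phi> l K (Seq c1 c2) s t s'"
  "exec \<phi> l K (Cond b c1 c2) s t s'"

inductive_cases exec_While_elim: "exec \<phi> l K (While b c) s t s'"

lemma exec_deterministic:
  "exec \<phi> l K c s t s' \<Longrightarrow> exec \<phi> l K c s u s'' \<Longrightarrow> t = u \<and> s' = s''"
proof (induction arbitrary: u s'' rule: exec.induct)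
  case (Seq c1 s t1 s1 c2 t2 s2)
  from Seq.prems obtain u1 r1 u2 where
    1: "exec \<phi> l K c1 s u1 r1" and 2: "exec \<phi> l K c2 r1 u2 s''" and u: "u = u1 + u2"
    by (rule exec_elims)
  from Seq.IH(1)[OF 1] have e: "t1 = u1" "s1 = r1" by simp_all
  from Seq.IH(2)[of u2 s''] 2 e u show ?case by simp
next
  case (CondTrue b s c1 t s' c2)
  from CondTrue.prems obtain v where "exec \<phi> l K c1 s v s''" "u = 1 + v"
    by (rule exec_elims) (use CondTrue.hyps in simp_all)
  with CondTrue.IH[of v s''] show ?case by simp
next
  case (CondFalse b s c2 t s' c1)
  from CondFalse.prems obtain v where "exec \<phi> l K c2 s v s''" "u = 1 + v"
    by (rule exec_elims) (use CondFalse.hyps in simp_all)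
  with CondFalse.IH[of v s''] show ?case by simp
next
  case (WhileFalse b s c)
  from WhileFalse.prems show ?case
    by (rule exec_While_elim) (use WhileFalse.hyps in simp_all)
next
  case (WhileTrue b s c t1 s1 t2 s2)
  from WhileTrue.prems obtain u1 r1 u2 where
    1: "exec \<phi> l K c s u1 r1" and 2: "exec \<phi> l K (While b c) r1 u2 s''" and u: "u = 1 + u1 + u2"
    by (rule exec_While_elim) (use WhileTrue.hyps in simp_all)
  from WhileTrue.IH(1)[OF 1] have e: "t1 = u1" "s1 = r1" by simp_all
  from WhileTrue.IH(2)[of u2 s''] 2 e u show ?case by simp
qed (erule exec_elims, simp)+

text \<open>The inputs \<open>n\<close>, \<open>\<lambda>\<close>, \<open>\<epsilon>\<close> are given in cells 0, 1, 2; the output is read from cell 0.\<close>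

definition input_memory :: "nat \<Rightarrow> real \<Rightarrow> real \<Rightarrow> memory" where
  "input_memory n lam \<epsilon> = (\<lambda>_. 0)(0 := real n, 1 := lam, 2 := \<epsilon>)"

definition computes_within ::
  "(real ^ 'd \<Rightarrow> ereal) \<Rightarrow> nat \<Rightarrow> (nat \<Rightarrow> (real ^ 'd) set) \<Rightarrow>
   'd::finite com \<Rightarrow> memory \<Rightarrow> real \<Rightarrow> real \<Rightarrow> bool" where
  "computes_within \<phi> l K P s v T \<longleftrightarrow> (\<exists>t s'. exec \<phi> l K P s t s' \<and> real t \<le> T \<and> s' 0 = v)"

end

theory Submission
  imports Defs "HOL-Complex_Analysis.Complex_Analysis"
begin

text \<open>
  The logarithm of the partition function is read off from finitely many of its Taylor coefficients
  (Barvinok's interpolation method). A polynomial \<open>q\<close> with rational coefficients and \<open>q 0 = 0\<close>,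
  \<open>q 1 = 1\<close> maps a disc of radius \<open>r > 1\<close> into a thin neighbourhood of \<open>[0, 1]\<close>, so by zero-freeness
  \<open>w \<mapsto> log Z (\<lambda> q w)\<close> is holomorphic on that disc and bounded by \<open>C |\<Lambda>|\<close>. Its Taylor polynomial of
  degree \<open>m = O(log (|\<Lambda>| / \<epsilon>))\<close> at \<open>w = 1\<close> therefore approximates \<open>log Z \<lambda>\<close>, and it is a polynomial
  expression in the first \<open>m\<close> coefficients of \<open>Z\<close>. The \<open>k\<close>-th coefficient is an integral over \<open>\<Lambda>\<^sup>k\<close>
  whose integrand is Lipschitz up to the boundaries of the convex sets \<open>K j\<close>; a small dilation of
  \<open>K j\<close> swallows these boundaries, so a Riemann sum of mesh \<open>1 / Q\<close> has relative error \<open>O(k\<^sup>2 / Q)\<close>.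
  The error is amplified by at most \<open>exp (O(log\<^sup>2))\<close>, hence \<open>Q = exp (O(log\<^sup>2))\<close> suffices and the Riemann
  sums have \<open>Q\<^bsup>O(m)\<^esup> = exp (O(log\<^sup>3))\<close> terms.

  The running time leaves so much room that the algorithm can be a closed formula made of nested
  finite sums and products with at most \<open>exp (O(log\<^sup>3))\<close> terms each. Tuples are enumerated by the base
  \<open>N\<close> digits of a single loop counter, so that no arrays are needed.
\<close>

unbundle no vec_syntax

section \<open>Coefficients of powers and truncated logarithms\<close>

text \<open>Zero-freeness near [0, \<lambda>] says nothing about the disc of radius \<lambda> around
  0, so the Taylor series of log Z at 0 may diverge at \<lambda>; this is why q is needed. The bound
  C |\<Lambda>| on log Z matters as much as the absence of zeros: the truncation error is of order C
  |\<Lambda>| / r ^ m, so a logarithmic degree is enough, and an additive error in log Z is a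
  relative error in Z. The machine shapes the rest. Its constants are rational, so q has rational
  coefficients and \<lambda> is read from the input. It has no rounding, no exponential and no
  logarithm: integers are gained by counting loop rounds, and exp x is replaced by (1 + x / Q) ^ Q
  in the final step, its inverse being used for the Boltzmann factors. A single power of two, Q,
  serves as inverse mesh and as both exponents. The size parameter of the evaluation problem is 2 ^
  (m0 ^ 3), with m0 the rounded binary logarithm of |\<Lambda>| / \<epsilon>. The required running
  time thereby becomes polynomial time, which survives sequencing and any fixed nesting of
  loops.\<close>

definition digit :: "nat \<Rightarrow> nat \<Rightarrow> nat \<Rightarrow> nat" where
  "digit N e i = e div N ^ i mod N"

text \<open>This is the coefficient of \<open>x ^ i\<close> in the \<open>r\<close>-th power of the
  series with coefficients \<open>u\<close>, a sum over the ordered decompositions of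
  \<open>i\<close> into \<open>r\<close> parts. No part exceeds \<open>i\<close>, so base
  \<open>i + 1\<close> digits reach all of them.\<close>

definition power_coeff :: "(nat \<Rightarrow> 'a::comm_semiring_1) \<Rightarrow> nat \<Rightarrow> nat \<Rightarrow> 'a" where
  "power_coeff u r i = (\<Sum>e<(i + 1) ^ r.
     if (\<Sum>t<r. digit (i + 1) e t) = i then \<Prod>t<r. u (digit (i + 1) e t) else 0)"

text \<open>
  The first \<open>m + 1\<close> coefficients of the logarithm of \<open>1 + v\<close>, summed up. The summand for \<open>r = 0\<close>
  vanishes because \<open>x / 0 = 0\<close>.
\<close>

definition log_series_sum :: "(nat \<Rightarrow> 'a::field_char_0) \<Rightarrow> nat \<Rightarrow> 'a" where
  "log_series_sum v m = (\<Sum>i<m + 1. \<Sum>r<i + 1. (- 1) ^ (r + 1) / of_nat r * power_coeff v r i)"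

lemma digit_less: "0 < N \<Longrightarrow> digit N e i < N"
  by (simp add: digit_def)

lemma digit_Suc: "digit N e (Suc i) = digit N (e div N) i"
  by (simp add: digit_def div_mult2_eq)

lemma digit_0: "digit N e 0 = e mod N"
  by (simp add: digit_def)

lemma digits_inj:
  assumes "e < N ^ k" "e' < N ^ k" "\<And>i. i < k \<Longrightarrow> digit N e i = digit N e' i"
  shows "e = e'"
  using assms
proof (induction k arbitrary: e e')
  case (Suc k)
  have "e div N = e' div N"
  proof (rule Suc.IH)
    show "e div N < N ^ k" "e' div N < N ^ k"
      using Suc.prems(1,2) by (simp_all add: less_mult_imp_div_less mult.commute)
    show "digit N (e div N) i = digit N (e' div N) i" if "i < k" for i
      using Suc.prems(3)[of "Suc i"] that by (simp add: digit_Suc)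
  qed
  moreover have "e mod N = e' mod N" using Suc.prems(3)[of 0] by (simp add: digit_0)
  ultimately show ?case by (metis div_mult_mod_eq)
qed simp

text \<open>Surjectivity comes from counting: there are as many tuples as codes below
  \<open>N ^ k\<close>.\<close>

lemma bij_betw_digits:
  assumes "0 < N"
  shows "bij_betw (\<lambda>e. \<lambda>i\<in>{..<k}. digit N e i) {..<N ^ k} (PiE {..<k} (\<lambda>_. {..<N}))"
proof -
  let ?f = "\<lambda>e. \<lambda>i\<in>{..<k}. digit N e i"
  have inj: "inj_on ?f {..<N ^ k}"
  proof (rule inj_onI)
    fix e e' assume e: "e \<in> {..<N ^ k}" "e' \<in> {..<N ^ k}" and eq: "?f e = ?f e'"
    have "digit N e i = digit N e' i" if "i < k" for i
      using fun_cong[OF eq, of i] that by simp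
    with e show "e = e'" by (intro digits_inj[of e N k e']) auto
  qed
  have sub: "?f ` {..<N ^ k} \<subseteq> PiE {..<k} (\<lambda>_. {..<N})"
    using assms by (auto simp: digit_less split: if_splits)
  have "card (?f ` {..<N ^ k}) = card (PiE {..<k} (\<lambda>_. {..<N}))"
    using card_image[OF inj] by (simp add: card_PiE)
  hence "?f ` {..<N ^ k} = PiE {..<k} (\<lambda>_. {..<N})"
    by (intro card_subset_eq finite_PiE sub) auto
  with inj show ?thesis unfolding bij_betw_def by blast
qed

lemma sum_digits:
  assumes "0 < N" and g: "\<And>e. e < N ^ k \<Longrightarrow> h e = g (\<lambda>i\<in>{..<k}. digit N e i)"
  shows "(\<Sum>e<N ^ k. h e) = (\<Sum>\<kappa>\<in>PiE {..<k} (\<lambda>_. {..<N}). g \<kappa>)"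
proof -
  have "(\<Sum>e<N ^ k. h e) = (\<Sum>e<N ^ k. g (\<lambda>i\<in>{..<k}. digit N e i))"
    by (intro sum.cong refl g) auto
  also have "\<dots> = (\<Sum>\<kappa>\<in>PiE {..<k} (\<lambda>_. {..<N}). g \<kappa>)"
    by (rule sum.reindex_bij_betw[OF bij_betw_digits[OF assms(1)]])
  finally show ?thesis .
qed

lemma fps_power_nth_cong:
  fixes F G :: "'a::comm_semiring_1 fps"
  assumes "\<And>j. j \<le> i \<Longrightarrow> F $ j = G $ j"
  shows "(F ^ r) $ i = (G ^ r) $ i"
  using assms
proof (induction r arbitrary: i)
  case (Suc r)
  have "(F ^ r) $ (i - j) = (G ^ r) $ (i - j)" for j
    by (rule Suc.IH) (use Suc.prems in auto)
  with Suc.prems show ?case by (auto simp: fps_mult_nth intro!: sum.cong)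
qed simp

lemma fps_const_prod: "fps_const (\<Prod>t<(r::nat). f t) = (\<Prod>t<r. fps_const (f t :: 'a::comm_ring_1))"
  by (induction r) (simp_all flip: fps_const_mult)

text \<open>Coefficient \<open>i\<close> of a power involves only the coefficients up to
  \<open>i\<close>, so the series may be replaced by the polynomial \<open>F\<close>; expanding its
  power by distributivity gives one summand per tuple of exponents.\<close>

lemma power_coeff_eq_fps:
  fixes u :: "nat \<Rightarrow> 'a::comm_ring_1"
  shows "power_coeff u r i = (Abs_fps u ^ r) $ i"
proof -
  let ?S = "PiE {..<r} (\<lambda>_. {..<i + 1})"
  define F where "F = (\<Sum>j<i + 1. fps_const (u j) * fps_X ^ j)"
  have F: "F $ j = u j" if "j \<le> i" for j
    using that by (simp add: F_def fps_sum_nth if_distrib[of "\<lambda>x. _ * x"] cong: if_cong)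
  have "F ^ r = (\<Prod>t<r. \<Sum>j<i + 1. fps_const (u j) * fps_X ^ j)" by (simp add: F_def)
  also have "\<dots> = (\<Sum>\<kappa>\<in>?S. \<Prod>t<r. fps_const (u (\<kappa> t)) * fps_X ^ \<kappa> t)"
    by (rule prod_sum_PiE) auto
  also have "\<dots> = (\<Sum>\<kappa>\<in>?S. fps_const (\<Prod>t<r. u (\<kappa> t)) * fps_X ^ (\<Sum>t<r. \<kappa> t))"
    by (simp add: prod.distrib fps_const_prod power_sum)
  finally have "(F ^ r) $ i = (\<Sum>\<kappa>\<in>?S. if (\<Sum>t<r. \<kappa> t) = i then \<Prod>t<r. u (\<kappa> t) else 0)"
    by (simp add: fps_sum_nth if_distrib[of "\<lambda>x. _ * x"] eq_commute[of i] cong: if_cong)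
  also have "\<dots> = power_coeff u r i"
    unfolding power_coeff_def by (rule sum_digits[symmetric]) auto
  finally show ?thesis using fps_power_nth_cong[of i "Abs_fps u" F r] F by simp
qed

text \<open>
  The \<open>k\<close>-th coefficient of \<open>Z\<close> has size \<open>|\<Lambda>|\<^sup>k\<close>. Only with the weights \<open>M ^ j\<close> does a product of coefficients
  of total index \<open>i \<le> m\<close> cost \<open>M\<^sup>m\<close>; a uniform bound \<open>M\<^sup>m\<close> would lead to \<open>M\<close> to the power \<open>m\<^sup>2\<close>, that is, to an
  amplification by \<open>exp (O(log\<^sup>3))\<close>.
\<close>

lemma fps_power_nth_bound:
  fixes F :: "'a::{comm_ring_1,real_normed_algebra_1} fps"
  assumes "\<And>j. j \<le> i \<Longrightarrow> norm (F $ j) \<le> M ^ j" "0 \<le> M"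
  shows "norm ((F ^ r) $ i) \<le> (real i + 1) ^ r * M ^ i"
  using assms(1)
proof (induction r arbitrary: i)
  case 0
  then show ?case using assms(2) by (cases i) auto
next
  case (Suc r)
  have "norm ((F ^ Suc r) $ i) \<le> (\<Sum>j=0..i. norm (F $ j * (F ^ r) $ (i - j)))"
    by (simp add: fps_mult_nth norm_sum)
  also have "\<dots> \<le> (\<Sum>j=0..i. (real i + 1) ^ r * M ^ i)"
  proof (rule sum_mono)
    fix j assume j: "j \<in> {0..i}"
    have "norm ((F ^ r) $ (i - j)) \<le> (real (i - j) + 1) ^ r * M ^ (i - j)"
      by (rule Suc.IH) (use Suc.prems in auto)
    also have "\<dots> \<le> (real i + 1) ^ r * M ^ (i - j)"
      using assms(2) by (intro mult_right_mono power_mono) auto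
    finally have *: "norm ((F ^ r) $ (i - j)) \<le> (real i + 1) ^ r * M ^ (i - j)" .
    have "norm (F $ j * (F ^ r) $ (i - j)) \<le> norm (F $ j) * norm ((F ^ r) $ (i - j))"
      by (rule norm_mult_ineq)
    also have "\<dots> \<le> M ^ j * ((real i + 1) ^ r * M ^ (i - j))"
      using * Suc.prems j assms(2) by (intro mult_mono) auto
    also have "\<dots> = (real i + 1) ^ r * M ^ i"
      using j by (simp add: power_add[symmetric] mult.left_commute)
    finally show "norm (F $ j * (F ^ r) $ (i - j)) \<le> (real i + 1) ^ r * M ^ i" .
  qed
  also have "\<dots> = (real i + 1) ^ Suc r * M ^ i" by (simp add: algebra_simps)
  finally show ?case .
qed

text \<open>Telescoping \<open>F * F ^ r - G * G ^ r = (F - G) * F ^ r + G * (F ^ r - G ^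
  r)\<close>: each of the \<open>r\<close> steps contributes one \<open>\<eta>\<close>, each
  convolution a factor of at most \<open>i + 1\<close>, and the weights recombine to
  \<open>M ^ i\<close>.\<close>

lemma fps_power_nth_diff_bound:
  fixes F G :: "'a::{comm_ring_1,real_normed_algebra_1} fps"
  assumes "\<And>j. j \<le> i \<Longrightarrow> norm (F $ j) \<le> M ^ j" "\<And>j. j \<le> i \<Longrightarrow> norm (G $ j) \<le> M ^ j"
    and "\<And>j. j \<le> i \<Longrightarrow> norm (F $ j - G $ j) \<le> \<eta> * M ^ j" and M: "0 \<le> M" and \<eta>: "0 \<le> \<eta>"
  shows "norm ((F ^ r) $ i - (G ^ r) $ i) \<le> real r * (real i + 1) ^ r * M ^ i * \<eta>"
  using assms(1-3)
proof (induction r arbitrary: i)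
  case (Suc r)
  have "(F ^ Suc r) $ i - (G ^ Suc r) $ i =
      (\<Sum>j=0..i. (F $ j - G $ j) * (F ^ r) $ (i - j) + G $ j * ((F ^ r) $ (i - j) - (G ^ r) $ (i - j)))"
    by (simp add: fps_mult_nth sum_subtractf[symmetric] algebra_simps)
  also have "norm \<dots> \<le> (\<Sum>j=0..i. (real i + 1) ^ r * M ^ i * \<eta> + real r * (real i + 1) ^ r * M ^ i * \<eta>)"
  proof (rule sum_norm_le)
    fix j assume j: "j \<in> {0..i}"
    have "norm ((F ^ r) $ (i - j)) \<le> (real (i - j) + 1) ^ r * M ^ (i - j)"
      by (rule fps_power_nth_bound) (use Suc.prems M in auto)
    also have "\<dots> \<le> (real i + 1) ^ r * M ^ (i - j)"
      using M by (intro mult_right_mono power_mono) auto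
    finally have 1: "norm ((F ^ r) $ (i - j)) \<le> (real i + 1) ^ r * M ^ (i - j)" .
    have "norm ((F ^ r) $ (i - j) - (G ^ r) $ (i - j)) \<le> real r * (real (i - j) + 1) ^ r * M ^ (i - j) * \<eta>"
      by (rule Suc.IH) (use Suc.prems in auto)
    also have "\<dots> \<le> real r * (real i + 1) ^ r * M ^ (i - j) * \<eta>"
      using M \<eta> by (intro mult_right_mono mult_left_mono power_mono) auto
    finally have 2: "norm ((F ^ r) $ (i - j) - (G ^ r) $ (i - j)) \<le> real r * (real i + 1) ^ r * M ^ (i - j) * \<eta>" .
    have MM: "M ^ j * M ^ (i - j) = M ^ i" using j by (simp add: power_add[symmetric])
    have "norm ((F $ j - G $ j) * (F ^ r) $ (i - j)) \<le> (\<eta> * M ^ j) * ((real i + 1) ^ r * M ^ (i - j))"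
      using Suc.prems j 1 M \<eta> by (intro order_trans[OF norm_mult_ineq] mult_mono) auto
    moreover have "norm (G $ j * ((F ^ r) $ (i - j) - (G ^ r) $ (i - j))) \<le>
        M ^ j * (real r * (real i + 1) ^ r * M ^ (i - j) * \<eta>)"
      using Suc.prems j 2 M \<eta> by (intro order_trans[OF norm_mult_ineq] mult_mono) auto
    ultimately show "norm ((F $ j - G $ j) * (F ^ r) $ (i - j) + G $ j * ((F ^ r) $ (i - j) - (G ^ r) $ (i - j)))
        \<le> (real i + 1) ^ r * M ^ i * \<eta> + real r * (real i + 1) ^ r * M ^ i * \<eta>"
      unfolding MM[symmetric] by (intro order_trans[OF norm_triangle_ineq]) (simp add: algebra_simps)
  qed
  also have "\<dots> = real (Suc r) * (real i + 1) ^ Suc r * M ^ i * \<eta>" by (simp add: algebra_simps)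
  finally show ?case .
qed simp

lemma log_series_sum_diff_bound:
  fixes v w :: "nat \<Rightarrow> real"
  assumes "\<And>j. j \<le> m \<Longrightarrow> \<bar>v j\<bar> \<le> M ^ j" "\<And>j. j \<le> m \<Longrightarrow> \<bar>w j\<bar> \<le> M ^ j"
    and "\<And>j. j \<le> m \<Longrightarrow> \<bar>v j - w j\<bar> \<le> \<eta> * M ^ j" and M: "1 \<le> M" and \<eta>: "0 \<le> \<eta>"
  shows "\<bar>log_series_sum v m - log_series_sum w m\<bar> \<le> (real m + 1) ^ (m + 2) * M ^ m * \<eta>"
proof -
  let ?B = "(real m + 1) ^ m * M ^ m * \<eta>"
  have B0: "0 \<le> ?B" using M \<eta> by simp
  have tm: "\<bar>(- 1) ^ (r + 1) / of_nat r * power_coeff v r i - (- 1) ^ (r + 1) / of_nat r * power_coeff w r i\<bar> \<le> ?B"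
    if "r \<le> i" "i \<le> m" for r i
  proof (cases "r = 0")
    case False
    have "\<bar>power_coeff v r i - power_coeff w r i\<bar> \<le> real r * (real i + 1) ^ r * M ^ i * \<eta>"
      unfolding power_coeff_eq_fps real_norm_def[symmetric]
      by (rule fps_power_nth_diff_bound) (use assms that in auto)
    also have "\<dots> = real r * ((real i + 1) ^ r * M ^ i * \<eta>)" by simp
    also have "(real i + 1) ^ r * M ^ i * \<eta> \<le> ?B"
    proof (intro mult_right_mono mult_mono)
      have "(real i + 1) ^ r \<le> (real m + 1) ^ r" using that by (intro power_mono) auto
      also have "\<dots> \<le> (real m + 1) ^ m" using that by (intro power_increasing) auto
      finally show "(real i + 1) ^ r \<le> (real m + 1) ^ m" .
      show "M ^ i \<le> M ^ m" using that M by (intro power_increasing) auto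
    qed (use M \<eta> in auto)
    finally have "\<bar>power_coeff v r i - power_coeff w r i\<bar> \<le> real r * ?B" by (simp add: mult_left_mono)
    \<comment> \<open>The factor \<open>real r\<close> from the telescoping is absorbed by the
      coefficient \<open>1 / r\<close> of the logarithm.\<close>
    hence "\<bar>power_coeff v r i - power_coeff w r i\<bar> / real r \<le> ?B" using False by (simp add: field_simps)
    moreover have "\<bar>(- 1) ^ (r + 1) / of_nat r * power_coeff v r i - (- 1) ^ (r + 1) / of_nat r * power_coeff w r i\<bar>
       = \<bar>power_coeff v r i - power_coeff w r i\<bar> / real r"
      by (simp only: right_diff_distrib[symmetric] abs_mult abs_divide power_abs abs_minus_cancel abs_one power_one) simp
    ultimately show ?thesis by simp
  qed (use B0 in simp)
  have "\<bar>log_series_sum v m - log_series_sum w m\<bar> \<le> (\<Sum>i<m + 1. \<Sum>r<i + 1. ?B)"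
    unfolding log_series_sum_def sum_subtractf[symmetric]
    by (intro order_trans[OF sum_abs] sum_mono tm) auto
  \<comment> \<open>Both summations have at most \<open>m + 1\<close> terms, which raises the
    exponent of \<open>m + 1\<close> from \<open>m\<close> to \<open>m + 2\<close>.\<close>
  also have "\<dots> \<le> (\<Sum>i<m + 1. (real m + 1) * ?B)"
    using M \<eta> by (intro sum_mono) (auto intro!: mult_right_mono)
  also have "\<dots> = (real m + 1) ^ (m + 2) * M ^ m * \<eta>" by (simp add: power_add power2_eq_square algebra_simps)
  finally show ?thesis .
qed

text \<open>Since \<open>V - 1\<close> has no constant term, its powers with exponent above
  \<open>i\<close> do not reach coefficient \<open>i\<close>, and the composition with the logarithm
  is a finite double sum.\<close>

lemma fps_ln_compose_nth:
  fixes V :: "complex fps"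
  assumes "V $ 0 = 1"
  shows "(\<Sum>i\<le>m. (fps_ln 1 oo (V - 1)) $ i) = log_series_sum (\<lambda>j. if j = 0 then 0 else V $ j) m"
proof -
  have V: "V - 1 = Abs_fps (\<lambda>j. if j = 0 then 0 else V $ j)"
    using assms by (auto simp: fps_eq_iff)
  have "(fps_ln 1 oo (V - 1)) $ i = (\<Sum>r<i + 1. (- 1) ^ (r + 1) / of_nat r *
      power_coeff (\<lambda>j. if j = 0 then 0 else V $ j) r i)" for i
    unfolding fps_compose_nth power_coeff_eq_fps V[symmetric] fps_ln_nth
    by (intro sum.cong) (auto simp: gr0_conv_Suc)
  then show ?thesis unfolding log_series_sum_def by (simp add: lessThan_Suc_atMost)
qed

text \<open>Formally, the logarithm of \<open>exp G\<close> returns \<open>G\<close> because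
  \<open>G 0 = 0\<close>, so \<open>log_series_sum\<close> is a Taylor partial sum of
  \<open>G\<close> at \<open>1\<close>. Cauchy's estimate on the circle of radius
  \<open>r > 1\<close> bounds coefficient \<open>i\<close> by \<open>B / r ^ i\<close>, and the tail
  is geometric.\<close>

lemma truncated_log_bound:
  assumes G: "G holomorphic_on ball 0 \<rho>" and r: "1 < r" "r < \<rho>"
    and B: "\<And>w. w \<in> cball 0 r \<Longrightarrow> cmod (G w) \<le> B"
    and G0: "G 0 = 0" and V: "(\<lambda>w. exp (G w)) has_fps_expansion V"
  shows "cmod (G 1 - log_series_sum (\<lambda>j. if j = 0 then 0 else V $ j) m) \<le> B / (r - 1) * (1 / r) ^ m"
proof -
  define g where "g = fps_expansion G 0"
  have g: "G has_fps_expansion g"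
    unfolding g_def by (rule has_fps_expansion_fps_expansion[OF _ _ G]) (use r in auto)
  have g0: "g $ 0 = 0" using G0 by (simp add: fps_nth_fps_expansion[OF g])
  have "(exp \<circ> G) has_fps_expansion (fps_exp 1 oo g)"
    by (rule has_fps_expansion_compose[OF has_fps_expansion_exp1 g g0])
  hence Vg: "V = fps_exp 1 oo g" using V by (intro fps_expansion_unique_complex) (auto simp: comp_def)
  have V0: "V $ 0 = 1" unfolding Vg by simp
  have "V - 1 = (fps_exp 1 - 1) oo g" unfolding Vg by (simp add: fps_compose_sub_distrib fps_compose_1)
  moreover have "fps_ln 1 oo ((fps_exp 1 - 1) oo g) = (fps_ln 1 oo (fps_exp 1 - 1)) oo g"
    by (rule fps_compose_assoc) (use g0 in auto)
  moreover have "fps_ln 1 oo (fps_exp 1 - 1) = (fps_X :: complex fps)"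
    by (subst fps_ln_fps_exp_inv) (auto intro!: fps_inv)
  ultimately have "fps_ln 1 oo (V - 1) = g" using g0 by simp
  hence T: "log_series_sum (\<lambda>j. if j = 0 then 0 else V $ j) m = (\<Sum>i<m + 1. g $ i)"
    using fps_ln_compose_nth[OF V0, of m] by (simp add: lessThan_Suc_atMost)
  have gi: "g $ i = (deriv ^^ i) G 0 / fact i" for i by (rule fps_nth_fps_expansion[OF g])
  have "(\<lambda>n. (deriv ^^ n) G 0 / fact n * (1 - 0) ^ n) sums G 1"
    by (rule holomorphic_power_series[OF G]) (use r in auto)
  hence sums: "(\<lambda>i. g $ i) sums G 1" by (simp add: gi)
  have B0: "0 \<le> B" using B[of 0] r norm_ge_zero order_trans by (metis centre_in_cball less_imp_le order_less_trans zero_less_one)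
  have bound: "cmod (g $ i) \<le> B * (1 / r) ^ i" for i
  proof -
    have "cball 0 r \<subseteq> ball 0 \<rho>" using r by auto
    hence "cmod ((deriv ^^ i) G 0) \<le> fact i * B / r ^ i"
      using r G by (intro Cauchy_inequality B) (auto intro: holomorphic_on_subset holomorphic_on_imp_continuous_on
          intro!: B holomorphic_on_imp_continuous_on)
    then show ?thesis unfolding gi by (simp add: norm_divide field_simps)
  qed
  have "(\<lambda>i. g $ (i + (m + 1))) sums (G 1 - (\<Sum>i<m + 1. g $ i))"
    by (rule sums_split_initial_segment[OF sums])
  hence eq: "G 1 - log_series_sum (\<lambda>j. if j = 0 then 0 else V $ j) m = (\<Sum>i. g $ (i + (m + 1)))"
    unfolding T by (simp add: sums_iff)
  have geo: "(\<lambda>i. B * (1 / r) ^ (m + 1) * (1 / r) ^ i) sums (B * (1 / r) ^ (m + 1) * (1 / (1 - 1 / r)))"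
    using r by (intro sums_mult geometric_sums) auto
  have "cmod (\<Sum>i. g $ (i + (m + 1))) \<le> (\<Sum>i. B * (1 / r) ^ (m + 1) * (1 / r) ^ i)"
  proof (rule norm_suminf_le)
    show "cmod (g $ (i + (m + 1))) \<le> B * (1 / r) ^ (m + 1) * (1 / r) ^ i" for i
      using bound[of "i + (m + 1)"] by (simp add: power_add mult_ac)
  qed (use geo in \<open>simp add: sums_iff\<close>)
  also have "\<dots> = B * (1 / r) ^ (m + 1) * (1 / (1 - 1 / r))" using geo by (simp add: sums_iff)
  also have "\<dots> = B / (r - 1) * (1 / r) ^ m" using r by (simp add: field_simps)
  finally show ?thesis unfolding eq .
qed

no_notation fps_nth (infixl "$" 75)
unbundle vec_syntax

section \<open>A polynomial mapping a disc into a neighbourhood of a segment\<close>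

definition list_coeff :: "rat list \<Rightarrow> nat \<Rightarrow> real" where
  "list_coeff qs t = (if t < length qs then of_rat (qs ! t) else 0)"

text \<open>On the closed unit disc the series of \<open>- Ln (1 - \<alpha> w)\<close> is dominated
  by the geometric series in \<open>\<alpha>\<close>, so its partial sums converge uniformly. The
  summand \<open>t = 0\<close> vanishes because division by zero gives \<open>0\<close>.\<close>

lemma truncated_log_near_log:
  fixes \<alpha> :: real
  assumes "0 < \<alpha>" "\<alpha> < 1"
  shows "\<exists>N>1. \<forall>w. cmod w \<le> 1 \<longrightarrow>
    cmod ((\<Sum>t<N. of_real (\<alpha> ^ t / real t) * w ^ t) + Ln (1 - of_real \<alpha> * w)) \<le> 1 / 2"
proof -
  have "summable (\<lambda>n. \<alpha> ^ n)" using assms by (intro summable_geometric) auto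
  from suminf_exist_split[OF _ this, of "1/2"] obtain N0 where
    N0: "\<And>n. n \<ge> N0 \<Longrightarrow> norm (\<Sum>i. \<alpha> ^ (i + n)) < 1 / 2" by auto
  \<comment> \<open>The lower bound 2 keeps the denominators \<open>n + N\<close> of the tail at
    least 1.\<close>
  define N where "N = max N0 2"
  show ?thesis
  proof (intro exI[of _ N] conjI allI impI)
    show "1 < N" by (simp add: N_def)
    fix w :: complex assume w: "cmod w \<le> 1"
    define z where "z = - (of_real \<alpha> * w)"
    have nz: "cmod z \<le> \<alpha>" using w assms by (simp add: z_def norm_mult mult_left_le)
    hence "cmod z < 1" using assms by simp
    from Ln_series'[OF this] have "(\<lambda>n. - ((- z) ^ n / of_nat n)) sums Ln (1 + z)" by simp
    from sums_minus[OF this] have s: "(\<lambda>n. (- z) ^ n / of_nat n) sums (- Ln (1 + z))" by simp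
    have eq: "(\<Sum>t<N. of_real (\<alpha> ^ t / real t) * w ^ t) = (\<Sum>t<N. (- z) ^ t / of_nat t)"
      by (intro sum.cong) (auto simp: z_def power_mult_distrib)
    have "(\<lambda>n. (- z) ^ (n + N) / of_nat (n + N)) sums (- Ln (1 + z) - (\<Sum>t<N. (- z) ^ t / of_nat t))"
      by (rule sums_split_initial_segment[OF s])
    hence "- Ln (1 + z) - (\<Sum>t<N. (- z) ^ t / of_nat t) = (\<Sum>n. (- z) ^ (n + N) / of_nat (n + N))"
      by (simp add: sums_iff)
    moreover have "cmod (\<Sum>n. (- z) ^ (n + N) / of_nat (n + N)) \<le> (\<Sum>n. \<alpha> ^ (n + N))"
    proof (rule norm_suminf_le)
      fix n
      have "cmod ((- z) ^ (n + N) / of_nat (n + N)) = cmod z ^ (n + N) / real (n + N)"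
        by (simp add: norm_divide norm_power del: of_nat_add)
      also have "\<dots> \<le> cmod z ^ (n + N) / 1"
        by (intro divide_left_mono) (auto simp: N_def)
      also have "\<dots> \<le> \<alpha> ^ (n + N)" using nz by (simp add: power_mono)
      finally show "cmod ((- z) ^ (n + N) / of_nat (n + N)) \<le> \<alpha> ^ (n + N)" .
      show "summable (\<lambda>n. \<alpha> ^ (n + N))"
        using \<open>summable (\<lambda>n. \<alpha> ^ n)\<close> by (rule summable_ignore_initial_segment)
    qed
    moreover have "(\<Sum>n. \<alpha> ^ (n + N)) < 1 / 2" using N0[of N] by (simp add: N_def abs_less_iff)
    ultimately have "cmod (- Ln (1 + z) - (\<Sum>t<N. (- z) ^ t / of_nat t)) \<le> 1 / 2" by simp
    moreover have "- Ln (1 + z) - (\<Sum>t<N. (- z) ^ t / of_nat t) =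
        - ((\<Sum>t<N. of_real (\<alpha> ^ t / real t) * w ^ t) + Ln (1 - of_real \<alpha> * w))"
      unfolding eq by (simp add: z_def)
    ultimately show "cmod ((\<Sum>t<N. of_real (\<alpha> ^ t / real t) * w ^ t) + Ln (1 - of_real \<alpha> * w)) \<le> 1 / 2"
      by (metis norm_minus_cancel)
  qed
qed

text \<open>The point \<open>1 - \<alpha> w\<close> lies in the right half-plane and its modulus is
  at most 2, so its argument is below \<open>pi / 2\<close> in absolute value and the logarithm of
  its modulus is at most 1.\<close>

lemma Ln_one_minus_bounds:
  fixes \<alpha> :: real
  assumes "0 < \<alpha>" "\<alpha> < 1" "cmod w \<le> 1"
  shows "Re (Ln (1 - of_real \<alpha> * w)) \<le> 1" "\<bar>Im (Ln (1 - of_real \<alpha> * w))\<bar> \<le> 2"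
proof -
  let ?z = "1 - of_real \<alpha> * w"
  have "cmod (of_real \<alpha> * w) < 1" using assms by (simp add: norm_mult) (metis mult_left_le less_le_trans mult.commute norm_ge_zero order_le_less_trans mult_right_le_one_le less_imp_le)
  hence re: "Re ?z > 0" using abs_Re_le_cmod[of "of_real \<alpha> * w"] by simp
  hence nz: "?z \<noteq> 0" by (metis less_irrefl zero_complex.simps(1))
  have "cmod ?z \<le> 1 + cmod (of_real \<alpha> * w)" by (metis norm_one norm_triangle_ineq4)
  hence "cmod ?z \<le> 2" using \<open>cmod (of_real \<alpha> * w) < 1\<close> by simp
  moreover have "ln (cmod ?z) \<le> cmod ?z - 1" using nz by (intro ln_le_minus_one) simp
  ultimately have "ln (cmod ?z) \<le> 1" by linarith
  then show "Re (Ln ?z) \<le> 1" using nz by simp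
  have "\<bar>Im (Ln ?z)\<bar> < pi / 2" using Re_Ln_pos_lt[OF nz] re by blast
  then show "\<bar>Im (Ln ?z)\<bar> \<le> 2" using pi_less_4 by linarith
qed

text \<open>
  For \<open>\<alpha>\<close> close to \<open>1\<close> the values of \<open>- log (1 - \<alpha> w)\<close> on the unit disc have real part at least \<open>- log 2\<close>
  and bounded imaginary part, whereas the value at \<open>1\<close> is large. The polynomial is a normalized
  partial sum of this function.
\<close>

lemma exists_segment_polynomial:
  fixes \<delta> :: real
  assumes "\<delta> > 0"
  obtains qs :: "rat list" and r :: real where "1 < r" "list_coeff qs 0 = 0"
    "\<forall>t. 0 \<le> list_coeff qs t" "\<forall>t. list_coeff qs t \<le> 1"
    "(\<Sum>t<length qs. list_coeff qs t) = 1"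
    "\<forall>w. cmod w \<le> r \<longrightarrow>
       infdist (\<Sum>t<length qs. of_real (list_coeff qs t) * w ^ t) (complex_of_real ` {0..1}) < \<delta>"
proof -
  \<comment> \<open>With \<open>\<alpha> = 1 - 1 / a\<close> the function takes the value
    \<open>ln a\<close> at \<open>w = 1\<close>. The margin 1 covers the truncation error 1/2, so
    the partial sum \<open>S\<close> still exceeds \<open>4 / \<delta>\<close>.\<close>
  obtain a :: nat where a: "exp (4 / \<delta> + 1) < real a" using reals_Archimedean2 by blast
  have \<delta>4: "4 / \<delta> > 0" using assms by simp
  have a2: "real a > 2"
    using a exp_ge_add_one_self[of "4 / \<delta> + 1"] \<delta>4 by linarith
  \<comment> \<open>The rational twins \<open>\<alpha>'\<close> and \<open>S'\<close> make the
    coefficients of \<open>qs\<close> admissible as program constants.\<close>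
  define \<alpha>' :: rat where "\<alpha>' = 1 - 1 / of_nat a"
  define \<alpha> :: real where "\<alpha> = 1 - 1 / real a"
  have \<alpha>': "of_rat \<alpha>' = \<alpha>" by (simp add: \<alpha>_def \<alpha>'_def of_rat_diff of_rat_divide)
  have \<alpha>: "0 < \<alpha>" "\<alpha> < 1" using a2 by (auto simp: \<alpha>_def field_simps)
  obtain N where N: "N > 1" and near: "\<And>w. cmod w \<le> 1 \<Longrightarrow>
     cmod ((\<Sum>t<N. of_real (\<alpha> ^ t / real t) * w ^ t) + Ln (1 - of_real \<alpha> * w)) \<le> 1 / 2"
    using truncated_log_near_log[OF \<alpha>] by blast
  define S where "S = (\<Sum>t<N. \<alpha> ^ t / real t)"
  define S' :: rat where "S' = (\<Sum>t<N. \<alpha>' ^ t / of_nat t)"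
  have S': "of_rat S' = S" by (simp add: S_def S'_def of_rat_sum of_rat_divide of_rat_power \<alpha>')
  have S: "4 / \<delta> < S"
  proof -
    have "of_real S = (\<Sum>t<N. of_real (\<alpha> ^ t / real t) * (1::complex) ^ t)" by (simp add: S_def)
    moreover have "Ln (1 - of_real \<alpha> * 1) = of_real (- ln (real a))"
    proof -
      have "1 - complex_of_real \<alpha> * 1 = of_real (1 / real a)" by (simp add: \<alpha>_def)
      also have "Ln \<dots> = of_real (ln (1 / real a))" using a2 by (subst Ln_of_real) auto
      finally show ?thesis using a2 by (simp add: ln_div)
    qed
    ultimately have "cmod (of_real S + of_real (- ln (real a))) \<le> 1 / 2" using near[of 1] by simp
    hence "\<bar>S - ln (real a)\<bar> \<le> 1 / 2" by (metis norm_of_real of_real_add add_uminus_conv_diff)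
    moreover have "exp (4 / \<delta> + 1) < exp (ln (real a))" using a a2 by simp
    hence "4 / \<delta> + 1 < ln (real a)" by (simp only: exp_less_cancel_iff)
    ultimately show ?thesis by linarith
  qed
  have Spos: "S > 0" using S \<delta>4 by linarith
  define qs where "qs = map (\<lambda>t. \<alpha>' ^ t / of_nat t / S') [0..<N]"
  have len: "length qs = N" by (simp add: qs_def)
  have coeff: "list_coeff qs t = (if t < N then \<alpha> ^ t / real t / S else 0)" for t
    by (simp add: list_coeff_def qs_def of_rat_divide of_rat_mult of_rat_power \<alpha>' S')
  have nonneg: "0 \<le> list_coeff qs t" for t using \<alpha> Spos by (simp add: coeff)
  have sum1: "(\<Sum>t<length qs. list_coeff qs t) = 1"
  proof -
    have "(\<Sum>t<N. list_coeff qs t) = S / S" unfolding S_def sum_divide_distrib[of _ "{..<N}"] by (simp add: coeff S_def)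
    then show ?thesis using Spos len by simp
  qed
  have le1: "list_coeff qs t \<le> 1" for t
  proof (cases "t < N")
    case True
    have "list_coeff qs t \<le> (\<Sum>t<length qs. list_coeff qs t)"
      using True len nonneg by (intro member_le_sum) auto
    then show ?thesis using sum1 by simp
  qed (simp add: coeff)
  define q where "q w = (\<Sum>t<length qs. of_real (list_coeff qs t) * w ^ t)" for w :: complex
  define J where "J = complex_of_real ` {0..1}"
  have J: "J \<noteq> {}" by (auto simp: J_def)
  have disc: "infdist (q w) J < \<delta>" if w: "cmod w \<le> 1" for w
  proof -
    define P where "P = (\<Sum>t<N. of_real (\<alpha> ^ t / real t) * w ^ t)"
    have qP: "q w = P / of_real S"
      unfolding q_def P_def len sum_divide_distrib by (intro sum.cong) (auto simp: coeff)
    have PL: "cmod (P + Ln (1 - of_real \<alpha> * w)) \<le> 1 / 2" using near[OF w] by (simp add: P_def)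
    have "\<bar>Re P + Re (Ln (1 - of_real \<alpha> * w))\<bar> \<le> 1 / 2" "\<bar>Im P + Im (Ln (1 - of_real \<alpha> * w))\<bar> \<le> 1 / 2"
      using order_trans[OF abs_Re_le_cmod PL] order_trans[OF abs_Im_le_cmod PL] by simp_all
    \<comment> \<open>The bounds 1 and 2 on the logarithm grow by the truncation error 1/2; the sum
      3/2 + 5/2 = 4 is the origin of \<open>4 / \<delta>\<close>.\<close>
    with Ln_one_minus_bounds[OF \<alpha> w] have ReP: "Re P \<ge> - (3 / 2)" and ImP: "\<bar>Im P\<bar> \<le> 5 / 2" by linarith+
    have "cmod P \<le> (\<Sum>t<N. \<alpha> ^ t / real t)"
      unfolding P_def
    proof (rule sum_norm_le)
      fix t
      show "cmod (of_real (\<alpha> ^ t / real t) * w ^ t) \<le> \<alpha> ^ t / real t"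
        using \<alpha> w by (simp add: norm_mult norm_power norm_divide mult_left_le power_le_one divide_right_mono)
    qed
    hence "Re P \<le> S" using complex_Re_le_cmod[of P] by (simp add: S_def)
    \<comment> \<open>The comparison point on the segment is the real part of \<open>q w\<close>,
      raised to 0 if negative. It is at most 1 because the coefficients of \<open>P\<close> are
      nonnegative with sum \<open>S\<close>.\<close>
    define x where "x = max 0 (Re P / S)"
    have x: "x \<in> {0..1}" using \<open>Re P \<le> S\<close> Spos by (auto simp: x_def)
    have "infdist (q w) J \<le> dist (q w) (of_real x)"
      using x by (intro infdist_le) (auto simp: J_def)
    also have "\<dots> \<le> \<bar>Re (q w) - x\<bar> + \<bar>Im (q w)\<bar>"
      unfolding dist_norm using cmod_le[of "q w - of_real x"] by simp
    also have "\<bar>Im (q w)\<bar> \<le> (5 / 2) / S" using divide_right_mono[OF ImP, of S] Spos by (simp add: qP abs_divide)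
    also have "\<bar>Re (q w) - x\<bar> \<le> (3 / 2) / S"
    proof (cases "Re P \<ge> 0")
      case True
      then show ?thesis using Spos by (simp add: qP x_def)
    next
      case False
      hence "x = 0" using Spos by (simp add: x_def divide_nonpos_pos)
      then show ?thesis using divide_right_mono[OF ReP, of S] False Spos by (simp add: qP abs_if divide_neg_pos)
    qed
    also have "(3 / 2) / S + (5 / 2) / S = 4 / S" by (simp add: field_simps)
    also have "\<dots> < \<delta>" using S assms Spos by (simp add: field_simps)
    finally show ?thesis by simp
  qed
  \<comment> \<open>By compactness the strict estimate on the closed unit disc extends to a slightly
    larger disc; this supplies the radius \<open>r > 1\<close>.\<close>
  have "open {w. infdist (q w) J < \<delta>}"
    by (intro open_Collect_less continuous_intros) (auto simp: q_def intro!: continuous_intros)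
  moreover have "cball 0 1 \<subseteq> {w. infdist (q w) J < \<delta>}" using disc by auto
  ultimately obtain e where e: "e > 0" "(\<Union>x\<in>cball 0 1. cball x e) \<subseteq> {w. infdist (q w) J < \<delta>}"
    using compact_subset_open_imp_cball_epsilon_subset[OF compact_cball] by metis
  have big: "infdist (q w) J < \<delta>" if w: "cmod w \<le> 1 + e" for w
  proof (cases "cmod w \<le> 1")
    case False
    define w' where "w' = w / of_real (cmod w)"
    have "cmod w' = 1" using False by (auto simp: w'_def norm_divide)
    moreover have "dist w' w \<le> e"
    proof -
      have "w' - w = w' * of_real (1 - cmod w)" proof -
        have "complex_of_real (cmod w) \<noteq> 0" using False by auto
        then show ?thesis by (simp add: w'_def right_diff_distrib)
      qed
      hence "cmod (w' - w) = \<bar>1 - cmod w\<bar>" using \<open>cmod w' = 1\<close> by (metis mult_1 norm_mult norm_of_real)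
      then show ?thesis using False w by (simp add: dist_norm)
    qed
    ultimately show ?thesis using e(2) by force
  qed (rule disc)
  show thesis
  proof (rule that[of "1 + e" qs])
    show "list_coeff qs 0 = 0" using N by (simp add: coeff)
  qed (use e nonneg le1 sum1 big in \<open>auto simp: q_def J_def\<close>)
qed

section \<open>Computable real functions\<close>

text \<open>
  A frame describes a family of evaluation problems: the admissible parameters, the size in which the
  running time has to be polynomial, and the functions of the parameter whose values are already
  held in memory. Binding a variable turns a loop counter into a further parameter.
\<close>

datatype 'p frame = Frame (params: "'p set") (scale: "'p \<Rightarrow> nat") (vars: "('p \<Rightarrow> real) list")

text \<open>Besides loop counters, embedded by \<open>real\<close>, accumulators are bound in this
  way, with \<open>v = id\<close> and a one-element range.\<close>

definition bind_var :: "'p frame \<Rightarrow> ('p \<Rightarrow> 'a set) \<Rightarrow> ('a \<Rightarrow> real) \<Rightarrow> ('p \<times> 'a) frame" where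
  "bind_var fr A v =
     Frame (Sigma (params fr) A) (\<lambda>q. scale fr (fst q))
       ((\<lambda>q. v (snd q)) # map (\<lambda>w q. w (fst q)) (vars fr))"

lemma bind_var_simps [simp]:
  "params (bind_var fr A v) = Sigma (params fr) A"
  "scale (bind_var fr A v) = (\<lambda>q. scale fr (fst q))"
  "vars (bind_var fr A v) = (\<lambda>q. v (snd q)) # map (\<lambda>w q. w (fst q)) (vars fr)"
  by (simp_all add: bind_var_def)

text \<open>The running times of two programs and an overhead of up to 12 steps fit under one power,
  since \<open>(X + 2) ^ 4\<close> is at least 16.\<close>

lemma two_powers_le: "(X + 2) ^ a + (X + 2) ^ b + 12 \<le> (X + 2 :: nat) ^ (a + b + 4)"
proof -
  have 1: "(X + 2) ^ a \<le> (X + 2 :: nat) ^ (a + b)" "(X + 2) ^ b \<le> (X + 2 :: nat) ^ (a + b)"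
    by (intro power_increasing; simp)+
  have 2: "1 \<le> (X + 2 :: nat) ^ (a + b)" by simp
  have "(2::nat) ^ 4 \<le> (X + 2) ^ 4" by (intro power_mono) auto
  hence "(X + 2) ^ (a + b) * 16 \<le> (X + 2 :: nat) ^ (a + b) * (X + 2) ^ 4" by simp
  also have "\<dots> = (X + 2) ^ (a + b + 4)" by (simp only: power_add)
  finally show ?thesis using 1 2 by linarith
qed

section \<open>Programs whose running time is polynomial in the scale\<close>

locale potential_machine =
  fixes \<phi> :: "real ^ 'd::finite \<Rightarrow> ereal" and l :: nat and K :: "nat \<Rightarrow> (real ^ 'd) set"
begin

text \<open>
  The variables of the frame live in the cells \<open>as\<close>, all of them below \<open>b\<close>; the program may use the cells
  from \<open>b\<close> upwards as scratch space and leaves those below unchanged.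
\<close>

definition achieves ::
  "'p frame \<Rightarrow> nat \<Rightarrow> nat \<Rightarrow> nat list \<Rightarrow> 'd com \<Rightarrow> ('p \<Rightarrow> memory \<Rightarrow> bool) \<Rightarrow> bool" where
  "achieves fr d b as c post \<longleftrightarrow> (\<forall>p\<in>params fr. \<forall>s. map s as = map (\<lambda>w. w p) (vars fr) \<longrightarrow>
     (\<exists>t s'. exec \<phi> l K c s t s' \<and> t \<le> (scale fr p + 2) ^ d \<and> post p s' \<and> (\<forall>i<b. s' i = s i)))"

text \<open>Quantifying over the placement \<open>b\<close>, \<open>as\<close> makes code
  relocatable, so subprograms combine without clashes of cells. The program may depend on the
  placement, the exponent \<open>d\<close> may not, and neither depends on the parameter.\<close>

definition achievable :: "'p frame \<Rightarrow> nat \<Rightarrow> (nat \<Rightarrow> 'p \<Rightarrow> memory \<Rightarrow> bool) \<Rightarrow> bool" where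
  "achievable fr d post \<longleftrightarrow>
     (\<forall>b as. (\<forall>a\<in>set as. a < b) \<longrightarrow> (\<exists>c. achieves fr d b as c (post b)))"

abbreviation stores :: "nat \<Rightarrow> ('p \<Rightarrow> real) \<Rightarrow> 'p \<Rightarrow> memory \<Rightarrow> bool" where
  "stores b f \<equiv> \<lambda>p s. s b = f p"

definition computable :: "'p frame \<Rightarrow> ('p \<Rightarrow> real) \<Rightarrow> bool" where
  "computable fr f \<longleftrightarrow> (\<exists>d. achievable fr d (\<lambda>b. stores b f))"

lemma achievesI:
  assumes "\<And>p s. p \<in> params fr \<Longrightarrow> map s as = map (\<lambda>w. w p) (vars fr) \<Longrightarrow>
     \<exists>t s'. exec \<phi> l K c s t s' \<and> t \<le> (scale fr p + 2) ^ d \<and> post p s' \<and> (\<forall>i<b. s' i = s i)"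
  shows "achieves fr d b as c post"
  using assms unfolding achieves_def by blast

lemma achievesE:
  assumes "achieves fr d b as c post" "p \<in> params fr" "map s as = map (\<lambda>w. w p) (vars fr)"
  obtains t s' where "exec \<phi> l K c s t s'" "t \<le> (scale fr p + 2) ^ d" "post p s'" "\<forall>i<b. s' i = s i"
  using assms unfolding achieves_def by blast

lemma achievableI:
  assumes "\<And>b as. \<forall>a\<in>set as. a < b \<Longrightarrow> \<exists>c. achieves fr d b as c (post b)"
  shows "achievable fr d post"
  using assms unfolding achievable_def by blast

lemma achievableE:
  assumes "achievable fr d post" "\<forall>a\<in>set as. a < b"
  obtains c where "achieves fr d b as c (post b)"
  using assms unfolding achievable_def by blast

lemma computableI: "achievable fr d (\<lambda>b. stores b f) \<Longrightarrow> computable fr f"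
  unfolding computable_def by blast

lemma computableE:
  assumes "computable fr f"
  obtains d where "achievable fr d (\<lambda>b. stores b f)"
  using assms unfolding computable_def by blast

lemma computable_cong:
  assumes "\<And>p. p \<in> params fr \<Longrightarrow> f p = g p"
  shows "computable fr f \<longleftrightarrow> computable fr g"
  unfolding computable_def achievable_def achieves_def using assms by (simp cong: ball_cong)

lemma map_eq_agree:
  assumes "map s as = ys" "\<forall>i<b. s' i = s i" "\<forall>a\<in>set as. a < b"
  shows "map s' as = ys"
  using assms by (auto intro!: map_cong)

lemma achieves_mono:
  assumes "achieves fr d b as c post" "\<And>p s. p \<in> params fr \<Longrightarrow> post p s \<Longrightarrow> post' p s"
  shows "achieves fr d b as c post'"
  using assms unfolding achieves_def by meson

text \<open>Giving \<open>c2\<close> the higher scratch base \<open>b'\<close> protects the results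
  that \<open>c1\<close> left in the cells from \<open>b\<close> to below \<open>b'\<close>.\<close>

lemma achieves_Seq:
  assumes c1: "achieves fr d1 b as c1 post1" and c2: "achieves fr d2 b' as c2 post2"
    and b: "b \<le> b'" and as: "\<forall>a\<in>set as. a < b"
  shows "achieves fr (d1 + d2 + 4) b as (Seq c1 c2)
    (\<lambda>p s'. \<exists>s1. post1 p s1 \<and> post2 p s' \<and> (\<forall>i<b'. s' i = s1 i))"
proof (rule achievesI)
  fix p s assume p: "p \<in> params fr" and s: "map s as = map (\<lambda>w. w p) (vars fr)"
  obtain t1 s1 where 1: "exec \<phi> l K c1 s t1 s1" "t1 \<le> (scale fr p + 2) ^ d1" "post1 p s1" "\<forall>i<b. s1 i = s i"
    by (rule achievesE[OF c1 p s])
  obtain t2 s2 where 2: "exec \<phi> l K c2 s1 t2 s2" "t2 \<le> (scale fr p + 2) ^ d2" "post2 p s2" "\<forall>i<b'. s2 i = s1 i"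
    by (rule achievesE[OF c2 p map_eq_agree[OF s 1(4) as]])
  have "t1 + t2 \<le> (scale fr p + 2) ^ (d1 + d2 + 4)"
    using two_powers_le[of "scale fr p" d1 d2] 1 2 by linarith
  moreover have "\<forall>i<b. s2 i = s i" using 1 2 b by simp
  ultimately show "\<exists>t s'. exec \<phi> l K (Seq c1 c2) s t s' \<and> t \<le> (scale fr p + 2) ^ (d1 + d2 + 4) \<and>
      (\<exists>s1. post1 p s1 \<and> post2 p s' \<and> (\<forall>i<b'. s' i = s1 i)) \<and> (\<forall>i<b. s' i = s i)"
    using exec.Seq[OF 1(1) 2(1)] 1 2 by blast
qed

text \<open>The limit on \<open>k\<close> is the constant of \<open>two_powers_le\<close>, applied
  with second exponent \<open>0\<close>; hence the shape \<open>d + 0 + 4\<close>.\<close>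

lemma achieves_then:
  assumes c: "achieves fr d b as c post" and k: "k \<le> 12"
    and step: "\<And>p s. p \<in> params fr \<Longrightarrow> post p s \<Longrightarrow>
       \<exists>s'. exec \<phi> l K c' s k s' \<and> post' p s' \<and> (\<forall>i<b. s' i = s i)"
  shows "achieves fr (d + 0 + 4) b as (Seq c c') post'"
proof (rule achievesI)
  fix p s assume p: "p \<in> params fr" and s: "map s as = map (\<lambda>w. w p) (vars fr)"
  obtain t1 s1 where 1: "exec \<phi> l K c s t1 s1" "t1 \<le> (scale fr p + 2) ^ d" "post p s1" "\<forall>i<b. s1 i = s i"
    by (rule achievesE[OF c p s])
  from step[OF p 1(3)] obtain s2 where 2: "exec \<phi> l K c' s1 k s2" "post' p s2" "\<forall>i<b. s2 i = s1 i" by blast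
  have "t1 + k \<le> (scale fr p + 2) ^ (d + 0 + 4)"
    using two_powers_le[of "scale fr p" d 0] 1 k by linarith
  moreover have "\<forall>i<b. s2 i = s i" using 1 2 by simp
  ultimately show "\<exists>t s'. exec \<phi> l K (Seq c c') s t s' \<and> t \<le> (scale fr p + 2) ^ (d + 0 + 4) \<and>
      post' p s' \<and> (\<forall>i<b. s' i = s i)"
    using exec.Seq[OF 1(1) 2(1)] 2 by blast
qed

lemma achieves_Cond:
  assumes c: "achieves fr d b as c post" and c1: "achieves fr d1 b as c1 post1"
    and c2: "achieves fr d2 b as c2 post2" and as: "\<forall>a\<in>set as. a < b"
    and test: "\<And>p s. p \<in> params fr \<Longrightarrow> post p s \<Longrightarrow> holds \<phi> l K t s \<longleftrightarrow> B p"
  shows "achieves fr (d + (d1 + d2 + 4) + 4) b as (Seq c (Cond t c1 c2))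
    (\<lambda>p s'. if B p then post1 p s' else post2 p s')"
proof (rule achievesI)
  fix p s assume p: "p \<in> params fr" and s: "map s as = map (\<lambda>w. w p) (vars fr)"
  obtain t0 s0 where 0: "exec \<phi> l K c s t0 s0" "t0 \<le> (scale fr p + 2) ^ d" "post p s0" "\<forall>i<b. s0 i = s i"
    by (rule achievesE[OF c p s])
  note s0 = map_eq_agree[OF s 0(4) as]
  obtain t1 s1 where 1: "exec \<phi> l K c1 s0 t1 s1" "t1 \<le> (scale fr p + 2) ^ d1" "post1 p s1" "\<forall>i<b. s1 i = s0 i"
    by (rule achievesE[OF c1 p s0])
  obtain t2 s2 where 2: "exec \<phi> l K c2 s0 t2 s2" "t2 \<le> (scale fr p + 2) ^ d2" "post2 p s2" "\<forall>i<b. s2 i = s0 i"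
    by (rule achievesE[OF c2 p s0])
  have T: "t0 + (1 + t1) \<le> (scale fr p + 2) ^ (d + (d1 + d2 + 4) + 4)"
    "t0 + (1 + t2) \<le> (scale fr p + 2) ^ (d + (d1 + d2 + 4) + 4)"
    using two_powers_le[of "scale fr p" d1 d2] two_powers_le[of "scale fr p" d "d1 + d2 + 4"] 0 1 2
    by linarith+
  show "\<exists>u s'. exec \<phi> l K (Seq c (Cond t c1 c2)) s u s' \<and> u \<le> (scale fr p + 2) ^ (d + (d1 + d2 + 4) + 4) \<and>
      (if B p then post1 p s' else post2 p s') \<and> (\<forall>i<b. s' i = s i)"
  proof (cases "B p")
    case True
    have "exec \<phi> l K (Seq c (Cond t c1 c2)) s (t0 + (1 + t1)) s1"
      by (rule exec.Seq[OF 0(1) exec.CondTrue[OF _ 1(1)]]) (use True test[OF p 0(3)] in simp)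
    with True T 0 1 show ?thesis by auto
  next
    case False
    have "exec \<phi> l K (Seq c (Cond t c1 c2)) s (t0 + (1 + t2)) s2"
      by (rule exec.Seq[OF 0(1) exec.CondFalse[OF _ 2(1)]]) (use False test[OF p 0(3)] in simp)
    with False T 0 2 show ?thesis by auto
  qed
qed

lemma achieves_SKIP: "achieves fr 0 b as SKIP (\<lambda>_ _. True)"
  unfolding achieves_def using exec.Skip by fastforce

text \<open>There is no copy instruction, so the target is cleared and the source added to it; the
  source must be another cell to survive the clearing.\<close>

lemma exec_move:
  assumes "x \<noteq> y"
  shows "exec \<phi> l K (Seq (Cst x 0) (Add x x y)) s 2 (s(x := s y))"
  using exec.Seq[OF exec.Cst[of \<phi> l K x 0 s] exec.Add[of \<phi> l K x x y]] assms by (simp add: numeral_2_eq_2)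

section \<open>Closure properties of computable functions\<close>

lemma computable_rat: "computable fr (\<lambda>_. of_rat q)"
proof (intro computableI[where d = "0 + 0 + 4"] achievableI exI)
  fix b :: nat and as :: "nat list"
  show "achieves fr (0 + 0 + 4) b as (Seq SKIP (Cst b q)) (stores b (\<lambda>_. of_rat q))"
  proof (rule achieves_then[OF achieves_SKIP, where k = 1])
    fix s
    show "\<exists>s'. exec \<phi> l K (Cst b q) s 1 s' \<and> s' b = of_rat q \<and> (\<forall>i<b. s' i = s i)"
      using exec.Cst[of \<phi> l K b q s] by (intro exI[of _ "s(b := of_rat q)"]) auto
  qed simp
qed

lemma achievable_pair:
  assumes "computable fr f" "computable fr g"
  obtains d where "achievable fr d (\<lambda>b p s. s b = f p \<and> s (Suc b) = g p)"
proof -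
  obtain d1 where F: "achievable fr d1 (\<lambda>b. stores b f)" using assms(1) by (rule computableE)
  obtain d2 where G: "achievable fr d2 (\<lambda>b. stores b g)" using assms(2) by (rule computableE)
  show thesis
  proof (rule that[of "d1 + d2 + 4"], rule achievableI)
    fix b and as :: "nat list" assume as: "\<forall>a\<in>set as. a < b"
    hence as': "\<forall>a\<in>set as. a < Suc b" by (simp add: less_SucI)
    obtain c1 where c1: "achieves fr d1 b as c1 (stores b f)" by (rule achievableE[OF F as])
    obtain c2 where c2: "achieves fr d2 (Suc b) as c2 (stores (Suc b) g)" by (rule achievableE[OF G as'])
    have "achieves fr (d1 + d2 + 4) b as (Seq c1 c2) (\<lambda>p s. s b = f p \<and> s (Suc b) = g p)"
      by (rule achieves_mono[OF achieves_Seq[OF c1 c2 _ as]]) auto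
    then show "\<exists>c. achieves fr (d1 + d2 + 4) b as c (\<lambda>p s. s b = f p \<and> s (Suc b) = g p)" by blast
  qed
qed

lemma computable_binop:
  assumes op: "\<And>x y z s. exec \<phi> l K (I x y z) s 1 (s(x := h (s y) (s z)))"
    and f: "computable fr f" and g: "computable fr g"
  shows "computable fr (\<lambda>p. h (f p) (g p))"
proof -
  obtain d where d: "achievable fr d (\<lambda>b p s. s b = f p \<and> s (Suc b) = g p)"
    using f g by (rule achievable_pair)
  show ?thesis
  proof (rule computableI[where d = "d + 0 + 4"], rule achievableI)
    fix b and as :: "nat list" assume "\<forall>a\<in>set as. a < b"
    then obtain c where c: "achieves fr d b as c (\<lambda>p s. s b = f p \<and> s (Suc b) = g p)"
      by (rule achievableE[OF d])
    have "achieves fr (d + 0 + 4) b as (Seq c (I b b (Suc b))) (stores b (\<lambda>p. h (f p) (g p)))"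
    proof (rule achieves_then[OF c, where k = 1])
      fix p s assume "s b = f p \<and> s (Suc b) = g p"
      then show "\<exists>s'. exec \<phi> l K (I b b (Suc b)) s 1 s' \<and> s' b = h (f p) (g p) \<and> (\<forall>i<b. s' i = s i)"
        using op[of b b "Suc b" s] by (intro exI[of _ "s(b := h (s b) (s (Suc b)))"]) auto
    qed simp
    then show "\<exists>c. achieves fr (d + 0 + 4) b as c (stores b (\<lambda>p. h (f p) (g p)))" by blast
  qed
qed

lemmas computable_add = computable_binop[of Add "(+)", OF exec.Add]
lemmas computable_diff = computable_binop[of Sub "(-)", OF exec.Sub]
lemmas computable_mult = computable_binop[of Mul "(*)", OF exec.Mul]
lemmas computable_divide = computable_binop[of Div "(/)", OF exec.Div]

lemma computable_Cond:
  assumes T: "achievable fr d post" and f: "computable fr f" and g: "computable fr g"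
    and test: "\<And>b p s. p \<in> params fr \<Longrightarrow> post b p s \<Longrightarrow> holds \<phi> l K (t b) s \<longleftrightarrow> B p"
  shows "computable fr (\<lambda>p. if B p then f p else g p)"
proof -
  obtain d1 where F: "achievable fr d1 (\<lambda>b. stores b f)" using f by (rule computableE)
  obtain d2 where G: "achievable fr d2 (\<lambda>b. stores b g)" using g by (rule computableE)
  let ?d = "d + (d1 + d2 + 4) + 4"
  show ?thesis
  proof (rule computableI[where d = ?d], rule achievableI)
    fix b and as :: "nat list" assume as: "\<forall>a\<in>set as. a < b"
    obtain c where c: "achieves fr d b as c (post b)" by (rule achievableE[OF T as])
    obtain c1 where c1: "achieves fr d1 b as c1 (stores b f)" by (rule achievableE[OF F as])
    obtain c2 where c2: "achieves fr d2 b as c2 (stores b g)" by (rule achievableE[OF G as])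
    have "achieves fr ?d b as (Seq c (Cond (t b) c1 c2)) (\<lambda>p s. if B p then s b = f p else s b = g p)"
      by (rule achieves_Cond[OF c c1 c2 as test])
    then have "achieves fr ?d b as (Seq c (Cond (t b) c1 c2)) (stores b (\<lambda>p. if B p then f p else g p))"
      by (rule achieves_mono) (simp split: if_splits)
    then show "\<exists>c. achieves fr ?d b as c (stores b (\<lambda>p. if B p then f p else g p))" by blast
  qed
qed

lemma computable_if_less:
  assumes x: "computable fr x" and y: "computable fr y" and f: "computable fr f" and g: "computable fr g"
  shows "computable fr (\<lambda>p. if x p < y p then f p else g p)"
proof -
  obtain d where d: "achievable fr d (\<lambda>b p s. s b = x p \<and> s (Suc b) = y p)"
    using x y by (rule achievable_pair)
  show ?thesis by (rule computable_Cond[OF d f g, where t = "\<lambda>b. Less b (Suc b)"]) auto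
qed

text \<open>The bound \<open>B\<close> is real and the loop tests \<open>i < B p\<close>, so it
  makes exactly \<open>nat \<lceil>B p\<rceil>\<close> rounds; this is how integers are gained from
  reals. The accumulator ranges over its actual value only, so \<open>g\<close> has to be computable
  only along the run.\<close>

lemma computable_iterate:
  fixes acc :: "'p \<Rightarrow> nat \<Rightarrow> real"
  assumes B: "computable fr B" and a: "computable fr (\<lambda>p. acc p 0)"
    and g: "computable (bind_var (bind_var fr (\<lambda>p. {i. real i < B p}) real) (\<lambda>q. {acc (fst q) (snd q)}) id)
              (\<lambda>q. g (fst (fst q)) (snd (fst q)) (snd q))"
    and acc: "\<And>p i. p \<in> params fr \<Longrightarrow> real i < B p \<Longrightarrow> acc p (Suc i) = g p i (acc p i)"
    and Ble: "\<And>p. p \<in> params fr \<Longrightarrow> B p \<le> real ((scale fr p + 2) ^ e)"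
  shows "computable fr (\<lambda>p. acc p (nat \<lceil>B p\<rceil>))"
proof -
  let ?fr = "bind_var (bind_var fr (\<lambda>p. {i. real i < B p}) real) (\<lambda>q. {acc (fst q) (snd q)}) id"
  obtain d1 where F1: "achievable fr d1 (\<lambda>b. stores b B)" using B by (rule computableE)
  obtain d2 where F2: "achievable fr d2 (\<lambda>b. stores b (\<lambda>p. acc p 0))" using a by (rule computableE)
  obtain d3 where F3: "achievable ?fr d3 (\<lambda>b. stores b (\<lambda>q. g (fst (fst q)) (snd (fst q)) (snd q)))"
    using g by (rule computableE)
  \<comment> \<open>The first summand pays for the initialization. The loop has at most
    \<open>(scale fr p + 2) ^ e\<close> rounds of polynomial cost, hence the sum of exponents in the
    second.\<close>
  define D where "D = ((d2 + d1 + 4) + 0 + 4) + (e + (d3 + 0 + 4)) + 4"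
  show ?thesis
  proof (rule computableI[where d = D], rule achievableI)
    fix b and as :: "nat list" assume as: "\<forall>a\<in>set as. a < b"
    hence as2: "\<forall>a\<in>set as. a < b + 2" by (meson trans_less_add1)
    from as have as4: "\<forall>a\<in>set (b # (b + 1) # as). a < b + 4" by force
    obtain c2 where c2: "achieves fr d2 b as c2 (stores b (\<lambda>p. acc p 0))" by (rule achievableE[OF F2 as])
    obtain c1 where c1: "achieves fr d1 (b + 2) as c1 (stores (b + 2) B)" by (rule achievableE[OF F1 as2])
    obtain c3 where c3: "achieves ?fr d3 (b + 4) (b # (b + 1) # as) c3
        (stores (b + 4) (\<lambda>q. g (fst (fst q)) (snd (fst q)) (snd q)))" by (rule achievableE[OF F3 as4])
    \<comment> \<open>Cell \<open>b\<close> holds the accumulator, \<open>b + 1\<close> the counter,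
      \<open>b + 2\<close> the bound and \<open>b + 3\<close> the constant 1; \<open>c3\<close>
      works from \<open>b + 4\<close> upwards.\<close>
    define body where "body = Seq c3 (Seq (Seq (Cst b 0) (Add b b (b+4))) (Add (b+1) (b+1) (b+3)))"
    define loop where "loop = While (Less (b+1) (b+2)) body"
    define inv where "inv p i s \<longleftrightarrow> s b = acc p i \<and> s (b+1) = real i \<and> s (b+2) = B p \<and> s (b+3) = 1"
      for p i and s :: memory
    have body: "\<exists>t s'. exec \<phi> l K body s t s' \<and> t \<le> (scale fr p + 2) ^ d3 + 3 \<and>
        inv p (Suc i) s' \<and> (\<forall>i<b. s' i = s i)"
      if p: "p \<in> params fr" and s: "map s as = map (\<lambda>w. w p) (vars fr)"
        and i: "real i < B p" "inv p i s" for p s i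
    proof -
      have "map s (b # (b + 1) # as) = map (\<lambda>w. w ((p,i),acc p i)) (vars ?fr)"
        using s i by (simp add: comp_def inv_def)
      moreover have "((p, i), acc p i) \<in> params ?fr" using p i by simp
      ultimately obtain t1 s1 where 1: "exec \<phi> l K c3 s t1 s1" "t1 \<le> (scale fr p + 2) ^ d3"
         "s1 (b+4) = g p i (acc p i)" "\<forall>i<b+4. s1 i = s i"
        using achievesE[OF c3, of "((p, i), acc p i)" s] by auto
      define s2 where "s2 = s1(b := s1 (b+4))"
      have "exec \<phi> l K body s (t1 + (2 + 1)) (s2(b+1 := s2 (b+1) + s2 (b+3)))"
        unfolding body_def s2_def by (intro exec.Seq[OF 1(1)] exec.Seq[OF exec_move] exec.Add) simp
      with 1 i acc[OF p i(1)] show ?thesis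
        by (intro exI[of _ "t1 + (2 + 1)"] exI[of _ "s2(b+1 := s2 (b+1) + s2 (b+3))"])
           (auto simp: s2_def inv_def)
    qed
    \<comment> \<open>Here \<open>j\<close> is the number of remaining rounds.\<close>
    have loop: "\<exists>t s'. exec \<phi> l K loop s t s' \<and> t \<le> j * ((scale fr p + 2) ^ d3 + 4) + 1 \<and>
        s' b = acc p (nat \<lceil>B p\<rceil>) \<and> (\<forall>i<b. s' i = s i)"
      if p: "p \<in> params fr" and s: "map s as = map (\<lambda>w. w p) (vars fr)"
        and i: "i + j = nat \<lceil>B p\<rceil>" "inv p i s" for p s i j
      using s i
    proof (induction j arbitrary: s i)
      case 0
      hence "\<not> real i < B p" by linarith
      hence "exec \<phi> l K loop s 1 s" unfolding loop_def by (intro exec.WhileFalse) (use 0 in \<open>simp add: inv_def\<close>)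
      with 0 show ?case by (intro exI[of _ 1] exI[of _ s]) (auto simp: inv_def)
    next
      case (Suc j)
      hence lt: "real i < B p" by linarith
      from body[OF p Suc.prems(1) lt Suc.prems(3)] obtain t1 s1 where
        1: "exec \<phi> l K body s t1 s1" "t1 \<le> (scale fr p + 2) ^ d3 + 3" "inv p (Suc i) s1" "\<forall>i<b. s1 i = s i"
        by blast
      from Suc.IH[OF map_eq_agree[OF Suc.prems(1) 1(4) as] _ 1(3)] Suc.prems(2) obtain t2 s2 where
        2: "exec \<phi> l K loop s1 t2 s2" "t2 \<le> j * ((scale fr p + 2) ^ d3 + 4) + 1"
        "s2 b = acc p (nat \<lceil>B p\<rceil>)" "\<forall>i<b. s2 i = s1 i"
        by auto
      have "exec \<phi> l K loop s (1 + t1 + t2) s2"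
        unfolding loop_def
        by (rule exec.WhileTrue[OF _ 1(1) 2(1)[unfolded loop_def]]) (use lt Suc.prems in \<open>simp add: inv_def\<close>)
      with 1 2 show ?case by (intro exI[of _ "1 + t1 + t2"] exI[of _ s2]) auto
    qed
    let ?init = "Seq (Cst (b+1) 0) (Cst (b+3) 1)"
    have init: "achieves fr ((d2 + d1 + 4) + 0 + 4) b as (Seq (Seq c2 c1) ?init) (\<lambda>p s'. inv p 0 s')"
    proof (rule achieves_then[OF achieves_Seq[OF c2 c1 _ as], where k = "1 + 1"])
      fix p s assume "\<exists>s1. s1 b = acc p 0 \<and> s (b + 2) = B p \<and> (\<forall>i<b + 2. s i = s1 i)"
      then show "\<exists>s'. exec \<phi> l K ?init s (1 + 1) s' \<and> inv p 0 s' \<and> (\<forall>i<b. s' i = s i)"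
        using exec.Seq[OF exec.Cst[of \<phi> l K "b+1" 0 s] exec.Cst[of \<phi> l K "b+3" 1]]
        by (intro exI[of _ "s(b+1 := 0, b+3 := 1)"]) (auto simp: inv_def)
    qed auto
    have "achieves fr D b as (Seq (Seq (Seq c2 c1) ?init) loop) (stores b (\<lambda>p. acc p (nat \<lceil>B p\<rceil>)))"
    proof (rule achievesI)
      fix p s assume p: "p \<in> params fr" and s: "map s as = map (\<lambda>w. w p) (vars fr)"
      obtain t1 s1 where 1: "exec \<phi> l K (Seq (Seq c2 c1) ?init) s t1 s1"
        "t1 \<le> (scale fr p + 2) ^ ((d2 + d1 + 4) + 0 + 4)" "inv p 0 s1" "\<forall>i<b. s1 i = s i"
        by (rule achievesE[OF init p s])
      from loop[OF p map_eq_agree[OF s 1(4) as] _ 1(3), of "nat \<lceil>B p\<rceil>"] obtain t2 s2 where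
        2: "exec \<phi> l K loop s1 t2 s2" "t2 \<le> nat \<lceil>B p\<rceil> * ((scale fr p + 2) ^ d3 + 4) + 1"
          "s2 b = acc p (nat \<lceil>B p\<rceil>)" "\<forall>i<b. s2 i = s1 i"
        by auto
      have "nat \<lceil>B p\<rceil> \<le> (scale fr p + 2) ^ e"
        using Ble[OF p] by (simp add: ceiling_le_iff nat_le_iff)
      hence "nat \<lceil>B p\<rceil> * ((scale fr p + 2) ^ d3 + 4) \<le> (scale fr p + 2) ^ e * (scale fr p + 2) ^ (d3 + 0 + 4)"
        using two_powers_le[of "scale fr p" d3 0] by (intro mult_mono) auto
      hence "t2 \<le> (scale fr p + 2) ^ (e + (d3 + 0 + 4)) + 1" using 2 unfolding power_add[of _ e] by linarith
      hence "t1 + t2 \<le> (scale fr p + 2) ^ D"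
        using two_powers_le[of "scale fr p" "(d2 + d1 + 4) + 0 + 4" "e + (d3 + 0 + 4)"] 1 2
        unfolding D_def by linarith
      then show "\<exists>t s'. exec \<phi> l K (Seq (Seq (Seq c2 c1) ?init) loop) s t s' \<and> t \<le> (scale fr p + 2) ^ D \<and>
          s' b = acc p (nat \<lceil>B p\<rceil>) \<and> (\<forall>i<b. s' i = s i)"
        using exec.Seq[OF 1(1) 2(1)] 1 2 by (intro exI[of _ "t1 + t2"] exI[of _ s2]) auto
    qed
    then show "\<exists>c. achieves fr D b as c (stores b (\<lambda>p. acc p (nat \<lceil>B p\<rceil>)))" by blast
  qed
qed

lemma computable_weaken:
  assumes "computable fr f"
  shows "computable (bind_var fr A v) (\<lambda>q. f (fst q))"
proof -
  obtain d where F: "achievable fr d (\<lambda>b. stores b f)" using assms by (rule computableE)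
  show ?thesis
  proof (rule computableI[where d = d], rule achievableI)
    fix b and as :: "nat list" assume "\<forall>a\<in>set as. a < b"
    hence "\<forall>a\<in>set (tl as). a < b" by (metis list.sel(2) list.set_sel(2))
    then obtain c where c: "achieves fr d b (tl as) c (stores b f)" by (rule achievableE[OF F])
    have "achieves (bind_var fr A v) d b as c (stores b (\<lambda>q. f (fst q)))"
    proof (rule achievesI)
      fix q s assume q: "q \<in> params (bind_var fr A v)"
        and s: "map s as = map (\<lambda>w. w q) (vars (bind_var fr A v))"
      have "map s (tl as) = map (\<lambda>w. w (fst q)) (vars fr)"
        using s by (cases as) (auto simp: comp_def)
      moreover have "fst q \<in> params fr" using q by auto
      ultimately show "\<exists>t s'. exec \<phi> l K c s t s' \<and> t \<le> (scale (bind_var fr A v) q + 2) ^ d \<and>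
          s' b = f (fst q) \<and> (\<forall>i<b. s' i = s i)"
        using c unfolding achieves_def by auto
    qed
    then show "\<exists>c. achieves (bind_var fr A v) d b as c (stores b (\<lambda>q. f (fst q)))" by blast
  qed
qed

lemma computable_var:
  assumes "v \<in> set (vars fr)"
  shows "computable fr v"
proof -
  obtain j where j: "j < length (vars fr)" "vars fr ! j = v" using assms by (auto simp: in_set_conv_nth)
  show ?thesis
  proof (rule computableI[where d = "1"], rule achievableI)
    fix b and as :: "nat list" assume as: "\<forall>a\<in>set as. a < b"
    have "achieves fr 1 b as (Seq (Cst b 0) (Add b b (as ! j))) (stores b v)"
    proof (rule achievesI)
      fix p s assume s: "map s as = map (\<lambda>w. w p) (vars fr)"
      hence len: "j < length as" using j by (metis length_map)
      hence "as ! j < b" using as by simp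
      moreover have "s (as ! j) = v p" using arg_cong[OF s, of "\<lambda>xs. xs ! j"] len j by simp
      ultimately show "\<exists>t s'. exec \<phi> l K (Seq (Cst b 0) (Add b b (as ! j))) s t s' \<and> t \<le> (scale fr p + 2) ^ 1 \<and>
          s' b = v p \<and> (\<forall>i<b. s' i = s i)"
        using exec_move[of b "as ! j" s] by (intro exI[of _ 2] exI[of _ "s(b := s (as ! j))"]) auto
    qed
    then show "\<exists>c. achieves fr 1 b as c (stores b v)" by blast
  qed
qed

lemma computable_bound: "computable (bind_var fr A v) (\<lambda>q. v (snd q))"
  by (rule computable_var) simp

lemma achievable_coordinates:
  assumes "\<And>f. f \<in> set fs \<Longrightarrow> computable fr f"
  shows "\<exists>d. achievable fr d (\<lambda>b p s'. \<forall>i<length fs. s' (b + i) = (fs ! i) p)"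
  using assms
proof (induction fs)
  case Nil
  have "achievable fr 0 (\<lambda>b p s'. \<forall>i<length []. s' (b + i) = ([] ! i) p)"
    using achieves_SKIP by (intro achievableI exI[of _ SKIP]) simp
  then show ?case by blast
next
  case (Cons f fs)
  have "computable fr f" using Cons.prems by simp
  then obtain d1 where F: "achievable fr d1 (\<lambda>b. stores b f)" by (rule computableE)
  from Cons obtain d2 where G: "achievable fr d2 (\<lambda>b p s'. \<forall>i<length fs. s' (b + i) = (fs ! i) p)" by auto
  have "achievable fr (d1 + d2 + 4) (\<lambda>b p s'. \<forall>i<length (f # fs). s' (b + i) = ((f # fs) ! i) p)"
  proof (rule achievableI)
    fix b and as :: "nat list" assume as: "\<forall>a\<in>set as. a < b"
    hence as': "\<forall>a\<in>set as. a < Suc b" by (simp add: less_SucI)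
    obtain c1 where c1: "achieves fr d1 b as c1 (stores b f)" by (rule achievableE[OF F as])
    obtain c2 where c2: "achieves fr d2 (Suc b) as c2 (\<lambda>p s'. \<forall>i<length fs. s' (Suc b + i) = (fs ! i) p)"
      by (rule achievableE[OF G as'])
    have "achieves fr (d1 + d2 + 4) b as (Seq c1 c2) (\<lambda>p s'. \<forall>i<length (f # fs). s' (b + i) = ((f # fs) ! i) p)"
    proof (rule achieves_mono[OF achieves_Seq[OF c1 c2 _ as]])
      fix p s assume *: "\<exists>s1. s1 b = f p \<and> (\<forall>i<length fs. s (Suc b + i) = (fs ! i) p) \<and> (\<forall>i<Suc b. s i = s1 i)"
      show "\<forall>i<length (f # fs). s (b + i) = ((f # fs) ! i) p"
      proof (intro allI impI)
        fix i assume "i < length (f # fs)"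
        then show "s (b + i) = ((f # fs) ! i) p" using * by (cases i) auto
      qed
    qed simp
    then show "\<exists>c. achieves fr (d1 + d2 + 4) b as c (\<lambda>p s'. \<forall>i<length (f # fs). s' (b + i) = ((f # fs) ! i) p)"
      by blast
  qed
  then show ?case by blast
qed

text \<open>The offsets \<open>adr\<close> come from an enumeration of the index type and do not
  depend on the base \<open>b\<close>, so one address map fits every placement.\<close>

lemma achievable_point:
  fixes f :: "'d \<Rightarrow> 'p \<Rightarrow> real"
  assumes "\<And>i. computable fr (f i)"
  obtains d adr where "achievable fr d (\<lambda>b p s'. point_at s' (\<lambda>i. b + adr i) = (\<chi> i. f i p))"
proof -
  obtain ds where ds: "set ds = (UNIV :: 'd set)" using finite_list[OF finite_class.finite_UNIV] by blast
  have "\<forall>i. \<exists>j<length ds. ds ! j = i" using ds by (metis UNIV_I in_set_conv_nth)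
  then obtain adr where adr: "\<And>i. adr i < length ds" "\<And>i. ds ! (adr i) = i" by metis
  have "\<And>g. g \<in> set (map f ds) \<Longrightarrow> computable fr g" using assms by auto
  from achievable_coordinates[OF this] obtain d where
    d: "achievable fr d (\<lambda>b p s'. \<forall>i<length (map f ds). s' (b + i) = (map f ds ! i) p)" by blast
  have "achievable fr d (\<lambda>b p s'. point_at s' (\<lambda>i. b + adr i) = (\<chi> i. f i p))"
  proof (rule achievableI)
    fix b and as :: "nat list" assume "\<forall>a\<in>set as. a < b"
    then obtain c where "achieves fr d b as c (\<lambda>p s'. \<forall>i<length (map f ds). s' (b + i) = (map f ds ! i) p)"
      by (rule achievableE[OF d])
    then have "achieves fr d b as c (\<lambda>p s'. point_at s' (\<lambda>i. b + adr i) = (\<chi> i. f i p))"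
      by (rule achieves_mono) (use adr in \<open>simp add: point_at_def vec_eq_iff\<close>)
    then show "\<exists>c. achieves fr d b as c (\<lambda>p s'. point_at s' (\<lambda>i. b + adr i) = (\<chi> i. f i p))" by blast
  qed
  then show thesis by (rule that)
qed

lemma computable_potential:
  assumes "\<And>i. computable fr (f i)"
  shows "computable fr (\<lambda>p. real_of_ereal (\<phi> (\<chi> i. f i p)))"
proof -
  obtain d adr where d: "achievable fr d (\<lambda>b p s'. point_at s' (\<lambda>i. b + adr i) = (\<chi> i. f i p))"
    by (rule achievable_point[OF assms])
  show ?thesis
  proof (rule computableI[where d = "d + 0 + 4"], rule achievableI)
    fix b and as :: "nat list" assume "\<forall>a\<in>set as. a < b"
    then obtain c where c: "achieves fr d b as c (\<lambda>p s'. point_at s' (\<lambda>i. b + adr i) = (\<chi> i. f i p))"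
      by (rule achievableE[OF d])
    have "achieves fr (d + 0 + 4) b as (Seq c (Phi b (\<lambda>i. b + adr i)))
        (stores b (\<lambda>p. real_of_ereal (\<phi> (\<chi> i. f i p))))"
    proof (rule achieves_then[OF c, where k = 1])
      fix p s assume "point_at s (\<lambda>i. b + adr i) = (\<chi> i. f i p)"
      with exec.Phi[of \<phi> l K b "\<lambda>i. b + adr i" s]
      show "\<exists>s'. exec \<phi> l K (Phi b (\<lambda>i. b + adr i)) s 1 s' \<and> s' b = real_of_ereal (\<phi> (\<chi> i. f i p)) \<and>
          (\<forall>i<b. s' i = s i)"
        by (intro exI[of _ "s(b := real_of_ereal (\<phi> (\<chi> i. f i p)))"]) auto
    qed simp
    then show "\<exists>c. achieves fr (d + 0 + 4) b as c (stores b (\<lambda>p. real_of_ereal (\<phi> (\<chi> i. f i p))))" by blast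
  qed
qed

lemma computable_if_infinite:
  assumes "\<And>i. computable fr (f i)" and g: "computable fr g" and h: "computable fr h"
  shows "computable fr (\<lambda>p. if \<phi> (\<chi> i. f i p) = \<infinity> then g p else h p)"
proof -
  obtain d adr where d: "achievable fr d (\<lambda>b p s'. point_at s' (\<lambda>i. b + adr i) = (\<chi> i. f i p))"
    by (rule achievable_point[OF assms(1)])
  show ?thesis by (rule computable_Cond[OF d g h, where t = "\<lambda>b. PhiInfinite (\<lambda>i. b + adr i)"]) simp
qed

lemma computable_numeral: "computable fr (\<lambda>_. 0)" "computable fr (\<lambda>_. 1)" "computable fr (\<lambda>_. real n)"
  using computable_rat[of fr 0] computable_rat[of fr 1] computable_rat[of fr "of_nat n"] by simp_all

text \<open>These functions are admissible as numbers of iterations.\<close>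

definition ncomp :: "'p frame \<Rightarrow> ('p \<Rightarrow> nat) \<Rightarrow> bool" where
  "ncomp fr B \<longleftrightarrow> computable fr (\<lambda>p. real (B p)) \<and> (\<exists>e. \<forall>p\<in>params fr. B p \<le> (scale fr p + 2) ^ e)"

lemma ncompD: "ncomp fr B \<Longrightarrow> computable fr (\<lambda>p. real (B p))"
  by (simp add: ncomp_def)

lemma ncomp_mono:
  assumes "ncomp fr B" "computable fr (\<lambda>p. real (A p))" "\<And>p. p \<in> params fr \<Longrightarrow> A p \<le> B p"
  shows "ncomp fr A"
  using assms unfolding ncomp_def by (meson order_trans)

lemma ncomp_const: "ncomp fr (\<lambda>_. n)"
  unfolding ncomp_def
proof (intro conjI exI[of _ n] ballI)
  fix p
  have "n \<le> 2 ^ n" by (rule less_imp_le[OF less_exp])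
  also have "\<dots> \<le> (scale fr p + 2) ^ n" by (intro power_mono) auto
  finally show "n \<le> (scale fr p + 2) ^ n" .
qed (rule computable_numeral)

lemma ncomp_add:
  assumes "ncomp fr A" "ncomp fr B"
  shows "ncomp fr (\<lambda>p. A p + B p)"
proof -
  from assms obtain e1 e2 where "\<forall>p\<in>params fr. A p \<le> (scale fr p + 2) ^ e1"
    "\<forall>p\<in>params fr. B p \<le> (scale fr p + 2) ^ e2" unfolding ncomp_def by blast
  hence "\<forall>p\<in>params fr. A p + B p \<le> (scale fr p + 2) ^ (e1 + e2 + 4)"
    using two_powers_le by (meson add_leD1 add_le_mono order_trans)
  moreover have "computable fr (\<lambda>p. real (A p) + real (B p))"
    by (intro computable_add ncompD assms)
  ultimately show ?thesis unfolding ncomp_def by auto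
qed

lemma ncomp_mult:
  assumes "ncomp fr A" "ncomp fr B"
  shows "ncomp fr (\<lambda>p. A p * B p)"
proof -
  from assms obtain e1 e2 where "\<forall>p\<in>params fr. A p \<le> (scale fr p + 2) ^ e1"
    "\<forall>p\<in>params fr. B p \<le> (scale fr p + 2) ^ e2" unfolding ncomp_def by blast
  hence "\<forall>p\<in>params fr. A p * B p \<le> (scale fr p + 2) ^ (e1 + e2)"
    by (simp add: power_add mult_le_mono)
  moreover have "computable fr (\<lambda>p. real (A p) * real (B p))"
    by (intro computable_mult ncompD assms)
  ultimately show ?thesis unfolding ncomp_def by auto
qed

lemma ncomp_weaken:
  assumes "ncomp fr B"
  shows "ncomp (bind_var fr A v) (\<lambda>q. B (fst q))"
  using assms computable_weaken[of fr "\<lambda>p. real (B p)"] unfolding ncomp_def by auto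

lemma ncomp_bound:
  assumes "ncomp fr B"
  shows "ncomp (bind_var fr (\<lambda>p. {..<B p}) real) (\<lambda>q. snd q)"
  by (rule ncomp_mono[OF ncomp_weaken[OF assms] computable_bound]) auto

lemma computable_fold:
  assumes B: "ncomp fr B"
    and g: "computable (bind_var fr (\<lambda>p. {..<B p}) real) (\<lambda>q. g (fst q) (snd q))"
  shows computable_sum: "computable fr (\<lambda>p. \<Sum>i<B p. g p i)"
    and computable_prod: "computable fr (\<lambda>p. \<Prod>i<B p. g p i)"
proof -
  from B obtain e where e: "\<forall>p\<in>params fr. B p \<le> (scale fr p + 2) ^ e" unfolding ncomp_def by blast
  have B': "computable fr (\<lambda>p. real (B p))" by (rule ncompD[OF B])
  have le: "real (B p) \<le> real ((scale fr p + 2) ^ e)" if "p \<in> params fr" for p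
    using e that of_nat_le_iff by blast
  let ?fr = "bind_var fr (\<lambda>p. {i. real i < real (B p)}) real"
  have g': "computable ?fr (\<lambda>q. g (fst q) (snd q))"
    using g by (simp add: lessThan_def)
  have "computable fr (\<lambda>p. (\<Sum>i<nat \<lceil>real (B p)\<rceil>. g p i))"
    by (rule computable_iterate[where acc = "\<lambda>p k. \<Sum>i<k. g p i" and g = "\<lambda>p i r. r + g p i" and e = e,
          OF B' _ computable_add[OF computable_bound[where v = id, simplified] computable_weaken[OF g']]])
      (use le in \<open>simp_all add: computable_numeral\<close>)
  then show "computable fr (\<lambda>p. \<Sum>i<B p. g p i)" by simp
  have "computable fr (\<lambda>p. (\<Prod>i<nat \<lceil>real (B p)\<rceil>. g p i))"
    by (rule computable_iterate[where acc = "\<lambda>p k. \<Prod>i<k. g p i" and g = "\<lambda>p i r. r * g p i" and e = e,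
          OF B' _ computable_mult[OF computable_bound[where v = id, simplified] computable_weaken[OF g']]])
      (use le in \<open>simp_all add: computable_numeral\<close>)
  then show "computable fr (\<lambda>p. \<Prod>i<B p. g p i)" by simp
qed

lemma computable_power:
  assumes f: "computable fr f" and k: "ncomp fr k"
  shows "computable fr (\<lambda>p. f p ^ k p)"
  using computable_prod[OF k computable_weaken[OF f]] by simp

text \<open>A loop that merely counts its rounds turns a real bound into its ceiling.\<close>

lemma ncomp_ceiling:
  assumes B: "computable fr B" and le: "\<And>p. p \<in> params fr \<Longrightarrow> B p \<le> real ((scale fr p + 2) ^ e)"
  shows "ncomp fr (\<lambda>p. nat \<lceil>B p\<rceil>)"
proof -
  have "computable fr (\<lambda>p. real (nat \<lceil>B p\<rceil>))"
    by (rule computable_iterate[where acc = "\<lambda>p k. real k" and g = "\<lambda>p i r. r + 1" and e = e,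
          OF B _ computable_add[OF computable_bound[where v = id, simplified] computable_numeral(2)]])
      (use le in \<open>simp_all add: computable_numeral\<close>)
  moreover have "nat \<lceil>B p\<rceil> \<le> (scale fr p + 2) ^ e" if "p \<in> params fr" for p
    using le[OF that] by (simp add: ceiling_le_iff nat_le_iff)
  ultimately show ?thesis unfolding ncomp_def by blast
qed

lemma computable_if_nat_less:
  assumes "computable fr (\<lambda>p. real (a p))" "computable fr (\<lambda>p. real (b p))" "computable fr f" "computable fr g"
  shows "computable fr (\<lambda>p. if a p < b p then f p else g p)"
  using computable_if_less[OF assms] by simp

lemma computable_if_nat_eq:
  assumes "computable fr (\<lambda>p. real (a p))" "computable fr (\<lambda>p. real (b p))" "computable fr f" "computable fr g"
  shows "computable fr (\<lambda>p. if a p = b p then f p else g p)"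
proof -
  have "computable fr (\<lambda>p. if a p < b p then g p else if b p < a p then g p else f p)"
    using assms by (intro computable_if_nat_less) auto
  moreover have "(\<lambda>p. if a p < b p then g p else if b p < a p then g p else f p) =
      (\<lambda>p. if a p = b p then f p else g p)" by (auto simp: fun_eq_iff)
  ultimately show ?thesis by simp
qed

text \<open>There is no rounding instruction, so quotients are computed by counting.\<close>

lemma div_eq_sum: "(\<Sum>i<a. if a < Suc i * b then 0 else 1) = (a div b :: nat)" if "0 < b"
proof -
  have "{i. i < a \<and> \<not> a < Suc i * b} = {..<a div b}"
  proof (intro set_eqI iffI)
    fix i assume "i \<in> {i. i < a \<and> \<not> a < Suc i * b}"
    hence "Suc i * b \<le> a" by simp
    hence "Suc i \<le> a div b" using that by (simp add: less_eq_div_iff_mult_less_eq)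
    then show "i \<in> {..<a div b}" by simp
  next
    fix i assume "i \<in> {..<a div b}"
    hence "Suc i \<le> a div b" by simp
    hence "Suc i * b \<le> a" using that by (simp add: less_eq_div_iff_mult_less_eq)
    moreover have "i < a" using \<open>Suc i \<le> a div b\<close> div_le_dividend[of a b] by linarith
    ultimately show "i \<in> {i. i < a \<and> \<not> a < Suc i * b}" by simp
  qed
  moreover have "(\<Sum>i<a. if a < Suc i * b then 0 else 1) = card {i. i < a \<and> \<not> a < Suc i * b}"
    by (subst sum.mono_neutral_cong_right[of "{..<a}" "{i. i < a \<and> \<not> a < Suc i * b}" _ "\<lambda>_. 1::nat"]) auto
  ultimately show ?thesis by simp
qed

lemma ncomp_div:
  assumes a: "ncomp fr a" and b: "ncomp fr b" and pos: "\<And>p. p \<in> params fr \<Longrightarrow> 0 < b p"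
  shows "ncomp fr (\<lambda>p. a p div b p)"
proof (rule ncomp_mono[OF a])
  let ?fr = "bind_var fr (\<lambda>p. {..<a p}) real"
  have "ncomp ?fr (\<lambda>q. (snd q + 1) * b (fst q))"
    by (intro ncomp_mult ncomp_add ncomp_bound ncomp_const a ncomp_weaken[OF b])
  from computable_if_nat_less[OF ncompD[OF ncomp_weaken[OF a]] ncompD[OF this] computable_numeral(1) computable_numeral(2)]
  have "computable ?fr (\<lambda>q. (if a (fst q) < (snd q + 1) * b (fst q) then 0 else 1))" .
  from computable_sum[OF a this]
  have "computable fr (\<lambda>p. \<Sum>i<a p. if a p < (i + 1) * b p then 0 else 1)" .
  moreover have "(\<Sum>i<a p. if a p < (i + 1) * b p then 0 else 1) = real (a p div b p)" if "p \<in> params fr" for p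
    using div_eq_sum[OF pos[OF that], of "a p", symmetric] by (simp add: if_distrib cong: if_cong)
  ultimately show "computable fr (\<lambda>p. real (a p div b p))"
    by (simp cong: computable_cong)
qed auto

lemma ncomp_mod:
  assumes a: "ncomp fr a" and b: "ncomp fr b" and pos: "\<And>p. p \<in> params fr \<Longrightarrow> 0 < b p"
  shows "ncomp fr (\<lambda>p. a p mod b p)"
proof (rule ncomp_mono[OF a])
  have "computable fr (\<lambda>p. real (a p) - real (a p div b p * b p))"
    by (intro computable_diff ncompD ncomp_mult ncomp_div a b pos)
  moreover have "real (a p) - real (a p div b p * b p) = real (a p mod b p)" for p
    using arg_cong[OF div_mult_mod_eq[of "a p" "b p"], of real] unfolding of_nat_add by linarith
  ultimately show "computable fr (\<lambda>p. real (a p mod b p))" by simp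
qed auto

text \<open>A power of admissible numbers may outgrow every polynomial in the scale, so an explicit
  majorant \<open>c\<close> is required; the assumptions on powers in the lemmas below serve as such
  majorants.\<close>

lemma ncomp_power:
  assumes "ncomp fr a" "ncomp fr k" "ncomp fr c" "\<And>p. p \<in> params fr \<Longrightarrow> a p ^ k p \<le> c p"
  shows "ncomp fr (\<lambda>p. a p ^ k p)"
  by (rule ncomp_mono[OF assms(3)]) (use computable_power[OF ncompD[OF assms(1)] assms(2)] assms(4) in auto)

end

section \<open>The closed formula evaluated by the algorithm\<close>

definition coord_index :: "'d::finite \<Rightarrow> nat" where
  "coord_index = (SOME f. bij_betw f UNIV {..<CARD('d)})"

lemma bij_betw_coord_index: "bij_betw (coord_index :: 'd::finite \<Rightarrow> nat) UNIV {..<CARD('d)}"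
proof -
  have "\<exists>f. bij_betw f (UNIV :: 'd set) {..<CARD('d)}"
    using ex_bij_betw_finite_nat[of "UNIV :: 'd set"] by (simp add: atLeast0LessThan)
  then show ?thesis unfolding coord_index_def by (rule someI_ex)
qed

lemma coord_index_less: "coord_index (c :: 'd::finite) < CARD('d)"
  using bij_betw_coord_index[where 'd = 'd] by (auto simp: bij_betw_def)

text \<open>
  The machine has no exponential function; \<open>exp (- x)\<close> is replaced by \<open>(1 + x / Q) ^ (- Q)\<close>.
\<close>

definition boltzmann_approx :: "(real ^ 'd \<Rightarrow> ereal) \<Rightarrow> nat \<Rightarrow> real ^ 'd \<Rightarrow> real" where
  "boltzmann_approx \<phi> Q u =
     (if \<phi> u = \<infinity> then 0 else (1 / (1 + real_of_ereal (\<phi> u) / real Q)) ^ Q)"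

text \<open>
  The Riemann sum for the \<open>k\<close>-th coefficient on the grid of mesh \<open>1 / Q\<close> in \<open>[-n, n]\<^sup>d\<close>. The base \<open>(2nQ)\<^sup>d\<close>
  digits of \<open>e\<close> number the grid points, the base \<open>2nQ\<close> digits of such a number are the coordinates;
  the offset \<open>-n\<close> cancels in the differences.
\<close>

definition grid_coeff :: "(real ^ 'd::finite \<Rightarrow> ereal) \<Rightarrow> nat \<Rightarrow> nat \<Rightarrow> nat \<Rightarrow> real" where
  "grid_coeff \<phi> n Q k =
     (\<Sum>e<((2 * n * Q) ^ CARD('d)) ^ k. \<Prod>j<k. \<Prod>i<j. boltzmann_approx \<phi> Q
        (\<chi> c. real (digit (2 * n * Q) (digit ((2 * n * Q) ^ CARD('d)) e i) (coord_index c)) / real Q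
           - real (digit (2 * n * Q) (digit ((2 * n * Q) ^ CARD('d)) e j) (coord_index c)) / real Q))
     / (real (Q ^ CARD('d)) ^ k * fact k)"

text \<open>Coefficient \<open>j\<close> of \<open>Z (lam * q w)\<close>, with Riemann sums in place
  of the integrals. As \<open>q 0 = 0\<close>, powers \<open>k > j\<close> do not contribute; index
  0 is set to \<open>0\<close> because the logarithm is expanded in \<open>Z - 1\<close>.\<close>

definition composed_coeff ::
  "(real ^ 'd::finite \<Rightarrow> ereal) \<Rightarrow> nat \<Rightarrow> nat \<Rightarrow> real \<Rightarrow> rat list \<Rightarrow> nat \<Rightarrow> real" where
  "composed_coeff \<phi> n Q lam qs j = (if j = 0 then 0 else
     \<Sum>k<j + 1. grid_coeff \<phi> n Q k * lam ^ k * power_coeff (list_coeff qs) k j)"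

context potential_machine
begin

lemma ncomp_digit:
  assumes "ncomp fr N" "ncomp fr e" "ncomp fr i" "ncomp fr B"
    and "\<And>p. p \<in> params fr \<Longrightarrow> 0 < N p" "\<And>p. p \<in> params fr \<Longrightarrow> N p ^ i p \<le> B p"
  shows "ncomp fr (\<lambda>p. digit (N p) (e p) (i p))"
  unfolding digit_def using assms by (intro ncomp_mod ncomp_div ncomp_power[OF assms(1,3,4)]) auto

lemma ncomp_const_power: "ncomp fr f \<Longrightarrow> ncomp fr (\<lambda>p. f p ^ (j :: nat))"
  by (induction j) (simp_all add: ncomp_const ncomp_mult)

lemma ncomp_sum:
  assumes B: "ncomp fr B" and C: "ncomp fr C"
    and g: "ncomp (bind_var fr (\<lambda>p. {..<B p}) real) (\<lambda>q. g (fst q) (snd q))"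
    and le: "\<And>p i. p \<in> params fr \<Longrightarrow> i < B p \<Longrightarrow> g p i \<le> C p"
  shows "ncomp fr (\<lambda>p. \<Sum>i<B p. g p i)"
proof (rule ncomp_mono[OF ncomp_mult[OF B C]])
  show "computable fr (\<lambda>p. real (\<Sum>i<B p. g p i))"
    using computable_sum[OF B ncompD[OF g]] by simp
  fix p assume "p \<in> params fr"
  then show "(\<Sum>i<B p. g p i) \<le> B p * C p"
    using sum_bounded_above[of "{..<B p}" "g p" "C p"] le by auto
qed

text \<open>The coefficients \<open>u p\<close> may themselves be costly. They are requested in the
  frame of the innermost loop and only at admissible indices of size at most \<open>i\<close>, which
  is what keeps their cost polynomial.\<close>

lemma computable_power_coeff:
  assumes r: "ncomp fr r" and i: "ncomp fr i" and ir: "ncomp fr (\<lambda>p. (i p + 1) ^ r p)"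
    and u: "\<And>t. ncomp (bind_var (bind_var fr (\<lambda>p. {..<(i p + 1) ^ r p}) real) (\<lambda>p. {..<r (fst p)}) real) t \<Longrightarrow>
      (\<And>q. fst (fst q) \<in> params fr \<Longrightarrow> t q \<le> i (fst (fst q))) \<Longrightarrow>
      computable (bind_var (bind_var fr (\<lambda>p. {..<(i p + 1) ^ r p}) real) (\<lambda>p. {..<r (fst p)}) real)
        (\<lambda>q. u (fst (fst q)) (t q))"
  shows "computable fr (\<lambda>p. power_coeff (u p) (r p) (i p))"
proof -
  let ?G = "bind_var fr (\<lambda>p. {..<(i p + 1) ^ r p}) real"
  let ?H = "bind_var ?G (\<lambda>p. {..<r (fst p)}) real"
  have i1: "ncomp fr (\<lambda>p. i p + 1)" by (intro ncomp_add i ncomp_const)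
  have iG: "ncomp ?G (\<lambda>q. i (fst q))" and i1G: "ncomp ?G (\<lambda>q. i (fst q) + 1)" and rG: "ncomp ?G (\<lambda>q. r (fst q))"
    and irG: "ncomp ?G (\<lambda>q. (i (fst q) + 1) ^ r (fst q))" and eG: "ncomp ?G (\<lambda>q. snd q)"
    using ncomp_weaken[OF i] ncomp_weaken[OF r] ncomp_weaken[OF ir] ncomp_weaken[OF i1] ncomp_bound[OF ir] by auto
  have dig: "ncomp ?H (\<lambda>q. digit (i (fst (fst q)) + 1) (snd (fst q)) (snd q))"
  proof (rule ncomp_digit[OF ncomp_weaken[OF i1G] ncomp_weaken[OF eG] ncomp_bound[OF rG] ncomp_weaken[OF irG]])
    fix p assume "p \<in> params ?H"
    hence "snd p < r (fst (fst p))" by auto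
    then show "(i (fst (fst p)) + 1) ^ snd p \<le> (i (fst (fst p)) + 1) ^ r (fst (fst p))"
      by (intro power_increasing) auto
  qed auto
  have dlt: "digit (k + 1) e t \<le> k" for k e t
    unfolding digit_def by (metis Suc_eq_plus1 mod_less_divisor zero_less_Suc less_Suc_eq_le)
  have sd: "ncomp ?G (\<lambda>q. \<Sum>t<r (fst q). digit (i (fst q) + 1) (snd q) t)"
    by (rule ncomp_sum[OF rG iG dig]) (use dlt in auto)
  have "computable ?H (\<lambda>q. u (fst (fst q)) (digit (i (fst (fst q)) + 1) (snd (fst q)) (snd q)))"
    by (rule u[OF dig]) (rule dlt)
  from computable_prod[OF rG this]
  have "computable ?G (\<lambda>q. \<Prod>t<r (fst q). u (fst q) (digit (i (fst q) + 1) (snd q) t))" .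
  from computable_sum[OF ir computable_if_nat_eq[OF ncompD[OF sd] ncompD[OF iG] this computable_numeral(1)]]
  show ?thesis unfolding power_coeff_def .
qed

text \<open>The list does not depend on the input, so it is hard-wired as a cascade of tests for the
  index.\<close>

lemma computable_list_coeff:
  assumes "ncomp fr t"
  shows "computable fr (\<lambda>p. list_coeff qs (t p))"
proof (induction qs rule: rev_induct)
  case Nil
  then show ?case by (simp add: list_coeff_def computable_numeral)
next
  case (snoc q qs)
  have "(\<lambda>p. list_coeff (qs @ [q]) (t p)) =
      (\<lambda>p. if t p = length qs then of_rat q else list_coeff qs (t p))"
    by (auto simp: list_coeff_def fun_eq_iff nth_append)
  with computable_if_nat_eq[OF ncompD[OF assms] computable_numeral(3) computable_rat snoc.IH, of "length qs" q]
  show ?case by simp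
qed

lemma computable_fact:
  assumes "ncomp fr k"
  shows "computable fr (\<lambda>p. fact (k p))"
proof -
  have "computable fr (\<lambda>p. \<Prod>i<k p. real i + 1)"
    by (rule computable_prod[OF assms computable_add[OF computable_bound computable_numeral(2)]])
  moreover have "(\<Prod>i<k. real i + 1) = fact k" for k
    by (induction k) (simp_all add: mult.commute add.commute)
  ultimately show ?thesis by simp
qed

lemma computable_boltzmann_approx:
  assumes f: "\<And>c. computable fr (f c)" and Q: "ncomp fr Q"
  shows "computable fr (\<lambda>p. boltzmann_approx \<phi> (Q p) (\<chi> c. f c p))"
  unfolding boltzmann_approx_def
  by (intro computable_if_infinite f computable_numeral computable_power Q computable_divide
       computable_add computable_potential ncompD[OF Q])

text \<open>Assumption \<open>P\<close> bounds the number of summands, one per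
  \<open>k\<close>-tuple of grid points, and also the divisors met when digits are
  extracted.\<close>

lemma computable_grid_coeff:
  fixes fr :: "'p frame"
  assumes n: "ncomp fr n" and Q: "ncomp fr Q" and k: "ncomp fr k"
    and P: "ncomp fr (\<lambda>p. ((2 * n p * Q p) ^ CARD('d)) ^ k p)"
    and pos: "\<And>p. p \<in> params fr \<Longrightarrow> 0 < n p \<and> 0 < Q p"
  shows "computable fr (\<lambda>p. grid_coeff \<phi> (n p) (Q p) (k p))"
proof -
  let ?G = "bind_var fr (\<lambda>p. {..<((2 * n p * Q p) ^ CARD('d)) ^ k p}) real"
  let ?H = "bind_var ?G (\<lambda>p. {..<k (fst p)}) real"
  let ?I = "bind_var ?H (\<lambda>p. {..<snd p}) real"
  let ?N = "\<lambda>q :: (('p \<times> nat) \<times> nat) \<times> nat. 2 * n (fst (fst (fst q))) * Q (fst (fst (fst q)))"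
  let ?Q = "\<lambda>q :: (('p \<times> nat) \<times> nat) \<times> nat. Q (fst (fst (fst q)))"
  let ?P = "\<lambda>q. ?N q ^ CARD('d)"
  have N: "ncomp fr (\<lambda>p. 2 * n p * Q p)" by (intro ncomp_mult ncomp_const n Q)
  note P1 = ncomp_const_power[OF N, of "CARD('d)"]
  have kG: "ncomp ?G (\<lambda>q. k (fst q))" by (rule ncomp_weaken[OF k])
  have jH: "ncomp ?H (\<lambda>q. snd q)" by (rule ncomp_bound[OF kG])
  have iI: "ncomp ?I (\<lambda>q. snd q)" by (rule ncomp_bound[OF jH])
  have jI: "ncomp ?I (\<lambda>q. snd (fst q))" by (rule ncomp_weaken[OF jH])
  have eI: "ncomp ?I (\<lambda>q. snd (fst (fst q)))" by (intro ncomp_weaken ncomp_bound[OF P])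
  have NI: "ncomp ?I (\<lambda>q. ?N q)"
    by (intro ncomp_weaken[OF ncomp_weaken[OF ncomp_weaken[OF N]]])
  have P1I: "ncomp ?I (\<lambda>q. ?P q)"
    by (intro ncomp_weaken[OF ncomp_weaken[OF ncomp_weaken[OF P1]]])
  have PI: "ncomp ?I (\<lambda>q. ?P q ^ k (fst (fst (fst q))))"
    by (intro ncomp_weaken[OF ncomp_weaken[OF ncomp_weaken[OF P]]])
  have QI: "ncomp ?I (\<lambda>q. ?Q q)"
    by (intro ncomp_weaken[OF ncomp_weaken[OF ncomp_weaken[OF Q]]])
  have dig: "ncomp ?I (\<lambda>q. digit (?N q)
      (digit (?P q) (snd (fst (fst q))) (x q)) (coord_index c))"
    if x: "ncomp ?I x" "\<And>q. q \<in> params ?I \<Longrightarrow> x q \<le> k (fst (fst (fst q)))" for x and c :: 'd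
  proof (rule ncomp_digit[OF NI ncomp_digit[OF P1I eI x(1) PI] ncomp_const P1I])
    fix q assume q: "q \<in> params ?I"
    then obtain p where p: "p = fst (fst (fst q))" "p \<in> params fr" by auto
    with pos show "0 < ?N q" "0 < ?P q" by auto
    then show "?P q ^ x q \<le> ?P q ^ k (fst (fst (fst q)))" "?N q ^ coord_index c \<le> ?P q"
      using x(2)[OF q] coord_index_less[of c] by (intro power_increasing; simp)+
  qed
  have "computable ?I (\<lambda>q. boltzmann_approx \<phi> (?Q q)
    (\<chi> c. real (digit (?N q) (digit (?P q) (snd (fst (fst q))) (snd q)) (coord_index c)) / real (?Q q)
     - real (digit (?N q) (digit (?P q) (snd (fst (fst q))) (snd (fst q))) (coord_index c)) / real (?Q q)))"
    by (intro computable_boltzmann_approx QI computable_diff computable_divide ncompD[OF QI]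
        ncompD[OF dig[OF iI]] ncompD[OF dig[OF jI]]) auto
  from computable_prod[OF kG computable_prod[OF jH this]]
  have "computable fr (\<lambda>p. \<Sum>e<((2 * n p * Q p) ^ CARD('d)) ^ k p. \<Prod>j<k p. \<Prod>i<j. boltzmann_approx \<phi> (Q p)
        (\<chi> c. real (digit (2 * n p * Q p) (digit ((2 * n p * Q p) ^ CARD('d)) e i) (coord_index c)) / real (Q p)
           - real (digit (2 * n p * Q p) (digit ((2 * n p * Q p) ^ CARD('d)) e j) (coord_index c)) / real (Q p)))"
    by (rule computable_sum[OF P])
  then show ?thesis
    unfolding grid_coeff_def
    by (intro computable_divide computable_mult computable_power k computable_fact ncompD[OF ncomp_const_power[OF Q]])
qed

lemma computable_composed_coeff:
  assumes n: "ncomp fr n" and Q: "ncomp fr Q" and j: "ncomp fr j"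
    and P: "ncomp fr (\<lambda>p. ((2 * n p * Q p) ^ CARD('d)) ^ j p)"
    and jj: "ncomp fr (\<lambda>p. (j p + 1) ^ j p)"
    and lam: "computable fr (\<lambda>_. lam)"
    and pos: "\<And>p. p \<in> params fr \<Longrightarrow> 0 < n p \<and> 0 < Q p"
  shows "computable fr (\<lambda>p. composed_coeff \<phi> (n p) (Q p) lam qs (j p))"
proof -
  have j1: "ncomp fr (\<lambda>p. j p + 1)" by (intro ncomp_add j ncomp_const)
  let ?G = "bind_var fr (\<lambda>p. {..<j p + 1}) real"
  have P1: "ncomp fr (\<lambda>p. (2 * n p * Q p) ^ CARD('d))" by (intro ncomp_const_power ncomp_mult ncomp_const n Q)
  have kG: "ncomp ?G (\<lambda>q. snd q)" by (rule ncomp_bound[OF j1])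
  have 1: "ncomp ?G (\<lambda>q. ((2 * n (fst q) * Q (fst q)) ^ CARD('d)) ^ snd q)"
  proof (rule ncomp_power[OF ncomp_weaken[OF P1] kG ncomp_weaken[OF P]])
    fix q assume "q \<in> params ?G"
    with pos show "((2 * n (fst q) * Q (fst q)) ^ CARD('d)) ^ snd q \<le> ((2 * n (fst q) * Q (fst q)) ^ CARD('d)) ^ j (fst q)"
      by (intro power_increasing) (auto simp: Suc_le_eq)
  qed
  have 2: "ncomp ?G (\<lambda>q. (j (fst q) + 1) ^ snd q)"
  proof (rule ncomp_power[OF ncomp_weaken[OF j1] kG ncomp_weaken[OF jj]])
    fix q assume "q \<in> params ?G"
    then show "(j (fst q) + 1) ^ snd q \<le> (j (fst q) + 1) ^ j (fst q)"
      by (intro power_increasing) auto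
  qed
  have "computable ?G (\<lambda>q. grid_coeff \<phi> (n (fst q)) (Q (fst q)) (snd q))"
    by (rule computable_grid_coeff[OF ncomp_weaken[OF n] ncomp_weaken[OF Q] kG 1]) (use pos in auto)
  moreover have "computable ?G (\<lambda>q. power_coeff (list_coeff qs) (snd q) (j (fst q)))"
    by (rule computable_power_coeff[OF kG ncomp_weaken[OF j] 2]) (rule computable_list_coeff)
  ultimately have "computable ?G (\<lambda>q. grid_coeff \<phi> (n (fst q)) (Q (fst q)) (snd q) * lam ^ snd q *
      power_coeff (list_coeff qs) (snd q) (j (fst q)))"
    using computable_weaken[OF lam] by (intro computable_mult computable_power kG)
  from computable_if_nat_eq[where b = "\<lambda>_. 0", OF ncompD[OF j] computable_numeral(3) computable_numeral(1)
      computable_sum[OF j1 this]]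
  show ?thesis unfolding composed_coeff_def .
qed

lemma computable_log_series_sum:
  fixes fr :: "'p frame"
  assumes n: "ncomp fr n" and Q: "ncomp fr Q" and m: "ncomp fr m"
    and P: "ncomp fr (\<lambda>p. ((2 * n p * Q p) ^ CARD('d)) ^ m p)"
    and mm: "ncomp fr (\<lambda>p. (m p + 1) ^ m p)"
    and lam: "computable fr (\<lambda>_. lam)"
    and pos: "\<And>p. p \<in> params fr \<Longrightarrow> 0 < n p \<and> 0 < Q p"
  shows "computable fr (\<lambda>p. log_series_sum (composed_coeff \<phi> (n p) (Q p) lam qs) (m p))"
proof -
  have m1: "ncomp fr (\<lambda>p. m p + 1)" by (intro ncomp_add m ncomp_const)
  let ?G = "bind_var fr (\<lambda>p. {..<m p + 1}) real"
  have iG: "ncomp ?G (\<lambda>q. snd q)" by (rule ncomp_bound[OF m1])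
  have i1G: "ncomp ?G (\<lambda>q. snd q + 1)" by (intro ncomp_add iG ncomp_const)
  let ?H = "bind_var ?G (\<lambda>q. {..<snd q + 1}) real"
  have rH: "ncomp ?H (\<lambda>q. snd q)" by (rule ncomp_bound[OF i1G])
  have r1H: "ncomp ?H (\<lambda>q. snd q + 1)" by (intro ncomp_add rH ncomp_const)
  have iH: "ncomp ?H (\<lambda>q. snd (fst q))" by (rule ncomp_weaken[OF iG])
  have i1H: "ncomp ?H (\<lambda>q. snd (fst q) + 1)" by (rule ncomp_weaken[OF i1G])
  have mmH: "ncomp ?H (\<lambda>q. (m (fst (fst q)) + 1) ^ m (fst (fst q)))"
    by (rule ncomp_weaken[OF ncomp_weaken[OF mm]])
  have irH: "ncomp ?H (\<lambda>q. (snd (fst q) + 1) ^ snd q)"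
  proof (rule ncomp_power[OF i1H rH mmH])
    fix q assume "q \<in> params ?H"
    hence le: "snd (fst q) \<le> m (fst (fst q))" "snd q \<le> m (fst (fst q))" by auto
    have "(snd (fst q) + 1) ^ snd q \<le> (m (fst (fst q)) + 1) ^ snd q" using le by (intro power_mono) auto
    also have "\<dots> \<le> (m (fst (fst q)) + 1) ^ m (fst (fst q))" using le by (intro power_increasing) auto
    finally show "(snd (fst q) + 1) ^ snd q \<le> (m (fst (fst q)) + 1) ^ m (fst (fst q))" .
  qed
  let ?I = "bind_var (bind_var ?H (\<lambda>q. {..<(snd (fst q) + 1) ^ snd q}) real) (\<lambda>q. {..<snd (fst q)}) real"
  let ?p = "\<lambda>q :: ((('p \<times> nat) \<times> nat) \<times> nat) \<times> nat. fst (fst (fst (fst q)))"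
  have w4: "ncomp ?I (\<lambda>q. f (?p q))" if "ncomp fr f" for f
    by (rule ncomp_weaken[OF ncomp_weaken[OF ncomp_weaken[OF ncomp_weaken[OF that]]]])
  have P1: "ncomp fr (\<lambda>p. (2 * n p * Q p) ^ CARD('d))" by (intro ncomp_const_power ncomp_mult ncomp_const n Q)
  have "computable ?I (\<lambda>q. composed_coeff \<phi> (n (?p q)) (Q (?p q)) lam qs (t q))"
    if t: "ncomp ?I t" "\<And>q. fst (fst q) \<in> params ?H \<Longrightarrow> t q \<le> snd (fst (fst (fst q)))" for t
  proof (rule computable_composed_coeff[OF w4[OF n] w4[OF Q] t(1)])
    have tm: "t q \<le> m (?p q)" "?p q \<in> params fr" if "q \<in> params ?I" for q using t(2)[of q] that by auto
    show "ncomp ?I (\<lambda>q. ((2 * n (?p q) * Q (?p q)) ^ CARD('d)) ^ t q)"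
    proof (rule ncomp_power[OF w4[OF P1] t(1) w4[OF P]])
      fix q assume "q \<in> params ?I"
      with pos tm[OF this] show "((2 * n (?p q) * Q (?p q)) ^ CARD('d)) ^ t q
        \<le> ((2 * n (?p q) * Q (?p q)) ^ CARD('d)) ^ m (?p q)"
        by (intro power_increasing) (auto simp: Suc_le_eq)
    qed
    show "ncomp ?I (\<lambda>q. (t q + 1) ^ t q)"
    proof (rule ncomp_power[OF ncomp_add[OF t(1) ncomp_const] t(1) w4[OF mm]])
      fix q assume "q \<in> params ?I"
      note le = tm(1)[OF this]
      have "(t q + 1) ^ t q \<le> (m (?p q) + 1) ^ t q" using le by (intro power_mono) auto
      also have "\<dots> \<le> (m (?p q) + 1) ^ m (?p q)" using le by (intro power_increasing) auto
      finally show "(t q + 1) ^ t q \<le> (m (?p q) + 1) ^ m (?p q)" .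
    qed
    show "computable ?I (\<lambda>_. lam)" by (intro computable_weaken[where f = "\<lambda>_. lam"] lam)
  qed (use pos in auto)
  from computable_power_coeff[OF rH iH irH this]
  have "computable ?H (\<lambda>q. power_coeff (composed_coeff \<phi> (n (fst (fst q))) (Q (fst (fst q))) lam qs) (snd q) (snd (fst q)))" .
  moreover have "computable ?H (\<lambda>_. - 1)" using computable_rat[of _ "- 1"] by (simp add: of_rat_minus)
  ultimately have "computable ?H (\<lambda>q. (- 1) ^ (snd q + 1) / real (snd q) *
      power_coeff (composed_coeff \<phi> (n (fst (fst q))) (Q (fst (fst q))) lam qs) (snd q) (snd (fst q)))"
    by (intro computable_mult computable_divide computable_power r1H ncompD[OF rH])
  from computable_sum[OF m1 computable_sum[OF i1G this]]
  show ?thesis unfolding log_series_sum_def .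
qed

end

section \<open>Quadrature of the configuration integrals\<close>

lemma exp_neg_bounds: "0 \<le> exp_neg h" "0 \<le> h \<Longrightarrow> exp_neg h \<le> 1"
  by (auto simp: exp_neg_def real_of_ereal_pos)

lemma exp_neg_zero: "exp_neg 0 = 1"
  by (simp add: exp_neg_def)

lemma exp_neg_add:
  assumes "0 \<le> a" "0 \<le> b"
  shows "exp_neg (a + b) = exp_neg a * exp_neg b"
  using assms by (cases a; cases b) (auto simp: exp_neg_def exp_add[symmetric])

lemma exp_neg_sum:
  assumes "\<And>i. i \<in> I \<Longrightarrow> 0 \<le> a i"
  shows "exp_neg (\<Sum>i\<in>I. a i) = (\<Prod>i\<in>I. exp_neg (a i))"
  using assms
  by (induction I rule: infinite_finite_induct) (auto simp: exp_neg_zero exp_neg_add sum_nonneg)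

text \<open>The bound is uniform in \<open>x\<close>, since the potential may be unbounded. With
  \<open>a = 1 / (1 + y)\<close> and \<open>b = exp (- y)\<close> one has
  \<open>a - b \<le> y\<^sup>2 * a\<close>, so the powers differ by at most
  \<open>N * y\<^sup>2 * a ^ N\<close>. Bernoulli's inequality for the exponent
  \<open>N div 2\<close>, squared, gives \<open>(1 + y) ^ N \<ge> (N * y / 3)\<^sup>2\<close>, which
  cancels \<open>y\<close>.\<close>

lemma inverse_power_approx_exp:
  fixes x :: real
  assumes "0 \<le> x" "2 \<le> N"
  shows "\<bar>(1 / (1 + x / real N)) ^ N - exp (- x)\<bar> \<le> 9 / real N"
proof -
  define y where "y = x / real N"
  have N: "real N \<ge> 2" using assms by simp
  have y: "0 \<le> y" "real N * y = x" using assms by (auto simp: y_def)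
  define a where "a = 1 / (1 + y)"
  define b where "b = exp (- y)"
  have "1 + y \<le> exp y" by (rule exp_ge_add_one_self)
  hence ab: "b \<le> a" using y unfolding a_def b_def exp_minus by (simp add: divide_inverse le_imp_inverse_le)
  have b0: "0 \<le> b" by (simp add: b_def)
  have a0: "0 \<le> a" using y by (simp add: a_def)
  have bN: "b ^ N = exp (- x)"
    using exp_of_nat_mult[of N "- y"] y by (simp add: b_def)
  have diff: "a - b \<le> y\<^sup>2 * a"
  proof -
    have "1 - y \<le> b" using exp_ge_add_one_self[of "- y"] by (simp add: b_def)
    hence "a - b \<le> a - (1 - y)" by simp
    also have "\<dots> = y\<^sup>2 * a" using y by (simp add: a_def field_simps power2_eq_square)
    finally show ?thesis .
  qed
  have "a ^ N - b ^ N = (a - b) * (\<Sum>i<N. b ^ (N - Suc i) * a ^ i)" by (rule power_diff_sumr2)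
  also have "\<dots> \<le> (a - b) * (\<Sum>i<N. a ^ (N - 1))"
  proof (intro mult_left_mono sum_mono)
    fix i assume "i \<in> {..<N}"
    hence "a ^ (N - 1) = a ^ (N - Suc i) * a ^ i" by (simp add: power_add[symmetric])
    moreover have "b ^ (N - Suc i) \<le> a ^ (N - Suc i)" using ab b0 by (rule power_mono)
    ultimately show "b ^ (N - Suc i) * a ^ i \<le> a ^ (N - 1)" using a0 by (simp add: mult_right_mono)
  qed (use ab in simp)
  also have "\<dots> = (a - b) * (real N * a ^ (N - 1))" by simp
  also have "\<dots> \<le> (y\<^sup>2 * a) * (real N * a ^ (N - 1))"
    using diff a0 by (intro mult_right_mono) auto
  also have "\<dots> = real N * y\<^sup>2 * a ^ N"
    using assms by (cases N) (auto simp: mult_ac)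
  also have "\<dots> \<le> 9 / real N"
  proof -
    have bern: "1 + real (N div 2) * y \<le> (1 + y) ^ (N div 2)"
      using y by (intro Bernoulli_inequality) auto
    \<comment> \<open>This uses \<open>2 \<le> N\<close> and produces the constant 9 as the square
      of 3.\<close>
    have "N \<le> 3 * (N div 2)" using assms by presburger
    hence h: "real N / 3 \<le> real (N div 2)" by linarith
    have "real N / 3 * y \<le> real (N div 2) * y" using h y by (intro mult_right_mono) auto
    hence "real N / 3 * y \<le> (1 + y) ^ (N div 2)" using bern by linarith
    hence "(real N / 3 * y)\<^sup>2 \<le> ((1 + y) ^ (N div 2))\<^sup>2" using y by (intro power_mono) auto
    also have "\<dots> = (1 + y) ^ (N div 2 * 2)" by (simp only: power_mult)
    also have "\<dots> \<le> (1 + y) ^ N" using y by (intro power_increasing) auto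
    finally have "real N * (real N * y\<^sup>2) \<le> 9 * (1 + y) ^ N"
      by (simp add: power2_eq_square mult_ac)
    moreover have "a ^ N = 1 / (1 + y) ^ N" by (simp add: a_def power_divide)
    moreover have "0 < (1 + y) ^ N" using y by simp
    ultimately show ?thesis using N by (simp add: field_simps)
  qed
  finally have "a ^ N - exp (- x) \<le> 9 / real N" by (simp add: bN)
  moreover have "b ^ N \<le> a ^ N" using ab b0 by (rule power_mono)
  ultimately show ?thesis by (simp add: a_def y_def bN[symmetric])
qed

lemma boltzmann_approx_error:
  assumes "0 \<le> \<phi> u" "2 \<le> Q"
  shows "\<bar>boltzmann_approx \<phi> Q u - exp_neg (\<phi> u)\<bar> \<le> 9 / real Q"
proof (cases "\<phi> u = \<infinity>")
  case False
  then show ?thesis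
    using inverse_power_approx_exp[of "real_of_ereal (\<phi> u)" Q] assms
    by (simp add: boltzmann_approx_def exp_neg_def real_of_ereal_pos)
qed (simp add: boltzmann_approx_def exp_neg_def)

lemma boltzmann_approx_bounds:
  assumes "0 \<le> \<phi> u"
  shows "0 \<le> boltzmann_approx \<phi> Q u" "boltzmann_approx \<phi> Q u \<le> 1"
proof -
  have "0 \<le> real_of_ereal (\<phi> u) / real Q" using real_of_ereal_pos[OF assms] by simp
  then show "0 \<le> boltzmann_approx \<phi> Q u" "boltzmann_approx \<phi> Q u \<le> 1"
    by (auto simp: boltzmann_approx_def divide_le_eq_1 intro!: power_le_one)
qed

text \<open>
  Every point with a neighbour on the other side of the boundary of \<open>A\<close> lies in \<open>shell A a\<close> for a
  suitable \<open>a\<close>, and dilations make the volume of this set easy to estimate.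
\<close>

definition shell :: "(real ^ 'd) set \<Rightarrow> real \<Rightarrow> (real ^ 'd) set" where
  "shell A a = (\<lambda>x. (1 + a) *\<^sub>R x) ` A - (\<lambda>x. (1 - a) *\<^sub>R x) ` A"

lemma zero_in_centered_cube: "0 \<le> r \<Longrightarrow> 0 \<in> centered_cube r"
  by (simp add: centered_cube_def)

text \<open>Write \<open>v = u + a w\<close> with \<open>a = R * h\<close>; then \<open>w\<close>
  and \<open>- w\<close> lie in the cube inside \<open>A\<close>. If \<open>u\<close> were in
  \<open>(1 - a) A\<close>, convexity would put both \<open>u\<close> and \<open>v\<close> into
  \<open>A\<close>. If \<open>v\<close> is in \<open>A\<close>, then \<open>u = v - a w\<close> is
  in \<open>(1 + a) A\<close>.\<close>

lemma separated_in_shell: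
  fixes u v :: "real ^ 'd"
  assumes A: "convex A" "centered_cube (1 / R) \<subseteq> A" and R: "0 < R" and h: "0 < h" "R * h \<le> 1"
    and uv: "\<And>c. \<bar>u $ c - v $ c\<bar> \<le> h" and sep: "(u \<in> A) \<noteq> (v \<in> A)"
  shows "u \<in> shell A (R * h)"
proof -
  define a where "a = R * h"
  have a: "0 < a" "a \<le> 1" using R h by (auto simp: a_def)
  have 0: "0 \<in> A" using A(2) zero_in_centered_cube[of "1 / R"] R by auto
  have shrink: "c *\<^sub>R x \<in> A" if "x \<in> A" "0 \<le> c" "c \<le> 1" for c x
    using convexD_alt[OF A(1) 0 that(1), of c] that by simp
  define w where "w = (1 / a) *\<^sub>R (v - u)"
  have w1: "\<bar>w $ c\<bar> \<le> 1 / R" for c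
  proof -
    have "\<bar>w $ c\<bar> = \<bar>u $ c - v $ c\<bar> / a" using a by (simp add: w_def abs_mult abs_minus_commute)
    also have "\<dots> \<le> h / a" using uv a by (intro divide_right_mono) auto
    also have "\<dots> = 1 / R" using R h by (simp add: a_def)
    finally show ?thesis .
  qed
  have w: "w \<in> A" "- w \<in> A" using A(2) w1 by (auto simp: centered_cube_def subset_eq)
  have v: "v = u + a *\<^sub>R w" using a by (simp add: w_def)
  show ?thesis
  proof (cases "u \<in> A")
    case True
    have "u = (1 + a) *\<^sub>R ((1 / (1 + a)) *\<^sub>R u)" using a by simp
    moreover have "(1 / (1 + a)) *\<^sub>R u \<in> A" using a True by (intro shrink) auto
    ultimately have 1: "u \<in> (\<lambda>x. (1 + a) *\<^sub>R x) ` A" by blast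
    have "u \<noteq> (1 - a) *\<^sub>R k" if "k \<in> A" for k
    proof
      assume "u = (1 - a) *\<^sub>R k"
      hence "v = (1 - a) *\<^sub>R k + a *\<^sub>R w" using v by simp
      hence "v \<in> A" using convexD_alt[OF A(1) that w(1), of a] a by simp
      with sep True show False by simp
    qed
    with 1 show ?thesis unfolding shell_def a_def[symmetric] by blast
  next
    case False
    hence vA: "v \<in> A" using sep by simp
    let ?t = "a / (1 + a)"
    have "1 - ?t = 1 / (1 + a)" using a by (simp add: field_simps)
    hence "(1 / (1 + a)) *\<^sub>R v + ?t *\<^sub>R (- w) \<in> A" using convexD_alt[OF A(1) vA w(2), of ?t] a by simp
    moreover have "u = (1 + a) *\<^sub>R ((1 / (1 + a)) *\<^sub>R v + ?t *\<^sub>R (- w))"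
      using a v by (simp add: scaleR_add_right)
    ultimately have 1: "u \<in> (\<lambda>x. (1 + a) *\<^sub>R x) ` A" by blast
    have "u \<noteq> (1 - a) *\<^sub>R k" if "k \<in> A" for k
      using shrink[OF that, of "1 - a"] a False by auto
    with 1 show ?thesis unfolding shell_def a_def[symmetric] by blast
  qed
qed

text \<open>The upper power is bounded by its chord over [0, 1], the lower one by Bernoulli's
  inequality, and \<open>d \<le> 2 ^ d\<close>.\<close>

lemma shell_power_diff:
  fixes a :: real
  assumes "0 \<le> a" "a \<le> 1"
  shows "(1 + a) ^ d - (1 - a) ^ d \<le> 2 ^ (d + 1) * a"
proof -
  have 1: "(1 + a) ^ d \<le> 1 + (2 ^ d - 1) * a"
  proof (induction d)
    case (Suc d)
    have "(1 + a) ^ Suc d \<le> (1 + a) * (1 + (2 ^ d - 1) * a)" using Suc assms by (simp add: mult_left_mono)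
    also have "\<dots> = 1 + 2 ^ d * a + (2 ^ d - 1) * (a * a)" by (simp add: algebra_simps)
    also have "\<dots> \<le> 1 + 2 ^ d * a + (2 ^ d - 1) * (a * 1)"
      using assms by (intro add_left_mono mult_left_mono) auto
    also have "\<dots> = 1 + (2 ^ Suc d - 1) * a" by (simp add: algebra_simps)
    finally show ?case .
  qed simp
  have 2: "1 - real d * a \<le> (1 - a) ^ d"
    using Bernoulli_inequality[of "- a" d] assms by simp
  have "real d \<le> 2 ^ d" using less_exp[of d] by (metis less_imp_le of_nat_less_iff of_nat_numeral of_nat_power)
  hence "real d * a \<le> 2 ^ d * a" using assms by (intro mult_right_mono) auto
  with 1 2 assms show ?thesis by (simp add: algebra_simps)
qed

lemma shell_measurable:
  assumes "compact A"
  shows "shell A a \<in> sets borel" "shell A a \<in> lmeasurable"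
proof -
  have "compact ((\<lambda>x. c *\<^sub>R x) ` A)" for c
    using assms by (rule compact_scaling)
  then show "shell A a \<in> sets borel" "shell A a \<in> lmeasurable"
    unfolding shell_def by (intro sets.Diff borel_compact, simp_all only:)
      (intro fmeasurable.Diff lmeasurable_compact fmeasurableD, simp_all only:)
qed

lemma measure_shell:
  fixes A :: "(real ^ 'd::finite) set"
  assumes "compact A" "convex A" "0 \<in> A" "0 \<le> a" "a \<le> 1"
  shows "measure lebesgue (shell A a) \<le> 2 ^ (CARD('d) + 1) * a * measure lebesgue A"
proof -
  have m: "measure lebesgue ((\<lambda>x. c *\<^sub>R x) ` A) = \<bar>c\<bar> ^ CARD('d) * measure lebesgue A" for c
    using measure_lebesgue_affine[of c 0 A] by simp
  have comp: "compact ((\<lambda>x. c *\<^sub>R x) ` A)" for c using assms(1) by (rule compact_scaling)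
  have sub: "(\<lambda>x. (1 - a) *\<^sub>R x) ` A \<subseteq> (\<lambda>x. (1 + a) *\<^sub>R x) ` A"
  proof (rule image_subsetI)
    fix x assume x: "x \<in> A"
    have "((1 - a) / (1 + a)) *\<^sub>R x \<in> A"
      using convexD_alt[OF assms(2,3) x, of "(1 - a) / (1 + a)"] assms(4,5) by simp
    moreover have "(1 - a) *\<^sub>R x = (1 + a) *\<^sub>R (((1 - a) / (1 + a)) *\<^sub>R x)" using assms(4) by simp
    ultimately show "(1 - a) *\<^sub>R x \<in> (\<lambda>x. (1 + a) *\<^sub>R x) ` A" by blast
  qed
  have "measure lebesgue (shell A a) = ((1 + a) ^ CARD('d) - (1 - a) ^ CARD('d)) * measure lebesgue A"
    unfolding shell_def
    by (subst measurable_measure_Diff[OF lmeasurable_compact[OF comp] _ sub])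
       (use assms comp lmeasurable_compact in \<open>auto simp: m left_diff_distrib dest: fmeasurableD\<close>)
  also have "\<dots> \<le> (2 ^ (CARD('d) + 1) * a) * measure lebesgue A"
    using shell_power_diff[OF assms(4,5), of "CARD('d)"] by (intro mult_right_mono) auto
  finally show ?thesis .
qed

section \<open>Variation and measurability of the Boltzmann factor of a regular potential\<close>

locale regular_potential =
  fixes \<phi> :: "real ^ 'd::finite \<Rightarrow> ereal" and l :: nat and L R :: real and K :: "nat \<Rightarrow> (real ^ 'd) set"
  assumes repulsive: "repulsive_pair_potential \<phi>" and regular: "regularity_assumption \<phi> l L R K"
begin

lemma nonneg: "0 \<le> \<phi> u"
  using repulsive by (simp add: repulsive_pair_potential_def)

lemma positive: "0 < L" "0 < R"
  using regular by (auto simp: regularity_assumption_def)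

lemma compact_K: "j \<le> l \<Longrightarrow> compact (K j)"
  using regular by (cases j) (auto simp: regularity_assumption_def)

lemma K_properties:
  assumes "j \<in> {1..l}"
  shows "convex (K j)" "K (j - 1) \<subseteq> K j" "L-lipschitz_on (K j - K (j - 1)) (\<lambda>x. exp_neg (\<phi> x))"
  using regular assms by (auto simp: regularity_assumption_def)

lemma cube_subset_K:
  assumes "j \<in> {1..l}"
  shows "centered_cube (1 / R) \<subseteq> K j"
  using assms
proof (induction j)
  case (Suc j)
  show ?case
  proof (cases "j = 0")
    case True
    then show ?thesis using regular by (simp add: regularity_assumption_def)
  next
    case False
    with Suc K_properties(2)[of "Suc j"] show ?thesis by fastforce
  qed
qed simp

lemma zero_outside: "u \<notin> K l \<Longrightarrow> \<phi> u = 0"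
  using regular closure_subset[of "{x. \<phi> x \<noteq> 0}"] by (auto simp: regularity_assumption_def)

lemma layer:
  assumes "u \<in> K l"
  obtains j where "j \<in> {1..l}" "u \<in> K j - K (j - 1)"
proof -
  define j where "j = (LEAST j. u \<in> K j)"
  have j: "u \<in> K j" unfolding j_def using assms by (rule LeastI)
  have "j \<le> l" unfolding j_def using assms by (rule Least_le)
  moreover have "j \<noteq> 0" using j regular by (metis empty_iff regularity_assumption_def)
  moreover have "u \<notin> K (j - 1)" using not_less_Least[of "j - 1" "\<lambda>j. u \<in> K j"] \<open>j \<noteq> 0\<close> by (auto simp: j_def)
  ultimately show thesis using j by (intro that[of j]) auto
qed

text \<open>If some \<open>K j\<close> separates the points, a shell indicator pays for the trivial
  bound 1. Otherwise both lie in the same layer, where the Lipschitz bound applies, or both outside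
  \<open>K l\<close>, where the potential vanishes. The bound involves only \<open>u\<close>, so
  \<open>v\<close> can be a grid point while \<open>u\<close> is integrated over.\<close>

lemma boltzmann_variation:
  assumes h: "0 < h" "R * h \<le> 1" and uv: "\<And>c. \<bar>u $ c - v $ c\<bar> \<le> h"
  shows "\<bar>exp_neg (\<phi> u) - exp_neg (\<phi> v)\<bar> \<le>
    L * (real CARD('d) * h) + (\<Sum>j\<in>{1..l}. indicator (shell (K j) (R * h)) u)"
proof (cases "\<exists>j\<in>{1..l}. (u \<in> K j) \<noteq> (v \<in> K j)")
  case True
  then obtain j where j: "j \<in> {1..l}" "(u \<in> K j) \<noteq> (v \<in> K j)" by blast
  have "u \<in> shell (K j) (R * h)"
    by (rule separated_in_shell[OF K_properties(1) cube_subset_K _ h uv j(2)]) (use j positive in auto)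
  hence "1 \<le> (\<Sum>j\<in>{1..l}. indicator (shell (K j) (R * h)) u :: real)"
    using member_le_sum[of j "{1..l}" "\<lambda>j. indicator (shell (K j) (R * h)) u :: real"] j by simp
  moreover have "\<bar>exp_neg (\<phi> u) - exp_neg (\<phi> v)\<bar> \<le> 1"
    using exp_neg_bounds[of "\<phi> u"] exp_neg_bounds[of "\<phi> v"] nonneg by (simp add: abs_le_iff)
  moreover have "0 \<le> L * (real CARD('d) * h)" using positive h by simp
  ultimately show ?thesis by linarith
next
  case False
  have rhs: "0 \<le> L * (real CARD('d) * h)" "0 \<le> (\<Sum>j\<in>{1..l}. indicator (shell (K j) (R * h)) u :: real)"
    using positive h by (auto intro: sum_nonneg)
  have l: "l \<in> {1..l}" using regular by (simp add: regularity_assumption_def)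
  show ?thesis
  proof (cases "u \<in> K l")
    case True
    then obtain j where j: "j \<in> {1..l}" "u \<in> K j - K (j - 1)" by (rule layer)
    have K0: "K 0 = {}" using regular by (simp add: regularity_assumption_def)
    have "v \<in> K j - K (j - 1)"
    proof (cases "j - 1 = 0")
      case True
      then show ?thesis using j K0 False by auto
    next
      case jn: False
      hence "j - 1 \<in> {1..l}" using j by auto
      then show ?thesis using j False by blast
    qed
    from lipschitz_onD[OF K_properties(3)[OF j(1)] j(2) this]
    have "\<bar>exp_neg (\<phi> u) - exp_neg (\<phi> v)\<bar> \<le> L * dist u v" by (simp add: dist_real_def)
    also have "dist u v \<le> (\<Sum>c\<in>UNIV. \<bar>(u - v) $ c\<bar>)" unfolding dist_norm by (rule norm_le_l1_cart)
    also have "\<dots> \<le> (\<Sum>c\<in>(UNIV :: 'd set). h)" using uv by (intro sum_mono) auto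
    also have "\<dots> = real CARD('d) * h" by simp
    finally have "\<bar>exp_neg (\<phi> u) - exp_neg (\<phi> v)\<bar> \<le> L * (real CARD('d) * h)"
      using positive by (simp add: mult_left_mono)
    with rhs show ?thesis by linarith
  next
    case uK: False
    hence "v \<notin> K l" using False l by blast
    with uK rhs show ?thesis by (simp add: zero_outside)
  qed
qed

text \<open>The integrands evaluate the potential at differences of coordinates, and Lebesgue
  measurability is not stable under such compositions. Borel measurability is recovered from
  regularity: the factor is continuous on each of finitely many Borel layers and equals 1 outside
  \<open>K l\<close>.\<close>

lemma boltzmann_borel [measurable]: "(\<lambda>u. exp_neg (\<phi> u)) \<in> borel_measurable borel"
proof -
  have K: "K j \<in> sets borel" if "j \<le> l" for j using compact_K[OF that] by (rule borel_compact)
  have D: "K j - K (j - 1) \<in> sets borel" if "j \<in> {1..l}" for j using that by (intro sets.Diff K) auto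
  let ?g = "\<lambda>u. (\<Sum>j\<in>{1..l}. indicator (K j - K (j - 1)) u *\<^sub>R exp_neg (\<phi> u)) + indicator (- K l) u"
  have mono: "K i \<subseteq> K j" if "i \<le> j" "j \<le> l" for i j
    using that
  proof (induction j)
    case (Suc j)
    then show ?case using K_properties(2)[of "Suc j"] by (cases "i = Suc j") auto
  qed auto
  have "?g \<in> borel_measurable borel"
  proof (intro borel_measurable_add borel_measurable_sum borel_measurable_indicator)
    fix j assume j: "j \<in> {1..l}"
    show "(\<lambda>u. indicator (K j - K (j - 1)) u *\<^sub>R exp_neg (\<phi> u)) \<in> borel_measurable borel"
      by (rule borel_measurable_continuous_on_indicator[OF D[OF j]
            lipschitz_on_continuous_on[OF K_properties(3)[OF j]]])
  qed (use K in auto)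
  moreover have "?g = (\<lambda>u. exp_neg (\<phi> u))"
  proof
    fix u show "?g u = exp_neg (\<phi> u)"
  proof (cases "u \<in> K l")
    case True
    then obtain j where j: "j \<in> {1..l}" "u \<in> K j - K (j - 1)" by (rule layer)
    have "u \<notin> K i - K (i - 1)" if "i \<in> {1..l}" "i \<noteq> j" for i
    proof (cases "i < j")
      case True
      hence "i \<le> j - 1" "j - 1 \<le> l" using j by auto
      then show ?thesis using j mono[of i "j - 1"] by blast
    next
      case False
      hence "j \<le> i - 1" "i - 1 \<le> l" using that by auto
      then show ?thesis using j mono[of j "i - 1"] by blast
    qed
    hence "(\<Sum>i\<in>{1..l}. indicator (K i - K (i - 1)) u *\<^sub>R exp_neg (\<phi> u)) =
       (\<Sum>i\<in>{1..l}. if i = j then exp_neg (\<phi> u) else 0)"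
      using j by (intro sum.cong) (auto simp: indicator_def)
    then show ?thesis using j True by simp
  next
    case False
    have "u \<notin> K i" if "i \<in> {1..l}" for i using mono[of i l] that False by auto
    hence "(\<Sum>i\<in>{1..l}. indicator (K i - K (i - 1)) u *\<^sub>R exp_neg (\<phi> u)) = 0"
      by (intro sum.neutral) auto
    then show ?thesis using False by (simp add: zero_outside exp_neg_zero)
  qed
  qed
  ultimately show ?thesis by (simp only:)
qed

end

section \<open>Integration over powers of a set of finite measure\<close>

lemma measurable_lebesgue_on_borel:
  fixes S :: "'a::euclidean_space set"
  shows "(\<lambda>x. x) \<in> lebesgue_on S \<rightarrow>\<^sub>M borel"
  by (intro measurable_restrict_space1 measurable_completion) simp

lemma measurable_component_lebesgue_on:
  fixes S :: "'a::euclidean_space set"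
  assumes "i \<in> I"
  shows "(\<lambda>x. x i) \<in> Pi\<^sub>M I (\<lambda>_. lebesgue_on S) \<rightarrow>\<^sub>M borel"
  by (rule measurable_compose[OF measurable_component_singleton[OF assms] measurable_lebesgue_on_borel])

lemma product_lebesgue_on:
  fixes S :: "'a::euclidean_space set"
  assumes "S \<in> lmeasurable"
  shows "product_sigma_finite (\<lambda>i. lebesgue_on S)"
  using finite_measure_lebesgue_on[OF assms]
  by (auto simp: product_sigma_finite_def finite_measure_def)

lemma emeasure_product_lebesgue_on:
  fixes S :: "'a::euclidean_space set"
  assumes S: "S \<in> lmeasurable" and "finite I"
  shows "emeasure (Pi\<^sub>M I (\<lambda>_. lebesgue_on S)) (space (Pi\<^sub>M I (\<lambda>_. lebesgue_on S))) =
    ennreal (measure lebesgue S ^ card I)"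
proof -
  interpret product_sigma_finite "\<lambda>i. lebesgue_on S" by (rule product_lebesgue_on[OF S])
  have "emeasure (lebesgue_on S) (space (lebesgue_on S)) = ennreal (measure lebesgue S)"
    using S by (simp add: emeasure_restrict_space emeasure_eq_measure2 fmeasurableD)
  then show ?thesis
    unfolding space_PiM using assms by (subst emeasure_PiM) (auto simp: ennreal_power prod_constant)
qed

lemma finite_measure_product_lebesgue_on:
  fixes S :: "'a::euclidean_space set"
  assumes S: "S \<in> lmeasurable" and "finite I"
  shows "finite_measure (Pi\<^sub>M I (\<lambda>_. lebesgue_on S))"
  by (rule finite_measureI) (simp add: emeasure_product_lebesgue_on[OF assms])

lemma measure_product_lebesgue_on:
  fixes S :: "'a::euclidean_space set"
  assumes S: "S \<in> lmeasurable" and "finite I"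
  shows "measure (Pi\<^sub>M I (\<lambda>_. lebesgue_on S)) (space (Pi\<^sub>M I (\<lambda>_. lebesgue_on S))) =
    measure lebesgue S ^ card I"
  unfolding measure_def emeasure_product_lebesgue_on[OF assms] by simp

text \<open>Coordinate \<open>i\<close> is integrated first: by translation invariance the inner
  integral is at most the volume of \<open>A\<close>, and each of the other \<open>k - 1\<close>
  coordinates contributes the volume of \<open>S\<close>.\<close>

lemma integral_difference_indicator:
  fixes S A :: "'a::euclidean_space set"
  assumes S: "S \<in> lmeasurable" and A: "A \<in> sets borel" "A \<in> lmeasurable" and ij: "i < k" "j < k" "i \<noteq> j"
  shows "(LINT x|Pi\<^sub>M {..<k} (\<lambda>_. lebesgue_on S). indicator A (x i - x j)) \<le>
    measure lebesgue A * measure lebesgue S ^ (k - 1)"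
proof -
  let ?M = "\<lambda>_::nat. lebesgue_on S"
  interpret product_sigma_finite ?M by (rule product_lebesgue_on[OF S])
  define I where "I = {..<k} - {i}"
  have I: "finite I" "i \<notin> I" "insert i I = {..<k}" "j \<in> I" "card I = k - 1"
    using ij by (auto simp: I_def)
  have diff: "(\<lambda>x. x i - x j) \<in> Pi\<^sub>M {..<k} ?M \<rightarrow>\<^sub>M borel"
    using ij by (intro borel_measurable_diff measurable_component_lebesgue_on) auto
  have meas: "(\<lambda>x. indicator A (x i - x j) :: ennreal) \<in> borel_measurable (Pi\<^sub>M {..<k} ?M)"
    by (rule measurable_compose[OF diff borel_measurable_indicator[OF A(1)]])
  have meas': "(\<lambda>x. indicator A (x i - x j) :: real) \<in> borel_measurable (Pi\<^sub>M {..<k} ?M)"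
    by (rule measurable_compose[OF diff borel_measurable_indicator[OF A(1)]])
  have "(\<integral>\<^sup>+ x. indicator A (x i - x j) \<partial>Pi\<^sub>M {..<k} ?M) =
      (\<integral>\<^sup>+ x. (\<integral>\<^sup>+ y. indicator A ((x(i := y)) i - (x(i := y)) j) \<partial>lebesgue_on S) \<partial>Pi\<^sub>M I ?M)"
    using product_nn_integral_insert[OF I(1,2), of "\<lambda>x. indicator A (x i - x j)"] meas I(3) by simp
  also have "\<dots> \<le> (\<integral>\<^sup>+ x. emeasure lebesgue A \<partial>Pi\<^sub>M I ?M)"
  proof (rule nn_integral_mono)
    fix x
    have im: "(\<lambda>y. 1 *\<^sub>R y + x j) ` A = {y. y - x j \<in> A}"
      by (auto simp: image_iff) (metis diff_add_cancel)
    have "(\<lambda>y. y - x j) -` A \<inter> space borel \<in> sets borel"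
      by (rule measurable_sets[OF _ A(1)]) (intro borel_measurable_diff measurable_const, auto)
    hence "{y. y - x j \<in> A} \<in> sets borel" by (simp add: vimage_def)
    hence leb: "{y. y - x j \<in> A} \<in> sets lebesgue" by simp
    have "(\<integral>\<^sup>+ y. indicator A ((x(i := y)) i - (x(i := y)) j) \<partial>lebesgue_on S) =
        (\<integral>\<^sup>+ y. indicator {y. y - x j \<in> A} y * indicator S y \<partial>lebesgue)"
      using ij S by (subst nn_integral_restrict_space) (auto simp: fmeasurableD indicator_def intro!: nn_integral_cong)
    also have "\<dots> \<le> (\<integral>\<^sup>+ y. indicator {y. y - x j \<in> A} y \<partial>lebesgue)"
      by (intro nn_integral_mono) (auto simp: indicator_def)
    also have "\<dots> = emeasure lebesgue {y. y - x j \<in> A}" using leb by simp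
    also have "\<dots> = emeasure lebesgue A"
      unfolding im[symmetric] by (subst emeasure_lebesgue_affine) simp
    finally show "(\<integral>\<^sup>+ y. indicator A ((x(i := y)) i - (x(i := y)) j) \<partial>lebesgue_on S) \<le> emeasure lebesgue A" .
  qed
  also have "\<dots> = emeasure lebesgue A * ennreal (measure lebesgue S ^ (k - 1))"
    by (simp add: emeasure_product_lebesgue_on[OF S I(1)] I(5))
  also have "\<dots> = ennreal (measure lebesgue A * measure lebesgue S ^ (k - 1))"
    using A by (simp add: emeasure_eq_measure2 ennreal_mult)
  finally have "(\<integral>\<^sup>+ x. indicator A (x i - x j) \<partial>Pi\<^sub>M {..<k} ?M) \<le>
      ennreal (measure lebesgue A * measure lebesgue S ^ (k - 1))" .
  hence "(\<integral>\<^sup>+ x. ennreal (indicator A (x i - x j)) \<partial>Pi\<^sub>M {..<k} ?M) \<le>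
      ennreal (measure lebesgue A * measure lebesgue S ^ (k - 1))"
    by (simp add: ennreal_indicator)
  then show ?thesis
    by (subst integral_eq_nn_integral) (use meas' in \<open>auto simp: enn2real_leI\<close>)
qed

text \<open>The minimum assigns the right endpoint of \<open>[-n, n]\<close> to the last interval.\<close>

definition cell_coord :: "nat \<Rightarrow> nat \<Rightarrow> real \<Rightarrow> nat" where
  "cell_coord n Q t = min (2 * n * Q - 1) (nat \<lfloor>(t + real n) * real Q\<rfloor>)"

definition cell :: "nat \<Rightarrow> nat \<Rightarrow> nat \<Rightarrow> (real ^ 'd::finite) set" where
  "cell n Q p = {x \<in> centered_cube (real n).
     \<forall>c. digit (2 * n * Q) p (coord_index c) = cell_coord n Q (x $ c)}"

text \<open>The lower corner of the cell, moved by \<open>n\<close> in every coordinate so that the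
  cube becomes \<open>[0, 2n]^d\<close>; the sums only involve differences of corners.\<close>

definition corner :: "nat \<Rightarrow> nat \<Rightarrow> nat \<Rightarrow> real ^ 'd::finite" where
  "corner n Q p = (\<chi> c. real (digit (2 * n * Q) p (coord_index c)) / real Q)"

lemma cell_coord_less: "1 \<le> n \<Longrightarrow> 1 \<le> Q \<Longrightarrow> cell_coord n Q t < 2 * n * Q"
proof -
  assume "1 \<le> n" "1 \<le> Q"
  hence "0 < 2 * n * Q" by simp
  moreover have "cell_coord n Q t \<le> 2 * n * Q - 1" by (simp add: cell_coord_def)
  ultimately show ?thesis by linarith
qed

lemma cell_coord_bounds:
  assumes "1 \<le> n" "1 \<le> Q" "\<bar>t\<bar> \<le> real n"
  shows "real (cell_coord n Q t) / real Q \<le> t + real n" "t + real n \<le> real (cell_coord n Q t) / real Q + 1 / real Q"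
proof -
  define s where "s = (t + real n) * real Q"
  have Q: "0 < real Q" using assms by simp
  have "t + real n \<le> 2 * real n" using assms by linarith
  hence s: "0 \<le> s" "s \<le> real (2 * n * Q)"
    using assms Q mult_right_mono[of "t + real n" "2 * real n" "real Q"] by (auto simp: s_def)
  have N: "1 \<le> 2 * n * Q" using assms by simp
  have m: "real (nat \<lfloor>s\<rfloor>) \<le> s" "s < real (nat \<lfloor>s\<rfloor>) + 1" using s by linarith+
  have "real (min (N - 1) (nat \<lfloor>s\<rfloor>)) \<le> s \<and> s \<le> real (min (N - 1) (nat \<lfloor>s\<rfloor>)) + 1"
    if N1: "1 \<le> N" "s \<le> real N" for N
  proof (cases "N - 1 \<le> nat \<lfloor>s\<rfloor>")
    case True
    hence "real (N - 1) \<le> real (nat \<lfloor>s\<rfloor>)" by simp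
    moreover have "real (N - 1) = real N - 1" using N1 by (simp add: of_nat_diff)
    ultimately show ?thesis using m N1 unfolding min_absorb1[OF True] by linarith
  next
    case False
    hence "nat \<lfloor>s\<rfloor> \<le> N - 1" by simp
    from min_absorb2[OF this] show ?thesis using m by simp
  qed
  from this[OF N s(2)] have "real (cell_coord n Q t) \<le> s" "s \<le> real (cell_coord n Q t) + 1"
    unfolding cell_coord_def s_def[symmetric] by auto
  then show "real (cell_coord n Q t) / real Q \<le> t + real n" "t + real n \<le> real (cell_coord n Q t) / real Q + 1 / real Q"
    using Q by (auto simp: s_def field_simps)
qed

lemma exists_unique_cell:
  fixes x :: "real ^ 'd::finite"
  assumes n: "1 \<le> n" "1 \<le> Q" and x: "x \<in> centered_cube (real n)"
  shows "\<exists>!p. p < (2 * n * Q) ^ CARD('d) \<and> x \<in> cell n Q p"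
proof -
  let ?N = "2 * n * Q" and ?d = "CARD('d)"
  have N: "0 < ?N" using n by simp
  have bij: "bij_betw (coord_index :: 'd \<Rightarrow> nat) UNIV {..<?d}" by (rule bij_betw_coord_index)
  define g where "g = (\<lambda>i\<in>{..<?d}. cell_coord n Q (x $ (inv_into UNIV coord_index i)))"
  have "g \<in> PiE {..<?d} (\<lambda>_. {..<?N})" using n by (auto simp: g_def cell_coord_less)
  with bij_betw_digits[OF N, of ?d] obtain p where p: "p < ?N ^ ?d" "(\<lambda>i\<in>{..<?d}. digit ?N p i) = g"
    unfolding bij_betw_def by (metis (no_types, lifting) imageE lessThan_iff)
  have "digit ?N p (coord_index c) = cell_coord n Q (x $ c)" for c :: 'd
  proof -
    have "digit ?N p (coord_index c) = g (coord_index c)"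
      using fun_cong[OF p(2), of "coord_index c"] coord_index_less[of c] by simp
    also have "\<dots> = cell_coord n Q (x $ c)"
      using coord_index_less[of c] bij by (simp add: g_def bij_betw_def inv_into_f_f)
    finally show ?thesis .
  qed
  hence "x \<in> cell n Q p" using x by (simp add: cell_def)
  moreover have "p' = p" if "p' < ?N ^ ?d" "x \<in> cell n Q p'" for p'
  proof (rule digits_inj[OF that(1) p(1)])
    fix i assume "i < ?d"
    then obtain c :: 'd where "i = coord_index c" using bij unfolding bij_betw_def by auto
    with that(2) \<open>x \<in> cell n Q p\<close> show "digit ?N p' i = digit ?N p i" by (simp add: cell_def)
  qed
  ultimately show ?thesis using p(1) by blast
qed

lemma cell_corner:
  assumes "1 \<le> n" "1 \<le> Q" "x \<in> cell n Q p"
  shows "corner n Q p $ c \<le> x $ c + real n" "x $ c + real n \<le> corner n Q p $ c + 1 / real Q"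
proof -
  have "\<bar>x $ c\<bar> \<le> real n" "digit (2 * n * Q) p (coord_index c) = cell_coord n Q (x $ c)"
    using assms(3) by (auto simp: cell_def centered_cube_def)
  with cell_coord_bounds[OF assms(1,2), of "x $ c"]
  show "corner n Q p $ c \<le> x $ c + real n" "x $ c + real n \<le> corner n Q p $ c + 1 / real Q"
    by (simp_all add: corner_def)
qed

text \<open>The cell is squeezed between an open and a closed box of side \<open>1 / Q\<close>,
  which differ by a null set.\<close>

lemma measure_cell:
  assumes n: "1 \<le> n" "1 \<le> Q"
  shows "(cell n Q p :: (real ^ 'd::finite) set) \<in> lmeasurable"
    "measure lebesgue (cell n Q p :: (real ^ 'd) set) = (1 / real Q) ^ CARD('d)"
proof -
  let ?D = "\<lambda>c :: 'd. digit (2 * n * Q) p (coord_index c)"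
  define a :: "real ^ 'd" where "a = (\<chi> c. corner n Q p $ c - real n)"
  define b :: "real ^ 'd" where "b = (\<chi> c. corner n Q p $ c - real n + 1 / real Q)"
  have Q: "0 < real Q" using n by simp
  have D: "?D c < 2 * n * Q" for c using n by (intro digit_less) simp
  have sub1: "cell n Q p \<subseteq> cbox a b"
  proof
    fix x :: "real ^ 'd" assume "x \<in> cell n Q p"
    from cell_corner[OF n this] show "x \<in> cbox a b"
      by (simp add: mem_box_cart a_def b_def algebra_simps)
  qed
  have sub2: "box a b \<subseteq> cell n Q p"
  proof
    fix x :: "real ^ 'd" assume x: "x \<in> box a b"
    have c: "\<bar>x $ c\<bar> \<le> real n \<and> ?D c = cell_coord n Q (x $ c)" for c
    proof -
      have 1: "real (?D c) / real Q < x $ c + real n" "x $ c + real n < real (?D c) / real Q + 1 / real Q"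
        using x by (auto simp: mem_box_cart a_def b_def corner_def algebra_simps)
      hence 2: "real (?D c) < (x $ c + real n) * real Q" "(x $ c + real n) * real Q < real (?D c) + 1"
        using Q by (auto simp: field_simps)
      have "real (?D c) + 1 \<le> real (2 * n * Q)" using D[of c] by linarith
      hence "(x $ c + real n) * real Q \<le> (2 * real n) * real Q" using 2 by simp
      hence "x $ c + real n \<le> 2 * real n" using Q by simp
      moreover have "0 \<le> x $ c + real n" using 1 Q by (meson divide_nonneg_nonneg less_imp_le of_nat_0_le_iff order_trans)
      moreover have "nat \<lfloor>(x $ c + real n) * real Q\<rfloor> = ?D c" using 2 by linarith
      ultimately show ?thesis using D[of c] by (auto simp: cell_coord_def)
    qed
    then show "x \<in> cell n Q p" by (auto simp: cell_def centered_cube_def)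
  qed
  have "negligible (cbox a b - box a b)" by (rule negligible_frontier_interval)
  hence neg: "negligible (cbox a b - cell n Q p)" "negligible (cell n Q p - box a b)"
    using sub1 sub2 by (auto intro: negligible_subset)
  have "cbox a b - cell n Q p \<in> sets lebesgue" using neg(1) by (rule negligible_imp_sets)
  hence "cbox a b - (cbox a b - cell n Q p) \<in> lmeasurable"
    by (rule fmeasurable_Diff[OF lmeasurable_cbox])
  moreover have "cbox a b - (cbox a b - cell n Q p) = cell n Q p" using sub1 by blast
  ultimately show m: "(cell n Q p :: (real ^ 'd) set) \<in> lmeasurable" by simp
  have "negligible (cbox a b - cell n Q p \<union> (cell n Q p - cbox a b))"
    using neg sub1 by (simp add: Diff_eq_empty_iff[THEN iffD2])
  hence "measure lebesgue (cell n Q p :: (real ^ 'd) set) = measure lebesgue (cbox a b)"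
    by (rule measure_negligible_symdiff[OF lmeasurable_cbox])
  also have "\<dots> = (\<Prod>c\<in>(UNIV :: 'd set). b $ c - a $ c)"
  proof -
    have "a \<in> cbox a b" using Q by (simp add: mem_box_cart a_def b_def)
    hence "cbox a b \<noteq> {}" by blast
    then show ?thesis by (simp add: content_cbox_cart)
  qed
  also have "\<dots> = (1 / real Q) ^ CARD('d)" by (simp add: a_def b_def)
  finally show "measure lebesgue (cell n Q p :: (real ^ 'd) set) = (1 / real Q) ^ CARD('d)" .
qed

lemma centered_cube_eq_cbox: "centered_cube r = cbox (\<chi> c. - r) (\<chi> c. r)"
proof -
  have "(\<bar>a\<bar> \<le> r) = (- r \<le> a \<and> a \<le> r)" for a :: real by auto
  then show ?thesis unfolding centered_cube_def set_eq_iff mem_Collect_eq mem_box_cart by simp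
qed

lemma measure_centered_cube:
  assumes "0 \<le> r"
  shows "(centered_cube r :: (real ^ 'd::finite) set) \<in> lmeasurable"
    "measure lebesgue (centered_cube r :: (real ^ 'd) set) = (2 * r) ^ CARD('d)"
proof -
  show "(centered_cube r :: (real ^ 'd) set) \<in> lmeasurable" by (simp add: centered_cube_eq_cbox)
  have "(0 :: real ^ 'd) \<in> cbox (\<chi> c. - r) (\<chi> c. r)" using assms by (simp add: mem_box_cart)
  hence "cbox (\<chi> c. - r) (\<chi> c. r :: real ^ 'd) \<noteq> {}" by blast
  then show "measure lebesgue (centered_cube r :: (real ^ 'd) set) = (2 * r) ^ CARD('d)"
    by (simp add: centered_cube_eq_cbox content_cbox_cart)
qed

section \<open>Riemann sums for the configuration integrals\<close>

definition pair_product :: "(real ^ 'd \<Rightarrow> real) \<Rightarrow> nat \<Rightarrow> (nat \<Rightarrow> real ^ 'd) \<Rightarrow> real" where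
  "pair_product f k x = (\<Prod>j<k. \<Prod>i<j. f (x i - x j))"

lemma pair_product_bounds:
  assumes "\<And>u. 0 \<le> f u" "\<And>u. f u \<le> 1"
  shows "0 \<le> pair_product f k x" "pair_product f k x \<le> 1"
  unfolding pair_product_def using assms by (auto intro!: prod_nonneg prod_le_1)

text \<open>For factors in [0, 1] the difference of two products is at most the sum of the
  differences of the factors; this is applied at both levels of the product.\<close>

lemma pair_product_diff:
  assumes f: "\<And>u. 0 \<le> f u" "\<And>u. f u \<le> 1" and g: "\<And>u. 0 \<le> g u" "\<And>u. g u \<le> 1"
  shows "\<bar>pair_product f k x - pair_product g k y\<bar> \<le> (\<Sum>j<k. \<Sum>i<j. \<bar>f (x i - x j) - g (y i - y j)\<bar>)"
proof -
  have "\<bar>pair_product f k x - pair_product g k y\<bar> \<le>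
      (\<Sum>j<k. \<bar>(\<Prod>i<j. f (x i - x j)) - (\<Prod>i<j. g (y i - y j))\<bar>)"
    unfolding pair_product_def real_norm_def[symmetric] using f g
    by (intro norm_prod_diff) (auto intro!: prod_le_1 simp: abs_prod)
  also have "\<dots> \<le> (\<Sum>j<k. \<Sum>i<j. \<bar>f (x i - x j) - g (y i - y j)\<bar>)"
    unfolding real_norm_def[symmetric] using f g by (intro sum_mono norm_prod_diff) auto
  finally show ?thesis .
qed

lemma exp_neg_energy:
  assumes "\<And>u. 0 \<le> \<phi> u"
  shows "exp_neg (energy \<phi> k x) = pair_product (\<lambda>u. exp_neg (\<phi> u)) k x"
  unfolding energy_def pair_product_def using assms by (simp add: exp_neg_sum sum_nonneg)

text \<open>Digit expansion decodes the single counter into a \<open>k\<close>-tuple of cells; the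
  last factor is the volume of a product of \<open>k\<close> cells.\<close>

lemma grid_coeff_eq:
  fixes \<phi> :: "real ^ 'd::finite \<Rightarrow> ereal"
  assumes "1 \<le> n" "1 \<le> Q"
  shows "grid_coeff \<phi> n Q k * fact k =
    (\<Sum>\<kappa>\<in>PiE {..<k} (\<lambda>_. {..<(2 * n * Q) ^ CARD('d)}).
       pair_product (boltzmann_approx \<phi> Q) k (\<lambda>i. corner n Q (\<kappa> i))) * ((1 / real Q) ^ CARD('d)) ^ k"
proof -
  let ?N = "2 * n * Q"
  let ?P = "?N ^ CARD('d)"
  have corner_diff: "(\<chi> c. real (digit ?N p (coord_index c)) / real Q - real (digit ?N p' (coord_index c)) / real Q) =
      (corner n Q p - corner n Q p' :: real ^ 'd)" for p p'
    by (simp add: corner_def vec_eq_iff)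
  have "(\<Sum>e<?P ^ k. \<Prod>j<k. \<Prod>i<j. boltzmann_approx \<phi> Q
        (\<chi> c. real (digit ?N (digit ?P e i) (coord_index c)) / real Q
           - real (digit ?N (digit ?P e j) (coord_index c)) / real Q)) =
     (\<Sum>\<kappa>\<in>PiE {..<k} (\<lambda>_. {..<?P}). pair_product (boltzmann_approx \<phi> Q) k (\<lambda>i. corner n Q (\<kappa> i)))"
    unfolding corner_diff using assms
    by (intro sum_digits) (auto simp: pair_product_def intro!: prod.cong)
  then show ?thesis unfolding grid_coeff_def by (simp add: power_divide)
qed

context regular_potential
begin

abbreviation "bf \<equiv> \<lambda>u. exp_neg (\<phi> u)"

definition config_integral :: "(real ^ 'd) set \<Rightarrow> nat \<Rightarrow> real" where
  "config_integral S k = (LINT x|Pi\<^sub>M {..<k} (\<lambda>_. lebesgue_on S). pair_product bf k x)"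

text \<open>Three sources of error, each of order \<open>1 / Q\<close>: the replacement of the
  exponential, the Lipschitz variation inside the layers, and the shells around the boundaries of
  the sets \<open>K t\<close>.\<close>

definition quad_const :: real where
  "quad_const = 9 + L * real CARD('d) + (\<Sum>t\<in>{1..l}. 2 ^ (CARD('d) + 1) * R * measure lebesgue (K t))"

lemma quad_const_pos: "0 < quad_const"
  unfolding quad_const_def using positive by (intro add_pos_nonneg sum_nonneg) auto

lemma bf_bounds: "0 \<le> bf u" "bf u \<le> 1"
  using exp_neg_bounds nonneg by auto

lemma pair_product_measurable:
  assumes "f \<in> borel_measurable borel"
  shows "pair_product f k \<in> borel_measurable (Pi\<^sub>M {..<k} (\<lambda>_. lebesgue_on S))"
  unfolding pair_product_def
proof (intro borel_measurable_prod)
  fix j i assume "j \<in> {..<k}" "i \<in> {..<j}"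
  hence "(\<lambda>x. x i - x j) \<in> Pi\<^sub>M {..<k} (\<lambda>_. lebesgue_on S) \<rightarrow>\<^sub>M borel"
    by (intro borel_measurable_diff measurable_component_lebesgue_on) auto
  then show "(\<lambda>x. f (x i - x j)) \<in> borel_measurable (Pi\<^sub>M {..<k} (\<lambda>_. lebesgue_on S))"
    by (rule measurable_compose) (rule assms)
qed

lemma pair_product_integrable:
  assumes "S \<in> lmeasurable"
  shows "integrable (Pi\<^sub>M {..<k} (\<lambda>_. lebesgue_on S)) (pair_product bf k)"
proof -
  interpret finite_measure "Pi\<^sub>M {..<k} (\<lambda>_. lebesgue_on S)"
    by (rule finite_measure_product_lebesgue_on[OF assms]) simp
  show ?thesis
    by (rule integrable_const_bound[where B = 1])
      (use pair_product_bounds[of bf k] bf_bounds pair_product_measurable[OF boltzmann_borel] in auto)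
qed

text \<open>The integrand is measurable already before completion, so completing the product measure
  does not change the integral.\<close>

lemma partition_function_coefficient:
  "(LINT x|completion (Pi\<^sub>M {..<k} (\<lambda>_. lebesgue_on S)). exp_neg (energy \<phi> k x)) = config_integral S k"
  unfolding config_integral_def exp_neg_energy[of \<phi>, OF nonneg]
  by (rule integral_completion[OF pair_product_measurable[OF boltzmann_borel]])

lemma config_integral_bounds:
  assumes "S \<in> lmeasurable"
  shows "0 \<le> config_integral S k" "config_integral S k \<le> measure lebesgue S ^ k"
proof -
  let ?M = "Pi\<^sub>M {..<k} (\<lambda>_::nat. lebesgue_on S)"
  interpret finite_measure ?M
    by (rule finite_measure_product_lebesgue_on[OF assms]) simp
  show "0 \<le> config_integral S k"
    unfolding config_integral_def using pair_product_bounds(1)[of bf k] bf_bounds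
    by (intro Bochner_Integration.integral_nonneg) auto
  have "config_integral S k \<le> (LINT x|?M. 1)"
    unfolding config_integral_def using pair_product_bounds(2)[of bf k] bf_bounds
    by (intro integral_mono pair_product_integrable[OF assms]) auto
  also have "\<dots> = measure lebesgue S ^ k"
    using measure_product_lebesgue_on[OF assms, of "{..<k}"] by simp
  finally show "config_integral S k \<le> measure lebesgue S ^ k" .
qed

lemma boltzmann_approx_variation:
  assumes "1 \<le> n" "2 \<le> Q" "R \<le> real Q" "x \<in> cell n Q p" "y \<in> cell n Q p'"
  shows "\<bar>bf (x - y) - boltzmann_approx \<phi> Q (corner n Q p - corner n Q p')\<bar> \<le>
    (9 + L * real CARD('d)) / real Q + (\<Sum>t\<in>{1..l}. indicator (shell (K t) (R / real Q)) (x - y))"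
proof -
  have Q: "0 < real Q" "1 \<le> Q" using assms by auto
  let ?v = "corner n Q p - corner n Q p' :: real ^ 'd"
  have "\<bar>bf (x - y) - bf ?v\<bar> \<le> L * (real CARD('d) * (1 / real Q)) +
      (\<Sum>t\<in>{1..l}. indicator (shell (K t) (R * (1 / real Q))) (x - y))"
  proof (rule boltzmann_variation)
    show "R * (1 / real Q) \<le> 1" using assms Q by simp
    fix c
    \<comment> \<open>Up to the common shift \<open>n\<close>, both points exceed their corners by
      an amount in \<open>[0, 1 / Q]\<close>; the differences are therefore off by
      \<open>1 / Q\<close> and not by twice as much.\<close>
    show "\<bar>(x - y) $ c - ?v $ c\<bar> \<le> 1 / real Q"
      using cell_corner[OF assms(1) Q(2) assms(4), of c] cell_corner[OF assms(1) Q(2) assms(5), of c]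
      by (simp add: abs_le_iff)
  qed (use Q in auto)
  moreover have "\<bar>boltzmann_approx \<phi> Q ?v - bf ?v\<bar> \<le> 9 / real Q"
    by (rule boltzmann_approx_error[OF nonneg assms(2)])
  ultimately show ?thesis by (simp add: add_divide_distrib)
qed

text \<open>The Riemann sum is the integral of the step function \<open>G\<close>, a combination of
  indicators of products of cells. Pointwise it differs from the integrand by at most
  \<open>H\<close>, a sum over pairs, and the configuration enters \<open>H\<close> only through
  shell indicators, whose integrals are governed by the volumes of thin shells.\<close>

lemma quadrature:
  assumes n: "1 \<le> n" and Q: "2 \<le> Q" "R \<le> real Q"
  shows "\<bar>grid_coeff \<phi> n Q k * fact k - config_integral (centered_cube (real n)) k\<bar> \<le>
    real k ^ 2 * (quad_const / real Q) * ((2 * real n) ^ CARD('d)) ^ k"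
proof -
  let ?sh = "\<lambda>u. \<Sum>t\<in>{1..l}. indicator (shell (K t) (R / real Q)) u :: real"
  define S :: "(real ^ 'd) set" where "S = centered_cube (real n)"
  define P where "P = (2 * n * Q) ^ CARD('d)"
  define V where "V = (2 * real n) ^ CARD('d)"
  let ?M = "Pi\<^sub>M {..<k} (\<lambda>_::nat. lebesgue_on S)"
  have Q1: "1 \<le> Q" and Q0: "0 < real Q" using Q by auto
  have S: "S \<in> lmeasurable" and V: "measure lebesgue S = V"
    unfolding S_def V_def using measure_centered_cube[of "real n"] by auto
  have V1: "1 \<le> V" unfolding V_def using n by (intro one_le_power) simp
  interpret product_sigma_finite "\<lambda>_::nat. lebesgue_on S" by (rule product_lebesgue_on[OF S])
  interpret fin: finite_measure ?M by (rule finite_measure_product_lebesgue_on[OF S]) simp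
  have space: "measure ?M (space ?M) = V ^ k"
    using measure_product_lebesgue_on[OF S, of "{..<k}"] V by simp
  define ba where "ba = boltzmann_approx \<phi> Q"
  have ba: "0 \<le> ba u" "ba u \<le> 1" for u
    unfolding ba_def using boltzmann_approx_bounds[of \<phi>, OF nonneg] by auto
  define g where "g \<kappa> = pair_product ba k (\<lambda>i. corner n Q (\<kappa> i))" for \<kappa> :: "nat \<Rightarrow> nat"
  define T where "T = PiE {..<k} (\<lambda>_. {..<P})"
  define G where "G x = (\<Sum>\<kappa>\<in>T. g \<kappa> * (\<Prod>i<k. indicator (cell n Q (\<kappa> i)) (x i)))" for x :: "nat \<Rightarrow> real ^ 'd"
  have cellS: "cell n Q p \<subseteq> S" for p by (auto simp: cell_def S_def)
  have cell_meas: "cell n Q p \<in> sets (lebesgue_on S)" for p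
  proof -
    have "(cell n Q p :: (real ^ 'd) set) \<in> sets lebesgue"
      using measure_cell(1)[OF n Q1] by (rule fmeasurableD)
    then show ?thesis
      using cellS[of p] S by (subst sets_restrict_space_iff) (auto simp: fmeasurableD)
  qed
  have cell_int: "integrable (lebesgue_on S) (indicator (cell n Q p) :: _ \<Rightarrow> real)"
    "integral\<^sup>L (lebesgue_on S) (indicator (cell n Q p)) = (1 / real Q) ^ CARD('d)" for p
  proof -
    interpret finite_measure "lebesgue_on S" by (rule finite_measure_lebesgue_on[OF S])
    show "integrable (lebesgue_on S) (indicator (cell n Q p) :: _ \<Rightarrow> real)"
      by (rule integrable_real_indicator[OF cell_meas]) (simp add: emeasure_eq_measure)
    have "cell n Q p \<inter> space (lebesgue_on S) = cell n Q p" using cellS[of p] by auto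
    hence "integral\<^sup>L (lebesgue_on S) (indicator (cell n Q p)) = measure (lebesgue_on S) (cell n Q p)"
      by simp
    also have "\<dots> = measure lebesgue (cell n Q p :: (real ^ 'd) set)"
      using cellS[of p] S by (intro measure_restrict_space) (auto simp: fmeasurableD)
    finally show "integral\<^sup>L (lebesgue_on S) (indicator (cell n Q p)) = (1 / real Q) ^ CARD('d)"
      using measure_cell(2)[OF n Q1, of p] by simp
  qed
  have int_prod: "integrable ?M (\<lambda>x. g \<kappa> * (\<Prod>i<k. indicator (cell n Q (\<kappa> i)) (x i)))" for \<kappa>
    by (intro integrable_mult_right product_integrable_prod cell_int) auto
  have intG: "integrable ?M G"
    unfolding G_def by (intro Bochner_Integration.integrable_sum int_prod)
  have "integral\<^sup>L ?M G = (\<Sum>\<kappa>\<in>T. g \<kappa> * (LINT x|?M. (\<Prod>i<k. indicator (cell n Q (\<kappa> i)) (x i))))"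
    unfolding G_def by (subst Bochner_Integration.integral_sum[OF int_prod]) simp
  also have "\<dots> = (\<Sum>\<kappa>\<in>T. g \<kappa> * ((1 / real Q) ^ CARD('d)) ^ k)"
  proof (intro sum.cong refl arg_cong[where f = "(*) (g _)"])
    fix \<kappa>
    have "(LINT x|?M. (\<Prod>i<k. indicator (cell n Q (\<kappa> i)) (x i))) =
        (\<Prod>i<k. integral\<^sup>L (lebesgue_on S) (indicator (cell n Q (\<kappa> i)) :: _ \<Rightarrow> real))"
      by (rule product_integral_prod) (auto intro: cell_int)
    also have "\<dots> = (\<Prod>i<k. (1 / real Q) ^ CARD('d))" by (simp only: cell_int(2))
    finally show "(LINT x|?M. (\<Prod>i<k. indicator (cell n Q (\<kappa> i)) (x i))) = ((1 / real Q) ^ CARD('d)) ^ k"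
      by simp
  qed
  also have "\<dots> = grid_coeff \<phi> n Q k * fact k"
    unfolding grid_coeff_eq[OF n Q1] T_def g_def P_def ba_def by (simp add: sum_distrib_right)
  finally have G: "integral\<^sup>L ?M G = grid_coeff \<phi> n Q k * fact k" .
  have T: "finite T" unfolding T_def by (intro finite_PiE) auto
  define e where "e = (9 + L * real CARD('d)) / real Q"
  define H where "H x = (\<Sum>j<k. \<Sum>i<j. e + ?sh (x i - x j))"
    for x :: "nat \<Rightarrow> real ^ 'd"
  have GH: "\<bar>G x - pair_product bf k x\<bar> \<le> H x" if x: "x \<in> space ?M" for x
  proof -
    have xS: "x i \<in> S" if "i < k" for i using x that by (auto simp: space_PiM PiE_def)
    define c where "c y = (THE p. p < P \<and> y \<in> cell n Q p)" for y :: "real ^ 'd"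
    have c: "c y < P \<and> y \<in> cell n Q (c y)" "\<And>p. p < P \<Longrightarrow> y \<in> cell n Q p \<Longrightarrow> p = c y" if "y \<in> S" for y
    proof -
      have ex: "\<exists>!p. p < P \<and> y \<in> cell n Q p"
        using exists_unique_cell[OF n Q1] that unfolding S_def P_def by blast
      show "c y < P \<and> y \<in> cell n Q (c y)" unfolding c_def by (rule theI'[OF ex])
      then show "\<And>p. p < P \<Longrightarrow> y \<in> cell n Q p \<Longrightarrow> p = c y" using ex by blast
    qed
    \<comment> \<open>A configuration lies in exactly one product of cells, so a single summand of
      \<open>G x\<close> survives.\<close>
    define \<kappa>0 where "\<kappa>0 = (\<lambda>i\<in>{..<k}. c (x i))"
    have \<kappa>0: "\<kappa>0 \<in> T" using c xS by (auto simp: \<kappa>0_def T_def)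
    have "(\<Prod>i<k. indicator (cell n Q (\<kappa> i)) (x i)) = (if \<kappa> = \<kappa>0 then 1 else 0 :: real)" if \<kappa>: "\<kappa> \<in> T" for \<kappa>
    proof (cases "\<kappa> = \<kappa>0")
      case True
      have "(\<Prod>i<k. indicator (cell n Q (\<kappa> i)) (x i)) = (\<Prod>i<k. 1 :: real)"
        using True c xS by (intro prod.cong) (auto simp: \<kappa>0_def)
      then show ?thesis using True by simp
    next
      case False
      have "\<exists>i<k. \<kappa> i \<noteq> \<kappa>0 i"
      proof (rule ccontr)
        assume "\<not> (\<exists>i<k. \<kappa> i \<noteq> \<kappa>0 i)"
        hence "\<kappa> = \<kappa>0" using \<kappa> \<kappa>0 unfolding T_def by (intro PiE_ext) auto
        with False show False by simp
      qed
      then obtain i where i: "i < k" "\<kappa> i \<noteq> c (x i)" by (auto simp: \<kappa>0_def)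
      have "\<kappa> i < P" using \<kappa> i by (auto simp: T_def PiE_def)
      with c(2)[OF xS[OF i(1)], of "\<kappa> i"] i have "x i \<notin> cell n Q (\<kappa> i)" by blast
      hence "\<exists>i\<in>{..<k}. indicator (cell n Q (\<kappa> i)) (x i) = (0::real)" using i by (intro bexI[of _ i]) auto
      then show ?thesis using False by (simp add: prod_zero)
    qed
    hence "G x = (\<Sum>\<kappa>\<in>T. if \<kappa> = \<kappa>0 then g \<kappa> else 0)"
      unfolding G_def by (intro sum.cong) auto
    hence "G x = g \<kappa>0" using T \<kappa>0 by simp
    hence "\<bar>G x - pair_product bf k x\<bar> = \<bar>pair_product bf k x - pair_product ba k (\<lambda>i. corner n Q (\<kappa>0 i))\<bar>"
      by (simp add: g_def abs_minus_commute)
    also have "\<dots> \<le> (\<Sum>j<k. \<Sum>i<j. \<bar>bf (x i - x j) - ba (corner n Q (\<kappa>0 i) - corner n Q (\<kappa>0 j))\<bar>)"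
      by (intro pair_product_diff bf_bounds ba)
    also have "\<dots> \<le> H x"
      unfolding H_def
    proof (intro sum_mono)
      fix j i assume ij: "j \<in> {..<k}" "i \<in> {..<j}"
      have "x i \<in> cell n Q (\<kappa>0 i)" "x j \<in> cell n Q (\<kappa>0 j)" using ij c xS by (auto simp: \<kappa>0_def)
      from boltzmann_approx_variation[OF n Q this]
      show "\<bar>bf (x i - x j) - ba (corner n Q (\<kappa>0 i) - corner n Q (\<kappa>0 j))\<bar> \<le>
          e + ?sh (x i - x j)"
        unfolding ba_def e_def .
    qed
    finally show ?thesis .
  qed
  have shell: "shell (K t) (R / real Q) \<in> sets borel" "shell (K t) (R / real Q) \<in> lmeasurable" if "t \<in> {1..l}" for t
    using that by (auto intro!: shell_measurable compact_K)
  have int_ind: "integrable ?M (\<lambda>x. indicator (shell (K t) (R / real Q)) (x i - x j) :: real)"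
    if "t \<in> {1..l}" "i < k" "j < k" for t i j
  proof (rule fin.integrable_const_bound[where B = 1])
    have diff: "(\<lambda>x. x i - x j) \<in> ?M \<rightarrow>\<^sub>M borel"
      using that by (intro borel_measurable_diff measurable_component_lebesgue_on) auto
    show "(\<lambda>x. indicator (shell (K t) (R / real Q)) (x i - x j) :: real) \<in> borel_measurable ?M"
      by (rule measurable_compose[OF diff borel_measurable_indicator[OF shell(1)[OF that(1)]]])
  qed auto
  have intH: "integrable ?M H"
    unfolding H_def by (intro Bochner_Integration.integrable_sum Bochner_Integration.integrable_add int_ind) auto
  have R: "0 \<le> R / real Q" "R / real Q \<le> 1" using positive Q Q0 by auto
  have shell_le: "measure lebesgue (shell (K t) (R / real Q)) \<le>
      2 ^ (CARD('d) + 1) * R * measure lebesgue (K t) / real Q" if t: "t \<in> {1..l}" for t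
  proof -
    have "0 \<in> K t" using cube_subset_K[OF t] zero_in_centered_cube[of "1 / R"] positive by auto
    from measure_shell[OF compact_K K_properties(1)[OF t] this R] t show ?thesis by simp
  qed
  have pair: "(LINT x|?M. e + ?sh (x i - x j)) \<le>
      quad_const / real Q * V ^ k" if ij: "j < k" "i < j" for i j
  proof -
    have "(LINT x|?M. e + ?sh (x i - x j)) =
        e * V ^ k + (\<Sum>t\<in>{1..l}. (LINT x|?M. indicator (shell (K t) (R / real Q)) (x i - x j)))"
      using ij space by (subst Bochner_Integration.integral_add)
        (auto intro!: int_ind Bochner_Integration.integrable_sum Bochner_Integration.integral_sum)
    also have "\<dots> \<le> e * V ^ k + (\<Sum>t\<in>{1..l}. (2 ^ (CARD('d) + 1) * R * measure lebesgue (K t) / real Q) * V ^ k)"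
    proof (intro add_left_mono sum_mono)
      fix t assume t: "t \<in> {1..l}"
      have "(LINT x|?M. indicator (shell (K t) (R / real Q)) (x i - x j)) \<le>
          measure lebesgue (shell (K t) (R / real Q)) * V ^ (k - 1)"
        using integral_difference_indicator[OF S shell[OF t], of i k j] ij V by simp
      also have "\<dots> \<le> (2 ^ (CARD('d) + 1) * R * measure lebesgue (K t) / real Q) * V ^ k"
        using V1 positive by (intro mult_mono shell_le[OF t] power_increasing) auto
      finally show "(LINT x|?M. indicator (shell (K t) (R / real Q)) (x i - x j)) \<le>
        (2 ^ (CARD('d) + 1) * R * measure lebesgue (K t) / real Q) * V ^ k" .
    qed
    also have "\<dots> = quad_const / real Q * V ^ k"
      unfolding quad_const_def e_def
      by (simp add: add_divide_distrib distrib_right sum_divide_distrib sum_distrib_right)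
    finally show ?thesis .
  qed
  have "\<bar>integral\<^sup>L ?M G - config_integral S k\<bar> = \<bar>LINT x|?M. G x - pair_product bf k x\<bar>"
    unfolding config_integral_def
    by (subst Bochner_Integration.integral_diff) (auto intro: intG pair_product_integrable[OF S])
  also have "\<dots> \<le> (LINT x|?M. \<bar>G x - pair_product bf k x\<bar>)"
    by (rule integral_abs_bound)
  also have "\<dots> \<le> integral\<^sup>L ?M H"
    by (intro integral_mono intH integrable_abs Bochner_Integration.integrable_diff intG
        pair_product_integrable[OF S] GH)
  also have "\<dots> = (\<Sum>j<k. \<Sum>i<j. LINT x|?M. e + ?sh (x i - x j))"
    unfolding H_def
    by (subst Bochner_Integration.integral_sum, (intro Bochner_Integration.integrable_sum Bochner_Integration.integrable_add int_ind; simp),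
        intro sum.cong refl Bochner_Integration.integral_sum Bochner_Integration.integrable_sum Bochner_Integration.integrable_add int_ind) auto
  also have "\<dots> \<le> (\<Sum>j<k. \<Sum>i<k. quad_const / real Q * V ^ k)"
  proof (rule sum_mono)
    fix j assume "j \<in> {..<k}"
    hence j: "j < k" by simp
    have "(\<Sum>i<j. LINT x|?M. e + ?sh (x i - x j)) \<le>
        (\<Sum>i<j. quad_const / real Q * V ^ k)" using pair[OF j] by (intro sum_mono) auto
    also have "\<dots> \<le> (\<Sum>i<k. quad_const / real Q * V ^ k)"
      using j quad_const_pos V1 by (intro sum_mono2) auto
    finally show "(\<Sum>i<j. LINT x|?M. e + ?sh (x i - x j)) \<le>
        (\<Sum>i<k. quad_const / real Q * V ^ k)" .
  qed
  also have "\<dots> = real k ^ 2 * (quad_const / real Q) * V ^ k" by (simp add: power2_eq_square)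
  finally show ?thesis unfolding G unfolding V_def S_def .
qed

end

section \<open>Error analysis\<close>

lemma power_coeff_of_real:
  "power_coeff (\<lambda>t. of_real (u t) :: complex) r i = of_real (power_coeff u r i)"
  unfolding power_coeff_def of_real_sum by (intro sum.cong refl) auto

lemma log_series_sum_of_real:
  "log_series_sum (\<lambda>j. of_real (v j) :: complex) m = of_real (log_series_sum v m)"
  unfolding log_series_sum_def of_real_sum power_coeff_of_real by (intro sum.cong refl) simp

context regular_potential
begin

definition config_coeff :: "(real ^ 'd) set \<Rightarrow> nat \<Rightarrow> real" where
  "config_coeff S k = config_integral S k / fact k"

lemma config_coeff_bounds:
  assumes "S \<in> lmeasurable"
  shows "0 \<le> config_coeff S k" "config_coeff S k \<le> measure lebesgue S ^ k / fact k"
  using config_integral_bounds[OF assms, of k] by (auto simp: config_coeff_def divide_right_mono)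

lemma partition_function_sums:
  fixes z :: "'a::{real_normed_field,banach}"
  assumes S: "S \<in> lmeasurable"
  shows "(\<lambda>k. of_real (config_coeff S k) * z ^ k) sums partition_function \<phi> S z"
proof -
  have "summable (\<lambda>k. of_real (config_coeff S k) * z ^ k)"
  proof (rule summable_comparison_test')
    show "summable (\<lambda>k. inverse (fact k) * (measure lebesgue S * norm z) ^ k)"
      by (rule summable_exp)
    fix k :: nat assume "k \<ge> 0"
    have "norm (of_real (config_coeff S k) * z ^ k) = config_coeff S k * norm z ^ k"
      using config_coeff_bounds(1)[OF S, of k] by (simp add: norm_mult norm_power)
    also have "\<dots> \<le> (measure lebesgue S ^ k / fact k) * norm z ^ k"
      by (intro mult_right_mono config_coeff_bounds(2)[OF S]) auto
    also have "\<dots> = inverse (fact k) * (measure lebesgue S * norm z) ^ k"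
      by (simp add: power_mult_distrib divide_inverse mult_ac)
    finally show "norm (of_real (config_coeff S k) * z ^ k) \<le> inverse (fact k) * (measure lebesgue S * norm z) ^ k" .
  qed
  moreover have "partition_function \<phi> S z = (\<Sum>k. of_real (config_coeff S k) * z ^ k)"
    unfolding partition_function_def partition_function_coefficient
    by (simp add: config_coeff_def mult.commute)
  ultimately show ?thesis by (simp add: summable_sums)
qed

lemma partition_function_of_real:
  assumes "S \<in> lmeasurable"
  shows "partition_function \<phi> S (complex_of_real x) = of_real (partition_function \<phi> S x)"
proof -
  have "(\<lambda>k. complex_of_real (config_coeff S k * x ^ k)) sums of_real (partition_function \<phi> S x)"
    using partition_function_sums[OF assms, of x] by (intro sums_of_real) simp
  moreover have "(\<lambda>k. complex_of_real (config_coeff S k * x ^ k)) sums partition_function \<phi> S (complex_of_real x)"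
    using partition_function_sums[OF assms, of "complex_of_real x"] by simp
  ultimately show ?thesis by (rule sums_unique2[symmetric])
qed

lemma partition_function_nonneg:
  assumes "S \<in> lmeasurable" "0 \<le> (x :: real)"
  shows "0 \<le> partition_function \<phi> S x"
  using sums_le[OF _ sums_zero partition_function_sums[OF assms(1), of x]]
    config_coeff_bounds(1)[OF assms(1)] assms(2) by simp

text \<open>The counterpart of \<open>composed_coeff\<close> with exact integrals: the Taylor
  coefficients of \<open>Z (lam * q w)\<close> without the constant term.\<close>

definition exact_coeff :: "(real ^ 'd) set \<Rightarrow> real \<Rightarrow> rat list \<Rightarrow> nat \<Rightarrow> real" where
  "exact_coeff S lam qs j = (if j = 0 then 0 else
     \<Sum>k<j + 1. config_coeff S k * lam ^ k * power_coeff (list_coeff qs) k j)"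

lemma log_partition_function_approx:
  assumes S: "S \<in> lmeasurable" "0 < measure lebesgue S"
    and U: "0 < \<delta>" "logZ holomorphic_on segment_nbhd \<delta> lam" "logZ 0 = 0"
    and logZ: "\<And>z. z \<in> segment_nbhd \<delta> lam \<Longrightarrow>
       exp (logZ z) = partition_function \<phi> S z \<and> 1 / measure lebesgue S * cmod (logZ z) \<le> C"
    and lam: "0 \<le> lam" and r: "1 < r" and q0: "list_coeff qs 0 = 0"
    and q1: "(\<Sum>t<length qs. list_coeff qs t) = 1"
    and q: "\<And>w. cmod w \<le> r \<Longrightarrow>
       infdist (\<Sum>t<length qs. of_real (list_coeff qs t) * w ^ t) (complex_of_real ` {0..1}) < \<delta> / (lam + 1)"
  shows "cmod (logZ (of_real lam) - of_real (log_series_sum (exact_coeff S lam qs) m)) \<le>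
     C * measure lebesgue S / ((1 + r) / 2 - 1) * (1 / ((1 + r) / 2)) ^ m"
proof -
  define V where "V = measure lebesgue S"
  define qf where "qf = (\<lambda>w :: complex. \<Sum>t<length qs. of_real (list_coeff qs t) * w ^ t)"
  define p where "p w = of_real lam * qf w" for w
  define G where "G = (\<lambda>w. logZ (p w))"
  have p_in: "p w \<in> segment_nbhd \<delta> lam" if w: "cmod w \<le> r" for w
  proof -
    have J: "complex_of_real ` {0..1} \<noteq> {}" "closed (complex_of_real ` {0..1})"
      by (auto intro!: compact_imp_closed compact_continuous_image continuous_intros)
    obtain x where x: "x \<in> {0..1}" "infdist (qf w) (complex_of_real ` {0..1}) = dist (qf w) (of_real x)"
      using infdist_attains_inf[OF J(2,1)] by blast
    hence d: "dist (qf w) (of_real x) < \<delta> / (lam + 1)" using q[OF w] by (simp add: qf_def)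
    have "infdist (p w) (complex_of_real ` {0..lam}) \<le> dist (p w) (of_real (lam * x))"
      using x lam by (intro infdist_le imageI) (auto simp: mult_left_le)
    also have "\<dots> = lam * dist (qf w) (of_real x)"
      using lam by (simp add: p_def dist_norm right_diff_distrib[symmetric] norm_mult)
    also have "\<dots> \<le> lam * (\<delta> / (lam + 1))" using d lam by (intro mult_left_mono) auto
    \<comment> \<open>Dividing by \<open>lam + 1\<close> rather than \<open>lam\<close> keeps this
      strict and covers \<open>lam = 0\<close>.\<close>
    also have "\<dots> < \<delta>" using lam U(1) by (simp add: field_simps)
    finally show ?thesis by (simp add: segment_nbhd_def)
  qed
  \<comment> \<open>Cauchy's estimate needs a closed disc inside the open disc of holomorphy, hence
    a radius strictly between 1 and \<open>r\<close>.\<close>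
  define \<rho> where "\<rho> = (1 + r) / 2"
  have \<rho>: "1 < \<rho>" "\<rho> < r" using r by (auto simp: \<rho>_def)
  have q_hol: "p holomorphic_on A" for A
    unfolding p_def qf_def by (intro holomorphic_intros)
  have "G holomorphic_on ball 0 r"
    unfolding G_def
  proof (rule holomorphic_on_compose_gen[OF q_hol U(2), unfolded comp_def])
    show "p ` ball 0 r \<subseteq> segment_nbhd \<delta> lam" using p_in by auto
  qed
  moreover have "cmod (G w) \<le> C * V" if "w \<in> cball 0 \<rho>" for w
  proof -
    have "1 / V * cmod (logZ (p w)) \<le> C"
      using logZ[OF p_in, of w] that \<rho> by (simp add: V_def)
    then show ?thesis using S(2) by (simp add: G_def V_def field_simps)
  qed
  moreover have "G 0 = 0"
  proof -
    have "qf 0 = (\<Sum>t<length qs. 0)"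
      unfolding qf_def using q0 by (intro sum.cong) (auto simp: power_0_left)
    then show ?thesis by (simp add: G_def p_def U(3))
  qed
  moreover define Zf where "Zf = Abs_fps (\<lambda>k. complex_of_real (config_coeff S k))"
  moreover define Qf where "Qf = Abs_fps (\<lambda>t. complex_of_real (list_coeff qs t))"
  moreover define Pf where "Pf = fps_const (of_real lam) * Qf"
  \<comment> \<open>Since \<open>p 0 = 0\<close>, the expansion of \<open>Z\<close> after
    \<open>p\<close> is a composition of formal power series; its coefficients are the finite sums
    in \<open>exact_coeff\<close>.\<close>
  moreover have "(\<lambda>w. exp (G w)) has_fps_expansion (Zf oo Pf)"
  proof -
    have Z: "partition_function \<phi> S has_fps_expansion Zf"
      using partition_function_sums[OF S(1), where 'a = complex]
      by (intro has_fps_expansionI always_eventually) (simp add: Zf_def)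
    have "qf has_fps_expansion Qf"
    proof (intro has_fps_expansionI always_eventually allI)
      fix u :: complex
      show "(\<lambda>n. fps_nth Qf n * u ^ n) sums qf u"
        unfolding qf_def Qf_def by (simp, rule sums_finite) (auto simp: list_coeff_def)
    qed
    hence P: "p has_fps_expansion Pf"
      unfolding p_def Pf_def by (intro fps_expansion_intros)
    have "fps_nth Pf 0 = 0" by (simp add: Pf_def Qf_def q0)
    from has_fps_expansion_compose[OF Z P this]
    have comp: "(partition_function \<phi> S \<circ> p) has_fps_expansion (Zf oo Pf)" .
    have "eventually (\<lambda>w. w \<in> ball 0 r) (nhds (0::complex))"
      using r by (intro eventually_nhds_in_open) auto
    hence "eventually (\<lambda>w. (partition_function \<phi> S \<circ> p) w = exp (G w)) (nhds 0)"
      by eventually_elim (use logZ p_in in \<open>simp add: G_def\<close>)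
    with comp show ?thesis by (subst has_fps_expansion_cong[OF _ refl]) (auto elim: eventually_mono)
  qed
  ultimately have "cmod (G 1 - log_series_sum (\<lambda>j. if j = 0 then 0 else fps_nth (Zf oo Pf) j) m) \<le>
      C * V / (\<rho> - 1) * (1 / \<rho>) ^ m"
    using \<rho> by (intro truncated_log_bound[where \<rho> = r]) auto
  moreover have "(\<lambda>j. if j = 0 then 0 else fps_nth (Zf oo Pf) j) = (\<lambda>j. of_real (exact_coeff S lam qs j))"
  proof
    fix j
    have "fps_nth (Zf oo Pf) j = (\<Sum>k<j + 1. of_real (config_coeff S k * lam ^ k * power_coeff (list_coeff qs) k j))"
      unfolding fps_compose_nth Zf_def Pf_def Qf_def power_mult_distrib fps_const_power
      by (intro sum.cong) (auto simp: power_coeff_eq_fps[symmetric] power_coeff_of_real)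
    then show "(if j = 0 then 0 else fps_nth (Zf oo Pf) j) = of_real (exact_coeff S lam qs j)"
      by (simp add: exact_coeff_def)
  qed
  moreover have "qf 1 = 1"
    unfolding qf_def using arg_cong[OF q1, of complex_of_real] by simp
  hence "G 1 = logZ (of_real lam)" by (simp add: G_def p_def)
  ultimately show ?thesis by (simp add: log_series_sum_of_real V_def \<rho>_def)
qed

end

text \<open>This preserves the geometric form \<open>M ^ j\<close> that
  \<open>log_series_sum_diff_bound\<close> asks for. The base \<open>W\<close> is at least 1, so
  \<open>k\<close> can be raised to \<open>j\<close>, and the \<open>j + 1 \<le> 2 ^ j\<close>
  summands account for the factor 2. It serves with \<open>\<eta> = 1\<close> for the sizes of the
  coefficients and with \<open>\<eta>\<close> of order \<open>1 / Q\<close> for their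
  differences.\<close>

lemma weighted_coeff_bound:
  fixes a :: "nat \<Rightarrow> real"
  assumes a: "\<And>k. k \<le> m \<Longrightarrow> \<bar>a k\<bar> \<le> \<eta> * V ^ k" and V: "1 \<le> V" and \<eta>: "0 \<le> \<eta>" and lam: "0 \<le> lam"
    and u: "\<And>t. \<bar>u t\<bar> \<le> 1" and j: "j \<le> m"
  shows "\<bar>\<Sum>k<j + 1. a k * lam ^ k * power_coeff u k j\<bar> \<le> \<eta> * (2 * (real m + 1) * V * max 1 lam) ^ j"
proof -
  define W where "W = (real m + 1) * V * max 1 lam"
  have "1 * 1 \<le> (real m + 1) * V" using V by (intro mult_mono) auto
  hence "1 * 1 \<le> ((real m + 1) * V) * max 1 lam" by (intro mult_mono) auto
  hence W: "1 \<le> W" by (simp add: W_def)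
  have "\<bar>\<Sum>k<j + 1. a k * lam ^ k * power_coeff u k j\<bar> \<le> (\<Sum>k<j + 1. \<eta> * W ^ j)"
  proof (intro order_trans[OF sum_abs] sum_mono)
    fix k assume "k \<in> {..<j + 1}"
    hence k: "k \<le> j" by auto
    have "\<bar>power_coeff u k j\<bar> \<le> (real j + 1) ^ k * 1 ^ j"
      unfolding power_coeff_eq_fps real_norm_def[symmetric]
      by (rule fps_power_nth_bound) (use u in auto)
    also have "\<dots> \<le> (real m + 1) ^ k" using j by (simp add: power_mono)
    finally have pc: "\<bar>power_coeff u k j\<bar> \<le> (real m + 1) ^ k" .
    have "lam ^ k \<le> max 1 lam ^ k" using lam by (intro power_mono) auto
    hence "\<bar>a k * lam ^ k\<bar> \<le> (\<eta> * V ^ k) * max 1 lam ^ k"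
      unfolding abs_mult using a[of k] j k lam V \<eta> by (intro mult_mono) auto
    hence "\<bar>a k * lam ^ k * power_coeff u k j\<bar> \<le> ((\<eta> * V ^ k) * max 1 lam ^ k) * (real m + 1) ^ k"
      unfolding abs_mult[of "a k * lam ^ k"] using pc \<eta> V by (intro mult_mono) auto
    also have "\<dots> = \<eta> * W ^ k" by (simp add: W_def power_mult_distrib mult_ac)
    also have "\<dots> \<le> \<eta> * W ^ j" using W k \<eta> by (intro mult_left_mono power_increasing) auto
    finally show "\<bar>a k * lam ^ k * power_coeff u k j\<bar> \<le> \<eta> * W ^ j" .
  qed
  also have "\<dots> = real (j + 1) * (\<eta> * W ^ j)" by simp
  also have "\<dots> \<le> 2 ^ j * (\<eta> * W ^ j)"
  proof (rule mult_right_mono)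
    have "j + 1 \<le> 2 ^ j" by (simp add: Suc_leI)
    then show "real (j + 1) \<le> 2 ^ j" by (metis of_nat_le_iff of_nat_numeral of_nat_power)
  qed (use \<eta> W in simp)
  also have "\<dots> = \<eta> * (2 * W) ^ j" unfolding power_mult_distrib[of 2 W] by simp
  also have "2 * W = 2 * (real m + 1) * V * max 1 lam" by (simp add: W_def)
  finally show ?thesis .
qed

context regular_potential
begin

text \<open>Every summand is at most 1, and the number of summands times the volume of a product of
  \<open>k\<close> cells is the \<open>k\<close>-th power of the volume of the cube.\<close>

lemma grid_coeff_bound:
  assumes "1 \<le> n" "1 \<le> Q"
  shows "\<bar>grid_coeff \<phi> n Q k\<bar> \<le> ((2 * real n) ^ CARD('d)) ^ k"
proof -
  let ?P = "(2 * n * Q) ^ CARD('d)"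
  let ?T = "PiE {..<k} (\<lambda>_. {..<?P})"
  have Q: "0 < real Q" using assms by simp
  define s where "s = (\<Sum>\<kappa>\<in>?T. pair_product (boltzmann_approx \<phi> Q) k (\<lambda>i. corner n Q (\<kappa> i)))"
  have ba: "0 \<le> boltzmann_approx \<phi> Q u" "boltzmann_approx \<phi> Q u \<le> 1" for u
    using boltzmann_approx_bounds[of \<phi>, OF nonneg] by auto
  have s0: "0 \<le> s" unfolding s_def by (intro sum_nonneg pair_product_bounds ba)
  have "s \<le> (\<Sum>\<kappa>\<in>?T. 1)" unfolding s_def by (intro sum_mono pair_product_bounds ba)
  also have "\<dots> = real ?P ^ k" by (simp add: card_PiE)
  finally have s1: "s \<le> real ?P ^ k" .
  have eq: "grid_coeff \<phi> n Q k * fact k = s * ((1 / real Q) ^ CARD('d)) ^ k"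
    unfolding s_def by (rule grid_coeff_eq[OF assms])
  have "s * ((1 / real Q) ^ CARD('d)) ^ k \<le> real ?P ^ k * ((1 / real Q) ^ CARD('d)) ^ k"
    using s1 by (intro mult_right_mono) auto
  also have "\<dots> = ((real (2 * n * Q) * (1 / real Q)) ^ CARD('d)) ^ k"
    by (simp only: of_nat_power power_mult_distrib[of "real (2 * n * Q)"]
        power_mult_distrib[of "real (2 * n * Q) ^ CARD('d)"])
  also have "real (2 * n * Q) * (1 / real Q) = 2 * real n" using Q by simp
  finally have le: "grid_coeff \<phi> n Q k * fact k \<le> ((2 * real n) ^ CARD('d)) ^ k" using eq by simp
  have g0: "0 \<le> grid_coeff \<phi> n Q k"
  proof -
    have "0 \<le> grid_coeff \<phi> n Q k * fact k" using eq s0 by simp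
    moreover have "0 < (fact k :: real)" by simp
    ultimately show ?thesis using zero_le_mult_iff[of "grid_coeff \<phi> n Q k" "fact k"] by linarith
  qed
  have "grid_coeff \<phi> n Q k \<le> grid_coeff \<phi> n Q k * fact k"
    using g0 by (simp add: mult_le_cancel_left1)
  with le g0 show ?thesis by simp
qed

lemma log_series_sum_error:
  assumes n: "1 \<le> n" and Q: "2 \<le> Q" "R \<le> real Q" and lam: "0 \<le> lam"
    and qs: "\<And>t. \<bar>list_coeff qs t\<bar> \<le> 1"
  shows "\<bar>log_series_sum (exact_coeff (centered_cube (real n)) lam qs) m -
      log_series_sum (composed_coeff \<phi> n Q lam qs) m\<bar> \<le>
    (real m + 1) ^ (m + 2) * (2 * (real m + 1) * (2 * real n) ^ CARD('d) * max 1 lam) ^ m *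
      (real m ^ 2 * quad_const / real Q)"
proof -
  define V where "V = (2 * real n) ^ CARD('d)"
  define S :: "(real ^ 'd) set" where "S = centered_cube (real n)"
  have S: "S \<in> lmeasurable" "measure lebesgue S = V"
    unfolding S_def V_def using measure_centered_cube[of "real n"] by auto
  have V1: "1 \<le> V" unfolding V_def using n by (intro one_le_power) simp
  define M where "M = 2 * (real m + 1) * V * max 1 lam"
  have "1 * 1 * 1 * 1 \<le> M" unfolding M_def using V1 by (intro mult_mono) auto
  hence M: "1 \<le> M" by simp
  have Q1: "1 \<le> Q" using Q by simp
  have M0: "0 \<le> M ^ j" for j using M by simp
  have exact_k: "\<bar>config_coeff S k\<bar> \<le> 1 * V ^ k" for k
  proof -
    have "config_coeff S k \<le> V ^ k / fact k" using config_coeff_bounds(2)[OF S(1), of k] S(2) by simp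
    also have "\<dots> \<le> V ^ k" using V1 by (simp add: divide_le_eq mult_le_cancel_left1)
    finally show ?thesis using config_coeff_bounds(1)[OF S(1), of k] by simp
  qed
  have diff_k: "\<bar>config_coeff S k - grid_coeff \<phi> n Q k\<bar> \<le> (real m ^ 2 * quad_const / real Q) * V ^ k" if "k \<le> m" for k
  proof -
    have "config_coeff S k - grid_coeff \<phi> n Q k = (config_integral S k - grid_coeff \<phi> n Q k * fact k) / fact k"
      by (simp add: config_coeff_def field_simps)
    hence "\<bar>config_coeff S k - grid_coeff \<phi> n Q k\<bar> = \<bar>grid_coeff \<phi> n Q k * fact k - config_integral S k\<bar> / fact k"
      by (simp add: abs_minus_commute)
    also have "\<dots> \<le> \<bar>grid_coeff \<phi> n Q k * fact k - config_integral S k\<bar>"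
      by (simp add: divide_le_eq mult_le_cancel_left1)
    also have "\<dots> \<le> real k ^ 2 * (quad_const / real Q) * V ^ k"
      using quadrature[OF n Q, of k] by (simp add: S_def V_def)
    also have "\<dots> \<le> real m ^ 2 * (quad_const / real Q) * V ^ k"
      using that quad_const_pos V1 by (intro mult_right_mono power_mono) auto
    finally show ?thesis by simp
  qed
  have e: "\<bar>exact_coeff S lam qs j\<bar> \<le> M ^ j" if "j \<le> m" for j
    using weighted_coeff_bound[of m "config_coeff S" 1 V lam "list_coeff qs" j] exact_k V1 lam qs that M0[of j]
    by (auto simp: exact_coeff_def M_def)
  have c: "\<bar>composed_coeff \<phi> n Q lam qs j\<bar> \<le> M ^ j" if "j \<le> m" for j
    using weighted_coeff_bound[of m "grid_coeff \<phi> n Q" 1 V lam "list_coeff qs" j] grid_coeff_bound[OF n Q1]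
      V1 lam qs that M0[of j]
    by (auto simp: composed_coeff_def M_def V_def)
  have ec: "\<bar>exact_coeff S lam qs j - composed_coeff \<phi> n Q lam qs j\<bar> \<le> (real m ^ 2 * quad_const / real Q) * M ^ j"
    if "j \<le> m" for j
  proof (cases "j = 0")
    case True
    then show ?thesis using quad_const_pos by (simp add: exact_coeff_def composed_coeff_def)
  next
    case False
    have "exact_coeff S lam qs j - composed_coeff \<phi> n Q lam qs j =
       (\<Sum>k<j + 1. (config_coeff S k - grid_coeff \<phi> n Q k) * lam ^ k * power_coeff (list_coeff qs) k j)"
      using False unfolding exact_coeff_def composed_coeff_def
      by (simp add: sum_subtractf[symmetric] left_diff_distrib del: sum.lessThan_Suc)
    also have "\<bar>\<dots>\<bar> \<le> (real m ^ 2 * quad_const / real Q) * M ^ j"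
      unfolding M_def using diff_k V1 lam qs that quad_const_pos by (intro weighted_coeff_bound) auto
    finally show ?thesis .
  qed
  show ?thesis
    using log_series_sum_diff_bound[OF e c ec M] quad_const_pos unfolding M_def V_def S_def by simp
qed

end

text \<open>The logarithm of the approximation is \<open>Q * ln (1 + T / Q)\<close>, which differs
  from \<open>T\<close> by at most \<open>2 * T\<^sup>2 / Q\<close>. One half of
  \<open>\<epsilon>\<close> pays for this, the other for the error of \<open>T\<close>.\<close>

lemma exp_approx_of_log:
  fixes T lz Z :: real
  assumes Z: "0 < Z" "\<bar>ln Z - T\<bar> \<le> \<epsilon> / 2" and Q: "0 < Q" and T: "\<bar>T\<bar> / real Q \<le> 1 / 2" "2 * T\<^sup>2 / real Q \<le> \<epsilon> / 2"
  shows "is_approximation \<epsilon> ((1 + T / real Q) ^ Q) Z"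
proof -
  define y where "y = T / real Q"
  have Q0: "0 < real Q" using Q by simp
  have y: "\<bar>y\<bar> \<le> 1 / 2" using T(1) Q0 by (simp add: y_def)
  hence y1: "0 < 1 + y" by linarith
  define A where "A = (1 + y) ^ Q"
  have A: "0 < A" using y1 by (simp add: A_def)
  have "ln A = real Q * ln (1 + y)" using y1 by (simp add: A_def ln_realpow)
  moreover have "T = real Q * y" using Q0 by (simp add: y_def)
  ultimately have "\<bar>ln A - T\<bar> = real Q * \<bar>ln (1 + y) - y\<bar>"
    using Q0 by (simp add: right_diff_distrib[symmetric] abs_mult)
  also have "\<dots> \<le> real Q * (2 * y\<^sup>2)"
    using abs_ln_one_plus_x_minus_x_bound[OF y] Q0 by (intro mult_left_mono) auto
  also have "\<dots> = 2 * T\<^sup>2 / real Q" using Q0 by (simp add: y_def power2_eq_square)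
  finally have "\<bar>ln A - T\<bar> \<le> \<epsilon> / 2" using T(2) by linarith
  hence d: "\<bar>ln Z - ln A\<bar> \<le> \<epsilon>" using Z(2) by linarith
  have "exp (ln A - \<epsilon>) \<le> exp (ln Z)" "exp (ln Z) \<le> exp (\<epsilon> + ln A)" using d by (simp_all add: abs_le_iff)
  hence "exp (- \<epsilon>) * A \<le> Z" "Z \<le> exp \<epsilon> * A"
    using A Z(1) by (simp_all add: exp_diff exp_add exp_minus divide_inverse mult.commute)
  then show ?thesis unfolding is_approximation_def A_def y_def by simp
qed

text \<open>The binary logarithm rounded up, and \<open>0\<close> for \<open>y \<le> 1\<close>. In
  this form the machine finds it by comparing \<open>y\<close> with powers of two.\<close>

definition log_size :: "real \<Rightarrow> nat" where
  "log_size y = (LEAST i. y \<le> 2 ^ i)"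

lemma log_size_ge: "y \<le> 2 ^ log_size y"
proof -
  obtain i :: nat where "y < 2 ^ i" using real_arch_pow[of 2 y] by auto
  hence "y \<le> 2 ^ i" by simp
  then show ?thesis unfolding log_size_def by (rule LeastI)
qed

lemma less_log_size_iff: "i < log_size y \<longleftrightarrow> 2 ^ i < y"
proof
  assume "i < log_size y"
  then show "2 ^ i < y" unfolding log_size_def using not_less_Least by fastforce
next
  assume "2 ^ i < y"
  also have "y \<le> 2 ^ log_size y" by (rule log_size_ge)
  finally show "i < log_size y" by simp
qed

lemma real_le_two_power: "\<exists>i. x \<le> (2::real) ^ i"
  using log_size_ge[of x] by blast

section \<open>Choice of the degree and the mesh\<close>

lemma volume_bounds:
  fixes V \<epsilon> :: real
  assumes "1 \<le> V" "V / \<epsilon> \<le> 2 ^ m0" "0 < \<epsilon>" "\<epsilon> < 1"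
  shows "V \<le> 2 ^ m0" "1 \<le> \<epsilon> * 2 ^ m0"
proof -
  have "V * 1 \<le> V * (1 / \<epsilon>)" using assms by (intro mult_left_mono) auto
  then show "V \<le> 2 ^ m0" using assms by simp
  have "1 / \<epsilon> \<le> V / \<epsilon>" using assms by (intro divide_right_mono) auto
  hence "1 / \<epsilon> \<le> 2 ^ m0" using assms by simp
  then show "1 \<le> \<epsilon> * 2 ^ m0" using assms by (simp add: field_simps)
qed

text \<open>Every summand has degree at most two in \<open>m0\<close>, so for
  \<open>m0 \<ge> 1\<close> it is at most its coefficient times \<open>m0 * m0\<close>. The final
  \<open>2 + m0\<close> stands for the factor \<open>4 * 2 ^ m0\<close>, which is at least
  \<open>4 / \<epsilon>\<close> where the lemma is applied.\<close>

lemma error_exponent: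
  fixes A a b m0 :: nat
  assumes "1 \<le> m0" "A * (A + 2) + (2 + A + a) * A + 2 * A + b + 3 \<le> B"
  shows "A * m0 * (A * m0 + 2) + (1 + A * m0 + m0 + a) * (A * m0) + A * m0 * 2 + b + (2 + m0) \<le> B * m0 * m0"
proof -
  define s where "s = m0 * m0"
  have s: "m0 \<le> s" "1 \<le> s" using assms by (auto simp: s_def)
  have "A * m0 * (A * m0 + 2) + (1 + A * m0 + m0 + a) * (A * m0) + A * m0 * 2 + b + (2 + m0) =
      A * A * s + 2 * A * m0 + (A * m0 + A * A * s + A * s + a * A * m0) + 2 * A * m0 + b * 1 + 2 * 1 + m0"
    by (simp add: s_def algebra_simps)
  also have "\<dots> \<le> A * A * s + 2 * A * s + (A * s + A * A * s + A * s + a * A * s) + 2 * A * s + b * s + 2 * s + s"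
    using s by (intro add_mono mult_le_mono order_refl)
  also have "\<dots> = (A * (A + 2) + (2 + A + a) * A + 2 * A + b + 3) * s" by (simp add: algebra_simps)
  also have "\<dots> \<le> B * s" using assms by (intro mult_right_mono) auto
  finally show ?thesis by (simp add: s_def mult.assoc)
qed

lemma discretization_error_le:
  fixes V lam c0 \<epsilon> :: real
  assumes V: "1 \<le> V" "V / \<epsilon> \<le> 2 ^ m0" and \<epsilon>: "0 < \<epsilon>" "\<epsilon> < 1" and m0: "1 \<le> m0"
    and a: "max 1 lam \<le> 2 ^ a" and b: "0 \<le> c0" "c0 \<le> 2 ^ b"
    and B: "A * (A + 2) + (2 + A + a) * A + 2 * A + b + 3 \<le> B"
    and m: "m = A * m0" and Q: "Q = 2 ^ (B * m0 * m0)"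
  shows "(real m + 1) ^ (m + 2) * (2 * (real m + 1) * V * max 1 lam) ^ m * (real m ^ 2 * c0 / real Q) \<le> \<epsilon> / 4"
proof -
  note V2 = volume_bounds(1)[OF V \<epsilon>] and eps = volume_bounds(2)[OF V \<epsilon>]
  have m1: "real m + 1 \<le> 2 ^ m"
  proof -
    have "m + 1 \<le> 2 ^ m" by (simp add: Suc_leI)
    hence "real (m + 1) \<le> real (2 ^ m)" by (simp only: of_nat_le_iff)
    then show ?thesis by simp
  qed
  have 1: "(real m + 1) ^ (m + 2) \<le> 2 ^ (m * (m + 2))"
    using power_mono[OF m1, of "m + 2"] unfolding power_mult by simp
  have "2 * (real m + 1) * V * max 1 lam \<le> 2 * 2 ^ m * 2 ^ m0 * 2 ^ a"
    using m1 V2 a V by (intro mult_mono) auto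
  also have "\<dots> = 2 ^ (1 + m + m0 + a)" by (simp add: power_add)
  finally have "2 * (real m + 1) * V * max 1 lam \<le> 2 ^ (1 + m + m0 + a)" .
  hence "(2 * (real m + 1) * V * max 1 lam) ^ m \<le> (2 ^ (1 + m + m0 + a)) ^ m"
    using V by (intro power_mono) auto
  hence 2: "(2 * (real m + 1) * V * max 1 lam) ^ m \<le> 2 ^ ((1 + m + m0 + a) * m)"
    by (simp only: power_mult)
  have "real m ^ 2 \<le> (2 ^ m) ^ 2" using m1 by (intro power_mono) auto
  hence 3: "real m ^ 2 \<le> 2 ^ (m * 2)" by (simp only: power_mult)
  have Q0: "0 < real Q" by (simp add: Q)
  have "(real m + 1) ^ (m + 2) * (2 * (real m + 1) * V * max 1 lam) ^ m * (real m ^ 2 * c0)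
      \<le> 2 ^ (m * (m + 2)) * 2 ^ ((1 + m + m0 + a) * m) * (2 ^ (m * 2) * 2 ^ b)"
    using 1 2 3 b V by (intro mult_mono) auto
  also have "\<dots> = 2 ^ (m * (m + 2) + (1 + m + m0 + a) * m + m * 2 + b)" by (simp only: power_add mult.assoc)
  finally have 4: "(real m + 1) ^ (m + 2) * (2 * (real m + 1) * V * max 1 lam) ^ m * (real m ^ 2 * c0)
      \<le> 2 ^ (m * (m + 2) + (1 + m + m0 + a) * m + m * 2 + b)" (is "?L \<le> 2 ^ ?E") .
  have "(2::real) ^ ?E * (4 * 2 ^ m0) = 2 ^ (?E + (2 + m0))" by (simp add: power_add)
  also have "\<dots> \<le> 2 ^ (B * m0 * m0)"
    using error_exponent[OF m0 B] unfolding m by (intro power_increasing) auto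
  finally have "2 ^ ?E * (4 * 2 ^ m0) \<le> real Q" by (simp add: Q)
  hence "2 ^ ?E * 4 * 2 ^ m0 \<le> real Q * 1" by simp
  also have "\<dots> \<le> real Q * (\<epsilon> * 2 ^ m0)" using eps Q0 by (intro mult_left_mono) auto
  finally have "2 ^ ?E * 4 \<le> real Q * \<epsilon>" by simp
  hence "2 ^ ?E \<le> real Q * (\<epsilon> / 4)" by simp
  with 4 have "?L \<le> real Q * (\<epsilon> / 4)" by linarith
  hence "?L / real Q \<le> \<epsilon> / 4" using Q0 by (simp add: field_simps)
  then show ?thesis by (simp add: mult.assoc)
qed

text \<open>By the choice of \<open>A\<close>, the power of \<open>1 / r\<close> is at most
  \<open>(1 / 2) ^ m0 / D\<close>: as \<open>m0 \<ge> 1\<close>, one factor \<open>1 / D\<close> can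
  be kept to pay for \<open>4 * C / (r - 1)\<close>, while \<open>(1 / 2) ^ m0\<close> compensates
  \<open>V / \<epsilon>\<close>.\<close>

lemma truncation_error_le:
  fixes V C r \<epsilon> :: real
  assumes V: "1 \<le> V" "V / \<epsilon> \<le> 2 ^ m0" and \<epsilon>: "0 < \<epsilon>" and m0: "1 \<le> m0" and C: "0 < C" and r: "1 < r"
    and D: "1 \<le> D" "4 * C / (r - 1) \<le> D" and A: "(1 / r) ^ A \<le> 1 / (2 * D)"
  shows "C * V / (r - 1) * (1 / r) ^ (A * m0) \<le> \<epsilon> / 4"
proof -
  have "(1 / r) ^ (A * m0) = ((1 / r) ^ A) ^ m0" by (rule power_mult)
  also have "\<dots> \<le> (1 / (2 * D)) ^ m0" using r A by (intro power_mono) auto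
  also have "\<dots> = (1 / 2) ^ m0 * (1 / D) ^ m0" by (simp add: power_mult_distrib[symmetric])
  also have "\<dots> \<le> (1 / 2) ^ m0 * (1 / D) ^ 1"
    using D m0 by (intro mult_left_mono power_decreasing) auto
  finally have 1: "(1 / r) ^ (A * m0) \<le> (1 / 2) ^ m0 / D" by simp
  have "V \<le> \<epsilon> * 2 ^ m0" using V \<epsilon> by (simp add: field_simps)
  hence 2: "V * (1 / 2) ^ m0 \<le> \<epsilon>" by (simp add: power_one_over field_simps)
  have "C * V / (r - 1) * (1 / r) ^ (A * m0) \<le> C * V / (r - 1) * ((1 / 2) ^ m0 / D)"
    using 1 C V r by (intro mult_left_mono) auto
  also have "\<dots> = (C / (r - 1) / D) * (V * (1 / 2) ^ m0)" by simp
  also have "\<dots> \<le> (1 / 4) * \<epsilon>"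
  proof (intro mult_mono 2)
    show "C / (r - 1) / D \<le> 1 / 4" using D r by (simp add: field_simps)
  qed (use V in auto)
  finally show ?thesis by simp
qed

text \<open>Here \<open>T\<close> is at most \<open>2 ^ (e + m0)\<close> and \<open>2 ^ m0\<close>
  at least \<open>1 / \<epsilon>\<close>, so \<open>Q\<close> needs the exponent
  \<open>2 * (e + m0) + (2 + m0)\<close>, which is at most
  \<open>(2 * e + 5) * (m0 * m0)\<close>.\<close>

lemma exp_size_le:
  fixes V C T \<epsilon> :: real
  assumes V: "1 \<le> V" "V / \<epsilon> \<le> 2 ^ m0" and \<epsilon>: "0 < \<epsilon>" "\<epsilon> < 1" and m0: "1 \<le> m0"
    and e: "C + 1 \<le> 2 ^ e" and T: "\<bar>T\<bar> \<le> (C + 1) * V" and B: "2 * e + 5 \<le> B"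
    and Q: "Q = 2 ^ (B * m0 * m0)"
  shows "\<bar>T\<bar> / real Q \<le> 1 / 2" "2 * T\<^sup>2 / real Q \<le> \<epsilon> / 2"
proof -
  have Q0: "0 < real Q" by (simp add: Q)
  note V2 = volume_bounds(1)[OF V \<epsilon>] and eps = volume_bounds(2)[OF V \<epsilon>]
  have "(C + 1) * V \<le> 2 ^ e * 2 ^ m0" using e V V2 by (intro mult_mono) auto
  hence T2: "\<bar>T\<bar> \<le> 2 ^ (e + m0)" using T by (simp add: power_add)
  have s: "m0 \<le> m0 * m0" "1 \<le> m0 * m0" using m0 by auto
  have "2 * (e + m0) + (2 + m0) = 2 * e * 1 + 3 * m0 + 2 * 1" by simp
  also have "\<dots> \<le> 2 * e * (m0 * m0) + 3 * (m0 * m0) + 2 * (m0 * m0)"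
    using s by (intro add_mono mult_le_mono order_refl)
  also have "\<dots> = (2 * e + 5) * (m0 * m0)" by (simp add: algebra_simps)
  also have "\<dots> \<le> B * (m0 * m0)" using B by (intro mult_right_mono) auto
  finally have ex: "2 * (e + m0) + (2 + m0) \<le> B * m0 * m0" by (simp add: mult.assoc)
  have "2 ^ (e + m0) * 2 = (2::real) ^ (e + m0 + 1)" by simp
  also have "\<dots> \<le> 2 ^ (B * m0 * m0)" using ex by (intro power_increasing) auto
  finally have "2 ^ (e + m0) * 2 \<le> real Q" by (simp add: Q)
  hence "\<bar>T\<bar> * 2 \<le> real Q" using T2 by linarith
  then show "\<bar>T\<bar> / real Q \<le> 1 / 2" using Q0 by (simp add: field_simps)
  have "T\<^sup>2 \<le> (2 ^ (e + m0))\<^sup>2" using power_mono[OF T2, of 2] by simp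
  hence "T\<^sup>2 * (4 * 2 ^ m0) \<le> (2 ^ (e + m0))\<^sup>2 * (4 * 2 ^ m0)" by (intro mult_right_mono) auto
  also have "(2 ^ (e + m0))\<^sup>2 = (2::real) ^ (2 * (e + m0))" unfolding power_mult[symmetric] by (simp only: mult.commute)
  also have "\<dots> * (4 * 2 ^ m0) = 2 ^ (2 * (e + m0) + (2 + m0))" unfolding power_add[of _ "2 * (e + m0)"] power_add[of _ 2] by simp
  also have "\<dots> \<le> 2 ^ (B * m0 * m0)" using ex by (intro power_increasing) auto
  finally have "T\<^sup>2 * 4 * 2 ^ m0 \<le> real Q * 1" by (simp add: Q)
  also have "\<dots> \<le> real Q * (\<epsilon> * 2 ^ m0)" using eps Q0 by (intro mult_left_mono) auto
  finally have "T\<^sup>2 * 4 \<le> real Q * \<epsilon>" by simp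
  then show "2 * T\<^sup>2 / real Q \<le> \<epsilon> / 2" using Q0 by (simp add: field_simps)
qed

lemma zero_freenessE:
  assumes "zero_freeness_assumption \<phi> a"
  obtains \<delta> C where "0 < \<delta>" "0 < C" "\<forall>S. bounded S \<and> S \<in> sets lebesgue \<longrightarrow>
     (\<exists>logZ. logZ holomorphic_on segment_nbhd \<delta> a \<and> logZ 0 = 0 \<and>
       (\<forall>z\<in>segment_nbhd \<delta> a. exp (logZ z) = partition_function \<phi> S z \<and>
          1 / measure lebesgue S * cmod (logZ z) \<le> C))"
proof -
  from assms[unfolded zero_freeness_assumption_def] show thesis
  proof (elim exE conjE)
    fix \<delta> C :: real
    assume \<delta>: "0 < \<delta>" and C: "0 < C" and *: "\<forall>S. bounded S \<and> S \<in> sets lebesgue \<longrightarrow>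
        (\<forall>z\<in>segment_nbhd \<delta> a. partition_function \<phi> S z \<noteq> 0) \<and>
        (\<exists>logZ. logZ holomorphic_on segment_nbhd \<delta> a \<and> logZ 0 = 0 \<and>
           (\<forall>z\<in>segment_nbhd \<delta> a.
              exp (logZ z) = partition_function \<phi> S z \<and>
              1 / measure lebesgue S * cmod (logZ z) \<le> C))"
    show thesis
    proof (rule that[OF \<delta> C], intro allI impI)
      fix S :: "(real ^ 'a) set"
      assume "bounded S \<and> S \<in> sets lebesgue"
      from *[THEN spec, THEN mp, OF this]
      show "\<exists>logZ. logZ holomorphic_on segment_nbhd \<delta> a \<and> logZ 0 = 0 \<and>
       (\<forall>z\<in>segment_nbhd \<delta> a. exp (logZ z) = partition_function \<phi> S z \<and>
          1 / measure lebesgue S * cmod (logZ z) \<le> C)" by (rule conjunct2)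
    qed
  qed
qed

context regular_potential
begin

text \<open>The budget is \<open>\<epsilon> / 4\<close> for truncation,
  \<open>\<epsilon> / 4\<close> for discretization and \<open>\<epsilon> / 2\<close> for replacing
  the exponential. The choice of \<open>qs\<close>, \<open>A\<close> and \<open>B\<close> precedes
  that of \<open>n\<close> and \<open>\<epsilon>\<close>, since a single program has to serve all
  inputs.\<close>

lemma approximation_formula:
  assumes lam: "0 \<le> lam" and zf: "zero_freeness_assumption \<phi> lam"
  obtains qs A B where "\<forall>n \<epsilon> m0 Q. 1 \<le> n \<longrightarrow> 0 < \<epsilon> \<longrightarrow> \<epsilon> < 1 \<longrightarrow>
    m0 = log_size ((2 * real n) ^ CARD('d) / \<epsilon>) \<longrightarrow> Q = 2 ^ (B * m0 * m0) \<longrightarrow>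
    is_approximation \<epsilon>
      ((1 + log_series_sum (composed_coeff \<phi> n Q lam qs) (A * m0) / real Q) ^ Q)
      (partition_function \<phi> (centered_cube (real n)) lam)"
proof -
  obtain \<delta> C where \<delta>: "0 < \<delta>" and C: "0 < C" and
    zf: "\<forall>S. bounded S \<and> S \<in> sets lebesgue \<longrightarrow>
     (\<exists>logZ. logZ holomorphic_on segment_nbhd \<delta> lam \<and> logZ 0 = 0 \<and>
       (\<forall>z\<in>segment_nbhd \<delta> lam. exp (logZ z) = partition_function \<phi> S z \<and>
          1 / measure lebesgue S * cmod (logZ z) \<le> C))"
    by (rule zero_freenessE[OF zf])
  have \<delta>': "\<delta> / (lam + 1) > 0" using \<delta> lam by simp
  obtain qs r where r: "1 < r" and qs: "list_coeff qs 0 = 0"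
    "\<forall>t. 0 \<le> list_coeff qs t" "\<forall>t. list_coeff qs t \<le> 1" "(\<Sum>t<length qs. list_coeff qs t) = 1"
    "\<forall>w. cmod w \<le> r \<longrightarrow>
       infdist (\<Sum>t<length qs. of_real (list_coeff qs t) * w ^ t) (complex_of_real ` {0..1}) < \<delta> / (lam + 1)"
    by (rule exists_segment_polynomial[OF \<delta>'])
  define \<rho> where "\<rho> = (1 + r) / 2"
  have \<rho>: "1 < \<rho>" using r by (simp add: \<rho>_def)
  define D where "D = max 1 (4 * C / (\<rho> - 1))"
  have D: "1 \<le> D" "4 * C / (\<rho> - 1) \<le> D" by (auto simp: D_def)
  have "0 < 1 / (2 * D)" "1 / \<rho> < 1" using \<rho> D by auto
  from real_arch_pow_inv[OF this] obtain A where "(1 / \<rho>) ^ A < 1 / (2 * D)" by blast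
  hence A: "(1 / \<rho>) ^ A \<le> 1 / (2 * D)" by (rule less_imp_le)
  obtain a where a: "max 1 lam \<le> 2 ^ a" using real_le_two_power by blast
  obtain b where b: "quad_const \<le> 2 ^ b" using real_le_two_power by blast
  obtain e where e: "C + 1 \<le> 2 ^ e" using real_le_two_power by blast
  obtain f where f: "R \<le> 2 ^ f" using real_le_two_power by blast
  \<comment> \<open>The summands meet the demands of \<open>discretization_error_le\<close>, of
    \<open>exp_size_le\<close> and of the condition \<open>R \<le> real Q\<close> in the
    quadrature.\<close>
  define B where "B = (A * (A + 2) + (2 + A + a) * A + 2 * A + b + 3) + (2 * e + 5) + f"
  show thesis
  proof (rule that[of B qs A], intro allI impI)
    fix n Q m0 :: nat and \<epsilon> :: real
    assume n: "1 \<le> n" and \<epsilon>: "0 < \<epsilon>" "\<epsilon> < 1" and m0_def: "m0 = log_size ((2 * real n) ^ CARD('d) / \<epsilon>)"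
      and Q: "Q = 2 ^ (B * m0 * m0)"
    define V where "V = (2 * real n) ^ CARD('d)"
    define S :: "(real ^ 'd) set" where "S = centered_cube (real n)"
    have S: "S \<in> lmeasurable" "measure lebesgue S = V"
      unfolding S_def V_def using measure_centered_cube[of "real n"] by auto
    have V2: "2 \<le> V"
    proof -
      have "2 * real n \<le> (2 * real n) ^ CARD('d)" using n by (intro self_le_power) auto
      then show ?thesis using n by (simp add: V_def)
    qed
    hence V1: "1 \<le> V" by simp
    have Vm: "V / \<epsilon> \<le> 2 ^ m0" unfolding m0_def V_def by (rule log_size_ge)
    \<comment> \<open>The volume is at least 2, so \<open>V / \<epsilon>\<close> exceeds
      \<open>2 ^ 0\<close> and \<open>m0\<close> is positive.\<close>
    have "V * 1 \<le> V * (1 / \<epsilon>)" using V1 \<epsilon> by (intro mult_left_mono) auto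
    hence "0 < m0" using V2 unfolding m0_def less_log_size_iff V_def[symmetric] by simp
    hence m0: "1 \<le> m0" by simp
    define m where "m = A * m0"
    have Bm: "B \<le> B * m0 * m0" using m0 by (simp add: mult.assoc)
    have "f + 1 \<le> B * m0 * m0" using Bm unfolding B_def by linarith
    hence "(2::nat) ^ (f + 1) \<le> Q" unfolding Q by (intro power_increasing) auto
    hence "real (2 ^ (f + 1)) \<le> real Q" by (simp only: of_nat_le_iff)
    hence Qf: "2 * 2 ^ f \<le> real Q" by simp
    have "1 \<le> (2::real) ^ f" by simp
    hence Q2: "2 \<le> Q" "R \<le> real Q" using Qf f by linarith+
    have bounded: "bounded S"
      unfolding S_def centered_cube_eq_cbox by (rule bounded_cbox)
    from zf[THEN spec, THEN mp, OF conjI[OF bounded fmeasurableD[OF S(1)]]] obtain logZ where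
      hol: "logZ holomorphic_on segment_nbhd \<delta> lam" "logZ 0 = 0" and
      logZ: "\<And>z. z \<in> segment_nbhd \<delta> lam \<Longrightarrow>
         exp (logZ z) = partition_function \<phi> S z \<and> 1 / measure lebesgue S * cmod (logZ z) \<le> C"
      by blast
    define Z where "Z = partition_function \<phi> S lam"
    have lam_in: "complex_of_real lam \<in> segment_nbhd \<delta> lam"
      using lam \<delta> by (simp add: segment_nbhd_def infdist_zero)
    have expZ: "exp (logZ (of_real lam)) = of_real Z"
      using logZ[OF lam_in] partition_function_of_real[OF S(1), of lam] by (simp add: Z_def)
    have Z0: "0 \<le> Z" unfolding Z_def by (rule partition_function_nonneg[OF S(1) lam])
    \<comment> \<open>As \<open>Z\<close> is real and nonnegative, taking moduli identifies it with
      an exponential; it is therefore positive, and its real logarithm is the real part of the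
      branch \<open>logZ\<close>.\<close>
    have "exp (Re (logZ (of_real lam))) = Z"
      using arg_cong[OF expZ, of cmod] Z0 by simp
    hence Z: "0 < Z" "ln Z = Re (logZ (of_real lam))" by (metis exp_gt_zero, metis ln_exp)
    have lnZ: "\<bar>ln Z\<bar> \<le> C * V"
    proof -
      have "1 / V * cmod (logZ (of_real lam)) \<le> C" using logZ[OF lam_in] S(2) by simp
      hence "cmod (logZ (of_real lam)) \<le> C * V" using V1 by (simp add: field_simps)
      then show ?thesis unfolding Z(2) using abs_Re_le_cmod order_trans by blast
    qed
    define T0 where "T0 = log_series_sum (exact_coeff S lam qs) m"
    define T where "T = log_series_sum (composed_coeff \<phi> n Q lam qs) m"
    have "cmod (logZ (of_real lam) - of_real T0) \<le> C * V / (\<rho> - 1) * (1 / \<rho>) ^ m"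
      unfolding T0_def \<rho>_def S(2)[symmetric]
      by (rule log_partition_function_approx[OF S(1) _ \<delta> hol logZ lam r qs(1,4) qs(5)[rule_format]]) (use S V1 in auto)
    also have "\<dots> \<le> \<epsilon> / 4"
      unfolding m_def by (rule truncation_error_le[OF V1 Vm \<epsilon>(1) m0 C \<rho> D A])
    finally have "\<bar>Re (logZ (of_real lam) - of_real T0)\<bar> \<le> \<epsilon> / 4"
      using abs_Re_le_cmod order_trans by blast
    hence e1: "\<bar>ln Z - T0\<bar> \<le> \<epsilon> / 4" by (simp add: Z(2))
    have "\<bar>T0 - T\<bar> \<le> (real m + 1) ^ (m + 2) * (2 * (real m + 1) * V * max 1 lam) ^ m *
        (real m ^ 2 * quad_const / real Q)"
      unfolding T0_def T_def S_def V_def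
      by (rule log_series_sum_error[OF n Q2 lam]) (use qs in auto)
    also have "\<dots> \<le> \<epsilon> / 4"
      by (rule discretization_error_le[OF V1 Vm \<epsilon> m0 a _ b _ m_def Q])
        (use quad_const_pos in \<open>auto simp: B_def\<close>)
    finally have e2: "\<bar>T0 - T\<bar> \<le> \<epsilon> / 4" .
    from e1 e2 have e3: "\<bar>ln Z - T\<bar> \<le> \<epsilon> / 2" by linarith
    have "\<bar>T\<bar> \<le> C * V + 1" using e3 lnZ \<epsilon> by linarith
    also have "\<dots> \<le> (C + 1) * V" using V1 by (simp add: algebra_simps)
    finally have T: "\<bar>T\<bar> \<le> (C + 1) * V" .
    have B5: "2 * e + 5 \<le> B" by (simp add: B_def)
    have "is_approximation \<epsilon> ((1 + T / real Q) ^ Q) Z"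
      by (rule exp_approx_of_log[OF Z(1) e3 _ exp_size_le[OF V1 Vm \<epsilon> m0 e T B5 Q]]) (use Q2 in simp)
    then show "is_approximation \<epsilon>
      ((1 + log_series_sum (composed_coeff \<phi> n Q lam qs) (A * m0) / real Q) ^ Q)
      (partition_function \<phi> (centered_cube (real n)) lam)"
      unfolding T_def m_def Z_def S_def .
  qed
qed

end

context potential_machine
begin

section \<open>Running time of the closed formula\<close>

lemma ncompI:
  assumes "computable fr (\<lambda>p. real (B p))" "\<And>p. p \<in> params fr \<Longrightarrow> B p \<le> scale fr p ^ e"
  shows "ncomp fr B"
  unfolding ncomp_def
proof (intro conjI assms(1) exI[of _ e] ballI)
  fix p assume "p \<in> params fr"
  from assms(2)[OF this] show "B p \<le> (scale fr p + 2) ^ e"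
    by (rule order_trans) (intro power_mono, auto)
qed

text \<open>The logarithm is the number of \<open>i\<close> with \<open>2 ^ i < Y\<close>; testing
  the \<open>i\<close> below the ceiling of \<open>Y\<close> suffices since \<open>2 ^ i\<close>
  exceeds \<open>i\<close>.\<close>

lemma ncomp_log_size:
  assumes Y: "computable fr Y" and le: "\<And>p. p \<in> params fr \<Longrightarrow> Y p \<le> real (scale fr p)"
  shows "ncomp fr (\<lambda>p. log_size (Y p))"
proof -
  have c: "ncomp fr (\<lambda>p. nat \<lceil>Y p\<rceil>)"
  proof (rule ncomp_ceiling[OF Y, of 1])
    fix p assume "p \<in> params fr"
    from le[OF this] show "Y p \<le> real ((scale fr p + 2) ^ 1)" by simp
  qed
  have log_le: "log_size y \<le> nat \<lceil>y\<rceil>" for y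
  proof -
    have "\<not> nat \<lceil>y\<rceil> < log_size y"
    proof
      assume "nat \<lceil>y\<rceil> < log_size y"
      hence "2 ^ nat \<lceil>y\<rceil> < y" by (simp add: less_log_size_iff)
      moreover have "real (nat \<lceil>y\<rceil>) < 2 ^ nat \<lceil>y\<rceil>" by (rule of_nat_less_two_power)
      ultimately show False by linarith
    qed
    then show ?thesis by simp
  qed
  have sum: "(\<Sum>i<nat \<lceil>y\<rceil>. if 2 ^ i < y then 1 else 0) = real (log_size y)" for y
  proof -
    have "(\<Sum>i<nat \<lceil>y\<rceil>. if 2 ^ i < y then 1 else 0) = (\<Sum>i\<in>{..<log_size y}. 1 :: real)"
      using log_le[of y] by (intro sum.mono_neutral_cong_right) (auto simp: less_log_size_iff[symmetric])
    then show ?thesis by simp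
  qed
  let ?G = "bind_var fr (\<lambda>p. {..<nat \<lceil>Y p\<rceil>}) real"
  have "computable ?G (\<lambda>q. if 2 ^ snd q < Y (fst q) then 1 else 0)"
    using computable_numeral(3)[of ?G 2]
    by (intro computable_if_less computable_power ncomp_bound c computable_weaken[OF Y] computable_numeral) simp
  from computable_sum[OF c this] have "computable fr (\<lambda>p. real (log_size (Y p)))"
    by (simp only: sum)
  from ncomp_mono[OF c this] show ?thesis using log_le by blast
qed

text \<open>The scale \<open>2 ^ (m0 ^ 3)\<close> makes the target running time polynomial. The real
  \<open>lam\<close> is a variable of the frame because programs contain only rational
  constants.\<close>

lemma computes_approximation_formula:
  assumes Q: "\<And>p. Q p = 2 ^ (B * m0 p * m0 p)"
    and m0: "\<And>n \<epsilon>. m0 (n, \<epsilon>) = log_size ((2 * real n) ^ CARD('d) / \<epsilon>)"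
  shows "computable (Frame {(n, \<epsilon>). 1 \<le> n \<and> 0 < \<epsilon> \<and> \<epsilon> < 1} (\<lambda>p. 2 ^ (m0 p) ^ 3)
       [\<lambda>p. real (fst p), \<lambda>_. lam, \<lambda>p. snd p])
     (\<lambda>p. (1 + log_series_sum (composed_coeff \<phi> (fst p) (Q p) lam qs) (A * m0 p) / real (Q p)) ^ Q p)"
proof -
  define fr where "fr = Frame {(n, \<epsilon>). 1 \<le> n \<and> 0 < \<epsilon> \<and> \<epsilon> < 1} (\<lambda>p. 2 ^ (m0 p) ^ 3)
       [\<lambda>p :: nat \<times> real. real (fst p), \<lambda>_. lam, \<lambda>p. snd p]"
  have fr [simp]: "params fr = {(n, \<epsilon>). 1 \<le> n \<and> 0 < \<epsilon> \<and> \<epsilon> < 1}" "scale fr = (\<lambda>p. 2 ^ (m0 p) ^ 3)"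
    by (simp_all add: fr_def)
  define Y where "Y = (\<lambda>p :: nat \<times> real. (2 * real (fst p)) ^ CARD('d) / snd p)"
  have m0Y: "m0 p = log_size (Y p)" for p by (cases p) (simp add: m0 Y_def)
  have vars: "computable fr (\<lambda>p. real (fst p))" "computable fr (\<lambda>_. lam)" "computable fr (\<lambda>p. snd p)"
    by (rule computable_var, simp add: fr_def)+
  have Yle: "Y p \<le> 2 ^ m0 p" for p unfolding m0Y by (rule log_size_ge)
  have nY: "2 * real (fst p) \<le> Y p" if "p \<in> params fr" for p
  proof -
    obtain n \<epsilon> where p: "p = (n, \<epsilon>)" by (cases p)
    with that have n: "1 \<le> n" "0 < \<epsilon>" "\<epsilon> < 1" by auto
    have "2 * real n \<le> (2 * real n) ^ CARD('d)" using n by (intro self_le_power) auto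
    also have "\<dots> * 1 \<le> (2 * real n) ^ CARD('d) * (1 / \<epsilon>)" using n by (intro mult_left_mono) auto
    finally show ?thesis by (simp add: p Y_def)
  qed
  have m0pos: "1 \<le> m0 p" if "p \<in> params fr" for p
  proof -
    have "2 \<le> 2 * real (fst p)" using that by (cases p) auto
    hence "2 ^ 0 < Y p" using nY[OF that] by simp
    hence "0 < m0 p" unfolding m0Y by (simp only: less_log_size_iff)
    then show ?thesis by simp
  qed
  have cube: "i ^ 1 \<le> i ^ 3" "i * i \<le> i ^ 3" if "1 \<le> i" for i :: nat
    using that power_increasing[of 1 3 i] power_increasing[of 2 3 i] by (auto simp: power2_eq_square)
  have YX: "Y p \<le> real (scale fr p)" if "p \<in> params fr" for p
  proof -
    note Yle[of p]
    also have "(2::real) ^ m0 p \<le> 2 ^ (m0 p ^ 3)" using cube(1)[OF m0pos[OF that]] by (intro power_increasing) auto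
    finally show ?thesis by simp
  qed
  have n_nc: "ncomp fr (\<lambda>p. fst p)"
  proof (rule ncompI[OF vars(1), of 1])
    fix p assume p: "p \<in> params fr"
    have "real (fst p) \<le> real (scale fr p)" using nY[OF p] YX[OF p] by linarith
    then show "fst p \<le> scale fr p ^ 1" by (simp only: of_nat_le_iff power_one_right)
  qed
  have "computable fr Y"
    unfolding Y_def
    using computable_numeral(3)[of fr 2]
    by (intro computable_divide computable_power computable_mult vars ncomp_const) simp
  from ncomp_log_size[OF this YX] have m0_nc: "ncomp fr m0" by (simp add: m0Y[symmetric])
  have m_nc: "ncomp fr (\<lambda>p. A * m0 p)" by (intro ncomp_mult ncomp_const m0_nc)
  have two_power: "ncomp fr N"
    if "computable fr (\<lambda>p. real (N p))" "\<And>p. p \<in> params fr \<Longrightarrow> N p \<le> 2 ^ (D * m0 p ^ 3)" for N D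
  proof (rule ncompI[OF that(1), of D])
    fix p assume "p \<in> params fr"
    from that(2)[OF this] show "N p \<le> scale fr p ^ D" by (simp add: power_mult[symmetric] mult.commute)
  qed
  have Q_nc: "ncomp fr Q"
  proof (rule two_power[of _ B])
    have "computable fr (\<lambda>p. real 2 ^ (B * m0 p * m0 p))"
      by (intro computable_power computable_numeral(3) ncomp_mult ncomp_const m0_nc)
    then show "computable fr (\<lambda>p. real (Q p))" by (simp add: Q)
    fix p assume p: "p \<in> params fr"
    show "Q p \<le> 2 ^ (B * m0 p ^ 3)"
      unfolding Q mult.assoc using cube(2)[OF m0pos[OF p]] by (intro power_increasing mult_left_mono) auto
  qed
  \<comment> \<open>This is the source of the cube: \<open>2 * n * Q\<close> is at most
    \<open>2 ^ ((B + 1) * m0 * m0)\<close> and is raised to a power proportional to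
    \<open>m0\<close>.\<close>
  have P_nc: "ncomp fr (\<lambda>p. ((2 * fst p * Q p) ^ CARD('d)) ^ (A * m0 p))"
  proof (rule two_power[of _ "(B + 1) * (CARD('d) * A)"])
    have "computable fr (\<lambda>p. (real (2 * fst p * Q p) ^ CARD('d)) ^ (A * m0 p))"
      by (intro computable_power m_nc ncomp_const ncompD[OF ncomp_mult] ncomp_mult n_nc Q_nc)
    then show "computable fr (\<lambda>p. real (((2 * fst p * Q p) ^ CARD('d)) ^ (A * m0 p)))" by simp
    fix p assume p: "p \<in> params fr"
    have "real (2 * fst p) \<le> real (2 ^ m0 p)" using nY[OF p] Yle[of p] by simp
    hence "2 * fst p \<le> 2 ^ m0 p" by (simp only: of_nat_le_iff)
    also have "\<dots> \<le> 2 ^ (m0 p * m0 p)" using m0pos[OF p] by (intro power_increasing) auto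
    finally have "2 * fst p * Q p \<le> 2 ^ (m0 p * m0 p) * 2 ^ (B * m0 p * m0 p)"
      unfolding Q by (intro mult_right_mono) auto
    also have "\<dots> = 2 ^ ((B + 1) * (m0 p * m0 p))" by (simp add: power_add[symmetric] algebra_simps)
    finally have "((2 * fst p * Q p) ^ CARD('d)) ^ (A * m0 p) \<le>
        ((2 ^ ((B + 1) * (m0 p * m0 p))) ^ CARD('d)) ^ (A * m0 p)"
      by (intro power_mono) auto
    also have "\<dots> = 2 ^ ((B + 1) * (CARD('d) * A) * m0 p ^ 3)"
      unfolding power_mult[symmetric] power3_eq_cube by (simp only: mult_ac)
    finally show "((2 * fst p * Q p) ^ CARD('d)) ^ (A * m0 p) \<le> 2 ^ ((B + 1) * (CARD('d) * A) * m0 p ^ 3)" .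
  qed
  have mm_nc: "ncomp fr (\<lambda>p. (A * m0 p + 1) ^ (A * m0 p))"
  proof (rule two_power[of _ "A * A"])
    have "computable fr (\<lambda>p. real (A * m0 p + 1) ^ (A * m0 p))"
      by (intro computable_power m_nc ncompD[OF ncomp_add] ncomp_const)
    then show "computable fr (\<lambda>p. real ((A * m0 p + 1) ^ (A * m0 p)))" by simp
    fix p assume p: "p \<in> params fr"
    have "A * m0 p + 1 \<le> 2 ^ (A * m0 p)" by (simp add: Suc_leI)
    hence "(A * m0 p + 1) ^ (A * m0 p) \<le> (2 ^ (A * m0 p)) ^ (A * m0 p)" by (intro power_mono) auto
    also have "\<dots> = 2 ^ (A * A * (m0 p * m0 p))" unfolding power_mult[symmetric] by (simp add: mult_ac)
    also have "\<dots> \<le> 2 ^ (A * A * m0 p ^ 3)"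
      using cube(2)[OF m0pos[OF p]] by (intro power_increasing mult_left_mono) auto
    finally show "(A * m0 p + 1) ^ (A * m0 p) \<le> 2 ^ (A * A * m0 p ^ 3)" .
  qed
  have "computable fr (\<lambda>p. log_series_sum (composed_coeff \<phi> (fst p) (Q p) lam qs) (A * m0 p))"
    by (rule computable_log_series_sum[OF n_nc Q_nc m_nc P_nc mm_nc vars(2)]) (auto simp: Q)
  hence "computable fr (\<lambda>p. (1 + log_series_sum (composed_coeff \<phi> (fst p) (Q p) lam qs) (A * m0 p) / real (Q p)) ^ Q p)"
    by (intro computable_power computable_add computable_divide computable_numeral ncompD[OF Q_nc] Q_nc)
  then show ?thesis unfolding fr_def .
qed

text \<open>The variables are the input cells 0, 1 and 2, so scratch space starts at 3, where the
  result appears before it is copied to the output cell.\<close>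

lemma computable_imp_program:
  assumes "computable (Frame E X [\<lambda>p. real (fst p), \<lambda>_. lam, \<lambda>p. snd p]) f"
  obtains P :: "'d com" and D where "\<forall>n \<epsilon>. (n, \<epsilon>) \<in> E \<longrightarrow>
    computes_within \<phi> l K P (input_memory n lam \<epsilon>) (f (n, \<epsilon>)) (real ((X (n, \<epsilon>) + 2) ^ D))"
proof -
  let ?fr = "Frame E X [\<lambda>p. real (fst p), \<lambda>_. lam, \<lambda>p. snd p]"
  obtain d where d: "achievable ?fr d (\<lambda>b. stores b f)" using assms by (rule computableE)
  have "\<forall>a\<in>set [0, 1, 2 :: nat]. a < 3" by simp
  then obtain c where c: "achieves ?fr d 3 [0, 1, 2] c (stores 3 f)" by (rule achievableE[OF d])
  show thesis
  proof (rule that[of "Seq c (Seq (Cst 0 0) (Add 0 0 3))" "d + 0 + 4"], intro allI impI)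
    fix n and \<epsilon> :: real assume E: "(n, \<epsilon>) \<in> E"
    let ?s = "input_memory n lam \<epsilon>"
    have s: "map ?s [0, 1, 2] = map (\<lambda>w. w (n, \<epsilon>)) (vars ?fr)" by (simp add: input_memory_def)
    have "(n, \<epsilon>) \<in> params ?fr" using E by simp
    then obtain t s' where 1: "exec \<phi> l K c ?s t s'" "t \<le> (scale ?fr (n, \<epsilon>) + 2) ^ d" "s' 3 = f (n, \<epsilon>)"
      by (rule achievesE[OF c _ s])
    have "t + 2 \<le> (X (n, \<epsilon>) + 2) ^ (d + 0 + 4)"
      using two_powers_le[of "X (n, \<epsilon>)" d 0] 1(2) by simp
    hence "real (t + 2) \<le> real ((X (n, \<epsilon>) + 2) ^ (d + 0 + 4))" by (simp only: of_nat_le_iff)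
    moreover have "(s'(0 := s' 3)) 0 = f (n, \<epsilon>)" using 1(3) by simp
    ultimately show "computes_within \<phi> l K (Seq c (Seq (Cst 0 0) (Add 0 0 3))) ?s (f (n, \<epsilon>))
        (real ((X (n, \<epsilon>) + 2) ^ (d + 0 + 4)))"
      unfolding computes_within_def using exec.Seq[OF 1(1) exec_move[of 0 3 s']] by (metis zero_neq_numeral)
  qed
qed

end

text \<open>Minimality of \<open>m = log_size Y\<close> gives \<open>2 ^ (m - 1) < Y\<close>, so
  \<open>m * ln 2\<close> is at most \<open>ln Y + ln 2\<close>, hence at most
  \<open>2 * ln Y\<close> as \<open>Y \<ge> 2\<close>. The summand 2 is absorbed by
  \<open>X + 2 \<le> X * X\<close>.\<close>

lemma two_power_cube_le:
  fixes Y :: real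
  assumes "2 \<le> Y"
  shows "real ((2 ^ (log_size Y) ^ 3 + 2) ^ D) \<le> exp (ln 2 * (2 * real D) * (2 / ln 2) ^ 3 * ln Y ^ 3)"
proof -
  define m where "m = log_size Y"
  have "0 < m" using assms unfolding m_def less_log_size_iff by simp
  hence m1: "1 \<le> m" by simp
  have "\<not> log_size Y \<le> m - 1" using m1 by (simp add: m_def)
  hence "2 ^ (m - 1) < Y" by (simp add: less_log_size_iff[symmetric])
  hence "ln (2 ^ (m - 1)) < ln Y" using assms by (subst ln_less_cancel_iff) auto
  hence "real (m - 1) * ln 2 < ln Y" by (simp add: ln_realpow)
  moreover have "ln 2 \<le> ln Y" using assms by simp
  ultimately have "real m * ln 2 \<le> 2 * ln Y" using m1 by (simp add: of_nat_diff algebra_simps)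
  hence m: "real m \<le> (2 / ln 2) * ln Y" by (simp add: field_simps)
  define X :: nat where "X = 2 ^ m ^ 3"
  have "2 ^ 1 \<le> X" unfolding X_def using m1 by (intro power_increasing) auto
  hence X: "2 \<le> X" by simp
  have "X + 2 \<le> X * X" using X mult_le_mono[OF X order_refl[of X]] by linarith
  hence "(X + 2) ^ D \<le> (X * X) ^ D" by (intro power_mono) auto
  also have "\<dots> = 2 ^ (m ^ 3 * (2 * D))"
    unfolding X_def power2_eq_square[symmetric] power_mult[symmetric] by (simp add: mult_ac)
  finally have "real ((X + 2) ^ D) \<le> real (2 ^ (m ^ 3 * (2 * D)))" by (simp only: of_nat_le_iff)
  also have "\<dots> = exp (ln 2 * (2 * real D) * real m ^ 3)"
    using exp_of_nat_mult[of "m ^ 3 * (2 * D)" "ln 2 :: real"] by (simp add: mult_ac)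
  also have "\<dots> \<le> exp (ln 2 * (2 * real D) * ((2 / ln 2) * ln Y) ^ 3)"
    using m by (intro iffD2[OF exp_le_cancel_iff] mult_left_mono power_mono) auto
  also have "\<dots> = exp (ln 2 * (2 * real D) * (2 / ln 2) ^ 3 * ln Y ^ 3)" by (simp only: power_mult_distrib mult.assoc)
  finally show ?thesis unfolding X_def m_def .
qed

theorem theorem1p1:
  fixes \<phi> :: "real ^ 'd::finite \<Rightarrow> ereal"
    and l :: nat and L R lam :: real
    and K :: "nat \<Rightarrow> (real ^ 'd) set"
  assumes "repulsive_pair_potential \<phi>"
    and "regularity_assumption \<phi> l L R K"
    and "0 \<le> lam"
    and "zero_freeness_assumption \<phi> lam"
  shows "\<exists>(P :: 'd com) c. \<forall>n \<epsilon>. 1 \<le> n \<longrightarrow> 0 < \<epsilon> \<longrightarrow> \<epsilon> < 1 \<longrightarrow>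
    (\<exists>Zhat. computes_within \<phi> l K P (input_memory n lam \<epsilon>) Zhat
        (exp (c * ln (measure lebesgue (centered_cube (real n) :: (real ^ 'd) set) / \<epsilon>) ^ 3)) \<and>
      is_approximation \<epsilon> Zhat
        (partition_function \<phi> (centered_cube (real n)) lam))"
proof -
  interpret regular_potential \<phi> l L R K
    by unfold_locales (rule assms)+
  obtain qs A B where approx: "\<forall>n \<epsilon> m0 Q. 1 \<le> n \<longrightarrow> 0 < \<epsilon> \<longrightarrow> \<epsilon> < 1 \<longrightarrow>
    m0 = log_size ((2 * real n) ^ CARD('d) / \<epsilon>) \<longrightarrow> Q = 2 ^ (B * m0 * m0) \<longrightarrow>
    is_approximation \<epsilon>
      ((1 + log_series_sum (composed_coeff \<phi> n Q lam qs) (A * m0) / real Q) ^ Q)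
      (partition_function \<phi> (centered_cube (real n)) lam)"
    by (rule approximation_formula[OF assms(3,4)])
  define m0 where "m0 = (\<lambda>p :: nat \<times> real. log_size ((2 * real (fst p)) ^ CARD('d) / snd p))"
  define Q where "Q = (\<lambda>p. 2 ^ (B * m0 p * m0 p) :: nat)"
  define F where "F = (\<lambda>p. (1 + log_series_sum (composed_coeff \<phi> (fst p) (Q p) lam qs) (A * m0 p) / real (Q p)) ^ Q p)"
  have F: "potential_machine.computable \<phi> l K
      (Frame {(n, \<epsilon>). 1 \<le> n \<and> 0 < \<epsilon> \<and> \<epsilon> < 1} (\<lambda>p. 2 ^ (m0 p) ^ 3) [\<lambda>p. real (fst p), \<lambda>_. lam, \<lambda>p. snd p]) F"
    unfolding F_def
    by (rule potential_machine.computes_approximation_formula[where B = B]) (simp_all add: Q_def m0_def)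
  \<comment> \<open>The program and the exponent are fixed here, before any \<open>n\<close> and
    \<open>\<epsilon>\<close> are chosen; this makes the constant of the running time
    uniform.\<close>
  obtain P D where P: "\<forall>n \<epsilon>. (n, \<epsilon>) \<in> {(n, \<epsilon>). 1 \<le> n \<and> 0 < \<epsilon> \<and> \<epsilon> < 1} \<longrightarrow>
    computes_within \<phi> l K P (input_memory n lam \<epsilon>) (F (n, \<epsilon>)) (real ((2 ^ (m0 (n, \<epsilon>)) ^ 3 + 2) ^ D))"
    by (rule potential_machine.computable_imp_program[OF F])
  show ?thesis
  proof (rule exI[of _ P], rule exI[of _ "ln 2 * (2 * real D) * (2 / ln 2) ^ 3"], intro allI impI)
    fix n :: nat and \<epsilon> :: real
    assume n: "1 \<le> n" and \<epsilon>: "0 < \<epsilon>" "\<epsilon> < 1"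
    let ?Y = "measure lebesgue (centered_cube (real n) :: (real ^ 'd) set) / \<epsilon>"
    have Y: "?Y = (2 * real n) ^ CARD('d) / \<epsilon>" using measure_centered_cube[of "real n", where 'd = 'd] by simp
    have "2 \<le> ?Y"
    proof -
      have "2 \<le> 2 * real n" using n by simp
      also have "\<dots> \<le> (2 * real n) ^ CARD('d)" using n by (intro self_le_power) auto
      also have "\<dots> * 1 \<le> (2 * real n) ^ CARD('d) * (1 / \<epsilon>)" using n \<epsilon> by (intro mult_left_mono) auto
      finally show ?thesis unfolding Y by simp
    qed
    from two_power_cube_le[OF this, of D]
    have time: "real ((2 ^ (m0 (n, \<epsilon>)) ^ 3 + 2) ^ D) \<le> exp (ln 2 * (2 * real D) * (2 / ln 2) ^ 3 * ln ?Y ^ 3)"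
      unfolding m0_def Y by simp
    have "computes_within \<phi> l K P (input_memory n lam \<epsilon>) (F (n, \<epsilon>)) (real ((2 ^ (m0 (n, \<epsilon>)) ^ 3 + 2) ^ D))"
      using P n \<epsilon> by blast
    hence "computes_within \<phi> l K P (input_memory n lam \<epsilon>) (F (n, \<epsilon>))
       (exp (ln 2 * (2 * real D) * (2 / ln 2) ^ 3 * ln ?Y ^ 3))"
      unfolding computes_within_def using time order_trans by blast
    moreover have "is_approximation \<epsilon> (F (n, \<epsilon>)) (partition_function \<phi> (centered_cube (real n)) lam)"
      using approx n \<epsilon> by (simp add: F_def Q_def m0_def)
    ultimately show "\<exists>Zhat. computes_within \<phi> l K P (input_memory n lam \<epsilon>) Zhat
        (exp (ln 2 * (2 * real D) * (2 / ln 2) ^ 3 * ln ?Y ^ 3)) \<and>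
      is_approximation \<epsilon> Zhat (partition_function \<phi> (centered_cube (real n)) lam)" by blast
  qed
qed

end
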